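(* Let $(\Sigma,\mathbb T)$ be a regular theory. Then one may define a regular calculus $(\mathbb C_{\mathbb T},F_{\mathbb T})$ where $\mathbb C_{\mathbb T}=\bigsqcup_{\Sigma\text{-sort}}\mathbb W$ is the coproduct of copies of $\mathbb W$ indexed by the sorts, and where $F_{\mathbb T}:\mathbb C_{\mathbb T}\to\mathbb P\mathsf{oset}$ sends each object, viewed as a context, to the poset of equivalence classes of regular formulae in that context quotiented by $\alpha$-equivalence.
   Context: A po-category is a 2-category whose hom-categories are posets; a po-functor is a functor monotone on homs; a symmetric monoidal po-category has a symmetric monoidal structure on its underlying category with $\otimes$ monotone. The po-prop $\mathbb W$: objects are the natural numbers $n$ (identified with $\underline n=\{1,\dots,n\}$). Hom-posets are the poset reflections of the categories of cospans of finite sets $\underline m\to S\leftarrow\underline n$, where $\omega\le\omega'$ iff there is a function from the apex of $\omega'$ to that of $\omega$ commuting with the legs. Composition is by pushout; the tensor is disjoint union with unit $0$. A supply of $\mathbb W$ in a symmetric monoidal po-category $\mathbb C$ is, for each object $c$, a strong symmetric monoidal po-functor $s_c:\mathbb W\to\mathbb C$ with $s_c(m)=c^{\otimes m}$ (left-bracketed), with strongators $c^{\otimes m}\otimes c^{\otimes n}\to c^{\otimes(m+n)}$ the associators, such that for all $\omega:m\to n$ in $\mathbb W$ and objects $c,d$, $(s_c(\omega)\otimes s_d(\omega))$ followed by the canonical symmetry $c^{\otimes n}\otimes d^{\otimes n}\cong(c\otimes d)^{\otimes n}$ equals the canonical symmetry followed by $s_{c\otimes d}(\omega)$, and $s_I(\omega)$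 is compatible with the canonical isomorphisms $I\cong I^{\otimes m}$, $I\cong I^{\otimes n}$. The coproduct $\bigsqcup_J\mathbb W$ is taken in symmetric monoidal po-categories: objects are families $(n_j)_{j\in J}$ of natural numbers, all but finitely many equal to $0$; morphisms are families of morphisms of $\mathbb W$, all but finitely many equal to $\mathrm{id}_0$; the structure is componentwise. It supplies $\mathbb W$ componentwise, using the supply of $\mathbb W$ in itself given by $s_k(\omega)=\omega+\dots+\omega$ ($k$ times) up to symmetry. A regular calculus $(\mathbb C,P)$ is a symmetric monoidal po-category $\mathbb C$ supplying $\mathbb W$ together with a right ajax po-functor $P:\mathbb C\to\mathbb P\mathsf{oset}$, that is, a lax symmetric monoidal po-functor (posets with cartesian product) whose laxators $1\to P(I)$ and $P(\Gamma_1)\times P(\Gamma_2)\to P(\Gamma_1\otimes\Gamma_2)$ are right adjoints. A regular theory $(\Sigma,\mathbb T)$ consists of a set $\Sigma$-sort of sorts, a set of relation symbols each with a finite list of sorts (no function symbols), and a set $\mathbb T$ of axioms: sequents $\varphi\vdash\psi$ between regular formulae in context. Regular formulae in a context (finite list of sorted variables) are built from relation symbols using $\top,\wedge,=,\exists$. An object $(n_\sigma)_\sigma$ of $\mathbb C_{\mathbb T}$ is viewed as the context with $n_\sigma$ variables of each sort $\sigma$. The set of regular formulae in a context, modulo $\alpha$-equivalence, is preordered by provability from $\mathbb T$ in regular logic in that context; the poset in question is the poset quotient of this preorder. *)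

theory Defs
  imports "HOL-Algebra.Galois_Connection" "HOL-Library.Nat_Bijection"
begin

section \<open>Symmetric monoidal po-categories\<close>

record ('o, 'a) smpo =
  Objs :: "'o set"
  Homs :: "'o \<Rightarrow> 'o \<Rightarrow> 'a set"
  Ident :: "'o \<Rightarrow> 'a"
  comp :: "'a \<Rightarrow> 'a \<Rightarrow> 'a"  (infixr \<open>\<cdot>\<index>\<close> 55)
  leq :: "'a \<Rightarrow> 'a \<Rightarrow> bool"  (infix \<open>\<preceq>\<index>\<close> 50)
  tensO :: "'o \<Rightarrow> 'o \<Rightarrow> 'o"  (infixl \<open>\<otimes>\<index>\<close> 70)
  tensA :: "'a \<Rightarrow> 'a \<Rightarrow> 'a"  (infixl \<open>\<boxtimes>\<index>\<close> 70)
  unitO :: "'o"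
  assoc :: "'o \<Rightarrow> 'o \<Rightarrow> 'o \<Rightarrow> 'a"
  lunit :: "'o \<Rightarrow> 'a"
  runit :: "'o \<Rightarrow> 'a"
  symm :: "'o \<Rightarrow> 'o \<Rightarrow> 'a"

text \<open>Composition is in applicative order: \<open>g \<cdot> f\<close> is \<open>f\<close> followed by \<open>g\<close>. The tensor is written
  \<open>\<otimes>\<close> on objects and \<open>\<boxtimes>\<close> on morphisms; \<open>assoc a b c\<close> goes from \<open>(a \<otimes> b) \<otimes> c\<close> to \<open>a \<otimes> (b \<otimes> c)\<close>.\<close>

locale po_category =
  fixes C :: "('o, 'a) smpo" (structure)
  assumes Homs_Objs: "f \<in> Homs C a b \<Longrightarrow> a \<in> Objs C \<and> b \<in> Objs C"
    and Homs_disjoint: "f \<in> Homs C a b \<Longrightarrow> f \<in> Homs C a' b' \<Longrightarrow> a = a' \<and> b = b'"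
    and Ident_in: "a \<in> Objs C \<Longrightarrow> Ident C a \<in> Homs C a a"
    and comp_in: "f \<in> Homs C a b \<Longrightarrow> g \<in> Homs C b c \<Longrightarrow> g \<cdot> f \<in> Homs C a c"
    and comp_Ident_left: "f \<in> Homs C a b \<Longrightarrow> Ident C b \<cdot> f = f"
    and comp_Ident_right: "f \<in> Homs C a b \<Longrightarrow> f \<cdot> Ident C a = f"
    and comp_assoc: "f \<in> Homs C a b \<Longrightarrow> g \<in> Homs C b c \<Longrightarrow> h \<in> Homs C c d \<Longrightarrow>
      (h \<cdot> g) \<cdot> f = h \<cdot> (g \<cdot> f)"
    and leq_refl: "f \<in> Homs C a b \<Longrightarrow> f \<preceq> f"
    and leq_antisym: "f \<in> Homs C a b \<Longrightarrow> g \<in> Homs C a b \<Longrightarrow> f \<preceq> g \<Longrightarrow> g \<preceq> f \<Longrightarrow> f = g"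
    and leq_trans: "f \<in> Homs C a b \<Longrightarrow> g \<in> Homs C a b \<Longrightarrow> h \<in> Homs C a b \<Longrightarrow>
      f \<preceq> g \<Longrightarrow> g \<preceq> h \<Longrightarrow> f \<preceq> h"
    and comp_mono: "f \<in> Homs C a b \<Longrightarrow> f' \<in> Homs C a b \<Longrightarrow> g \<in> Homs C b c \<Longrightarrow> g' \<in> Homs C b c \<Longrightarrow>
      f \<preceq> f' \<Longrightarrow> g \<preceq> g' \<Longrightarrow> g \<cdot> f \<preceq> g' \<cdot> f'"

definition inverse_arrs :: "('o, 'a) smpo \<Rightarrow> 'o \<Rightarrow> 'o \<Rightarrow> 'a \<Rightarrow> 'a \<Rightarrow> bool" where
  "inverse_arrs C a b f g \<longleftrightarrow> f \<in> Homs C a b \<and> g \<in> Homs C b a \<and>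
     g \<cdot>\<^bsub>C\<^esub> f = Ident C a \<and> f \<cdot>\<^bsub>C\<^esub> g = Ident C b"

definition iso_arr :: "('o, 'a) smpo \<Rightarrow> 'o \<Rightarrow> 'o \<Rightarrow> 'a \<Rightarrow> bool" where
  "iso_arr C a b f \<longleftrightarrow> (\<exists>g. inverse_arrs C a b f g)"

definition assoc_inv :: "('o, 'a) smpo \<Rightarrow> 'o \<Rightarrow> 'o \<Rightarrow> 'o \<Rightarrow> 'a" where
  "assoc_inv C a b c =
     (THE g. inverse_arrs C ((a \<otimes>\<^bsub>C\<^esub> b) \<otimes>\<^bsub>C\<^esub> c) (a \<otimes>\<^bsub>C\<^esub> (b \<otimes>\<^bsub>C\<^esub> c)) (assoc C a b c) g)"

locale sm_po_category = po_category C for C :: "('o, 'a) smpo" (structure) +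
  assumes unitO_in: "unitO C \<in> Objs C"
    and tensO_in: "a \<in> Objs C \<Longrightarrow> b \<in> Objs C \<Longrightarrow> a \<otimes> b \<in> Objs C"
    and tensA_in: "f \<in> Homs C a b \<Longrightarrow> g \<in> Homs C c d \<Longrightarrow> f \<boxtimes> g \<in> Homs C (a \<otimes> c) (b \<otimes> d)"
    and tensA_Ident: "a \<in> Objs C \<Longrightarrow> b \<in> Objs C \<Longrightarrow> Ident C a \<boxtimes> Ident C b = Ident C (a \<otimes> b)"
    and tensA_comp: "f \<in> Homs C a b \<Longrightarrow> f' \<in> Homs C b c \<Longrightarrow> g \<in> Homs C p q \<Longrightarrow> g' \<in> Homs C q r \<Longrightarrow>
      (f' \<cdot> f) \<boxtimes> (g' \<cdot> g) = (f' \<boxtimes> g') \<cdot> (f \<boxtimes> g)"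
    and tensA_mono: "f \<in> Homs C a b \<Longrightarrow> f' \<in> Homs C a b \<Longrightarrow> g \<in> Homs C c d \<Longrightarrow> g' \<in> Homs C c d \<Longrightarrow>
      f \<preceq> f' \<Longrightarrow> g \<preceq> g' \<Longrightarrow> f \<boxtimes> g \<preceq> f' \<boxtimes> g'"
    and assoc_iso: "a \<in> Objs C \<Longrightarrow> b \<in> Objs C \<Longrightarrow> c \<in> Objs C \<Longrightarrow>
      iso_arr C ((a \<otimes> b) \<otimes> c) (a \<otimes> (b \<otimes> c)) (assoc C a b c)"
    and lunit_iso: "a \<in> Objs C \<Longrightarrow> iso_arr C (unitO C \<otimes> a) a (lunit C a)"
    and runit_iso: "a \<in> Objs C \<Longrightarrow> iso_arr C (a \<otimes> unitO C) a (runit C a)"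
    and symm_in: "a \<in> Objs C \<Longrightarrow> b \<in> Objs C \<Longrightarrow> symm C a b \<in> Homs C (a \<otimes> b) (b \<otimes> a)"
    and symm_symm: "a \<in> Objs C \<Longrightarrow> b \<in> Objs C \<Longrightarrow> symm C b a \<cdot> symm C a b = Ident C (a \<otimes> b)"
    and assoc_natural: "f \<in> Homs C a a' \<Longrightarrow> g \<in> Homs C b b' \<Longrightarrow> h \<in> Homs C c c' \<Longrightarrow>
      assoc C a' b' c' \<cdot> ((f \<boxtimes> g) \<boxtimes> h) = (f \<boxtimes> (g \<boxtimes> h)) \<cdot> assoc C a b c"
    and lunit_natural: "f \<in> Homs C a b \<Longrightarrow> lunit C b \<cdot> (Ident C (unitO C) \<boxtimes> f) = f \<cdot> lunit C a"
    and runit_natural: "f \<in> Homs C a b \<Longrightarrow> runit C b \<cdot> (f \<boxtimes> Ident C (unitO C)) = f \<cdot> runit C a"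
    and symm_natural: "f \<in> Homs C a a' \<Longrightarrow> g \<in> Homs C b b' \<Longrightarrow>
      symm C a' b' \<cdot> (f \<boxtimes> g) = (g \<boxtimes> f) \<cdot> symm C a b"
    and pentagon: "a \<in> Objs C \<Longrightarrow> b \<in> Objs C \<Longrightarrow> c \<in> Objs C \<Longrightarrow> d \<in> Objs C \<Longrightarrow>
      assoc C a b (c \<otimes> d) \<cdot> assoc C (a \<otimes> b) c d =
      (Ident C a \<boxtimes> assoc C b c d) \<cdot> assoc C a (b \<otimes> c) d \<cdot> (assoc C a b c \<boxtimes> Ident C d)"
    and triangle: "a \<in> Objs C \<Longrightarrow> b \<in> Objs C \<Longrightarrow>
      (Ident C a \<boxtimes> lunit C b) \<cdot> assoc C a (unitO C) b = runit C a \<boxtimes> Ident C b"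
    and hexagon: "a \<in> Objs C \<Longrightarrow> b \<in> Objs C \<Longrightarrow> c \<in> Objs C \<Longrightarrow>
      assoc C b c a \<cdot> symm C a (b \<otimes> c) \<cdot> assoc C a b c =
      (Ident C b \<boxtimes> symm C a c) \<cdot> assoc C b a c \<cdot> (symm C a b \<boxtimes> Ident C c)"

locale strong_sm_po_functor = A: sm_po_category A + B: sm_po_category B
  for A :: "('o, 'a) smpo" and B :: "('p, 'b) smpo" +
  fixes Fo :: "'o \<Rightarrow> 'p" and Fa :: "'a \<Rightarrow> 'b"
    and mu :: "'o \<Rightarrow> 'o \<Rightarrow> 'b" and eps :: "'b"
  assumes Fo_in: "a \<in> Objs A \<Longrightarrow> Fo a \<in> Objs B"
    and Fa_in: "f \<in> Homs A a b \<Longrightarrow> Fa f \<in> Homs B (Fo a) (Fo b)"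
    and Fa_Ident: "a \<in> Objs A \<Longrightarrow> Fa (Ident A a) = Ident B (Fo a)"
    and Fa_comp: "f \<in> Homs A a b \<Longrightarrow> g \<in> Homs A b c \<Longrightarrow> Fa (g \<cdot>\<^bsub>A\<^esub> f) = Fa g \<cdot>\<^bsub>B\<^esub> Fa f"
    and Fa_mono: "f \<in> Homs A a b \<Longrightarrow> g \<in> Homs A a b \<Longrightarrow> f \<preceq>\<^bsub>A\<^esub> g \<Longrightarrow> Fa f \<preceq>\<^bsub>B\<^esub> Fa g"
    and mu_iso: "a \<in> Objs A \<Longrightarrow> b \<in> Objs A \<Longrightarrow>
      iso_arr B (Fo a \<otimes>\<^bsub>B\<^esub> Fo b) (Fo (a \<otimes>\<^bsub>A\<^esub> b)) (mu a b)"
    and eps_iso: "iso_arr B (unitO B) (Fo (unitO A)) eps"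
    and mu_natural: "f \<in> Homs A a a' \<Longrightarrow> g \<in> Homs A b b' \<Longrightarrow>
      mu a' b' \<cdot>\<^bsub>B\<^esub> (Fa f \<boxtimes>\<^bsub>B\<^esub> Fa g) = Fa (f \<boxtimes>\<^bsub>A\<^esub> g) \<cdot>\<^bsub>B\<^esub> mu a b"
    and mu_assoc: "a \<in> Objs A \<Longrightarrow> b \<in> Objs A \<Longrightarrow> c \<in> Objs A \<Longrightarrow>
      Fa (assoc A a b c) \<cdot>\<^bsub>B\<^esub> mu (a \<otimes>\<^bsub>A\<^esub> b) c \<cdot>\<^bsub>B\<^esub> (mu a b \<boxtimes>\<^bsub>B\<^esub> Ident B (Fo c)) =
      mu a (b \<otimes>\<^bsub>A\<^esub> c) \<cdot>\<^bsub>B\<^esub> (Ident B (Fo a) \<boxtimes>\<^bsub>B\<^esub> mu b c) \<cdot>\<^bsub>B\<^esub> assoc B (Fo a) (Fo b) (Fo c)"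
    and mu_lunit: "a \<in> Objs A \<Longrightarrow>
      Fa (lunit A a) \<cdot>\<^bsub>B\<^esub> mu (unitO A) a \<cdot>\<^bsub>B\<^esub> (eps \<boxtimes>\<^bsub>B\<^esub> Ident B (Fo a)) = lunit B (Fo a)"
    and mu_runit: "a \<in> Objs A \<Longrightarrow>
      Fa (runit A a) \<cdot>\<^bsub>B\<^esub> mu a (unitO A) \<cdot>\<^bsub>B\<^esub> (Ident B (Fo a) \<boxtimes>\<^bsub>B\<^esub> eps) = runit B (Fo a)"
    and mu_symm: "a \<in> Objs A \<Longrightarrow> b \<in> Objs A \<Longrightarrow>
      Fa (symm A a b) \<cdot>\<^bsub>B\<^esub> mu a b = mu b a \<cdot>\<^bsub>B\<^esub> symm B (Fo a) (Fo b)"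


section \<open>Tensor powers and their canonical isomorphisms\<close>

text \<open>The power is left-bracketed with \<open>c\<^sup>\<otimes>\<^sup>0 = I\<close> and \<open>c\<^sup>\<otimes>\<^sup>1 = c\<close> on the nose.\<close>

fun tpow :: "('o, 'a) smpo \<Rightarrow> 'o \<Rightarrow> nat \<Rightarrow> 'o" where
  "tpow C c 0 = unitO C"
| "tpow C c (Suc 0) = c"
| "tpow C c (Suc (Suc n)) = tpow C c (Suc n) \<otimes>\<^bsub>C\<^esub> c"

text \<open>\<open>c\<^sup>\<otimes>\<^sup>m \<otimes> c\<^sup>\<otimes>\<^sup>n \<rightarrow> c\<^sup>\<otimes>\<^sup>(\<^sup>m\<^sup>+\<^sup>n\<^sup>)\<close>\<close>

fun tpow_add :: "('o, 'a) smpo \<Rightarrow> 'o \<Rightarrow> nat \<Rightarrow> nat \<Rightarrow> 'a" where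
  "tpow_add C c m 0 = runit C (tpow C c m)"
| "tpow_add C c 0 (Suc n) = lunit C (tpow C c (Suc n))"
| "tpow_add C c (Suc m) (Suc 0) = Ident C (tpow C c (Suc m) \<otimes>\<^bsub>C\<^esub> c)"
| "tpow_add C c (Suc m) (Suc (Suc n)) =
     (tpow_add C c (Suc m) (Suc n) \<boxtimes>\<^bsub>C\<^esub> Ident C c) \<cdot>\<^bsub>C\<^esub>
     assoc_inv C (tpow C c (Suc m)) (tpow C c (Suc n)) c"

text \<open>\<open>(a \<otimes> b) \<otimes> (c \<otimes> d) \<rightarrow> (a \<otimes> c) \<otimes> (b \<otimes> d)\<close>\<close>

definition middle_swap :: "('o, 'a) smpo \<Rightarrow> 'o \<Rightarrow> 'o \<Rightarrow> 'o \<Rightarrow> 'o \<Rightarrow> 'a" where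
  "middle_swap C a b c d =
     assoc_inv C a c (b \<otimes>\<^bsub>C\<^esub> d) \<cdot>\<^bsub>C\<^esub>
     (Ident C a \<boxtimes>\<^bsub>C\<^esub> assoc C c b d) \<cdot>\<^bsub>C\<^esub>
     (Ident C a \<boxtimes>\<^bsub>C\<^esub> (symm C b c \<boxtimes>\<^bsub>C\<^esub> Ident C d)) \<cdot>\<^bsub>C\<^esub>
     (Ident C a \<boxtimes>\<^bsub>C\<^esub> assoc_inv C b c d) \<cdot>\<^bsub>C\<^esub>
     assoc C a b (c \<otimes>\<^bsub>C\<^esub> d)"

text \<open>\<open>c\<^sup>\<otimes>\<^sup>n \<otimes> d\<^sup>\<otimes>\<^sup>n \<rightarrow> (c \<otimes> d)\<^sup>\<otimes>\<^sup>n\<close>\<close>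

fun tpow_zip :: "('o, 'a) smpo \<Rightarrow> 'o \<Rightarrow> 'o \<Rightarrow> nat \<Rightarrow> 'a" where
  "tpow_zip C c d 0 = lunit C (unitO C)"
| "tpow_zip C c d (Suc 0) = Ident C (c \<otimes>\<^bsub>C\<^esub> d)"
| "tpow_zip C c d (Suc (Suc n)) =
     (tpow_zip C c d (Suc n) \<boxtimes>\<^bsub>C\<^esub> Ident C (c \<otimes>\<^bsub>C\<^esub> d)) \<cdot>\<^bsub>C\<^esub>
     middle_swap C (tpow C c (Suc n)) c (tpow C d (Suc n)) d"

text \<open>\<open>I\<^sup>\<otimes>\<^sup>n \<rightarrow> I\<close>\<close>

fun tpow_unit :: "('o, 'a) smpo \<Rightarrow> nat \<Rightarrow> 'a" where
  "tpow_unit C 0 = Ident C (unitO C)"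
| "tpow_unit C (Suc 0) = Ident C (unitO C)"
| "tpow_unit C (Suc (Suc n)) = tpow_unit C (Suc n) \<cdot>\<^bsub>C\<^esub> runit C (tpow C (unitO C) (Suc n))"


section \<open>The po-prop of cospans\<close>

definition refl_class :: "'a set \<Rightarrow> ('a \<Rightarrow> 'a \<Rightarrow> bool) \<Rightarrow> 'a \<Rightarrow> 'a set" where
  "refl_class A R x = {y \<in> A. R x y \<and> R y x}"

definition poset_reflection :: "'a set \<Rightarrow> ('a \<Rightarrow> 'a \<Rightarrow> bool) \<Rightarrow> 'a set gorder" where
  "poset_reflection A R =
     \<lparr>carrier = refl_class A R ` A, eq = (=), le = (\<lambda>X Y. \<exists>x\<in>X. \<exists>y\<in>Y. R x y)\<rparr>"

text \<open>A cospan \<open>m \<rightarrow> S \<leftarrow> n\<close> is a triple \<open>(S, xs, ys)\<close> with \<open>S\<close> a finite set of natural numbers; a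
  function out of \<open>{1..m}\<close> is encoded by the list of length \<open>m\<close> of its values. Apexes outside the
  natural numbers contribute nothing new, since every finite set is isomorphic to one of these.\<close>

type_synonym cospan = "nat set \<times> nat list \<times> nat list"

definition cospans :: "nat \<Rightarrow> nat \<Rightarrow> cospan set" where
  "cospans m n = {(S, xs, ys). finite S \<and> length xs = m \<and> length ys = n \<and> set xs \<subseteq> S \<and> set ys \<subseteq> S}"

fun cospan_le :: "cospan \<Rightarrow> cospan \<Rightarrow> bool" where
  "cospan_le (S, xs, ys) (S', xs', ys') \<longleftrightarrow> (\<exists>h \<in> S' \<rightarrow> S. map h xs' = xs \<and> map h ys' = ys)"

fun cospan_class :: "cospan \<Rightarrow> cospan set" where
  "cospan_class (S, xs, ys) = refl_class (cospans (length xs) (length ys)) cospan_le (S, xs, ys)"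

text \<open>The square with sides \<open>ys : n \<rightarrow> S\<close>, \<open>xs : n \<rightarrow> T\<close>, \<open>p : S \<rightarrow> U\<close>, \<open>q : T \<rightarrow> U\<close> is a pushout.\<close>

definition is_pushout ::
  "nat list \<Rightarrow> nat list \<Rightarrow> nat set \<Rightarrow> nat set \<Rightarrow> nat set \<Rightarrow> (nat \<Rightarrow> nat) \<Rightarrow> (nat \<Rightarrow> nat) \<Rightarrow> bool" where
  "is_pushout ys xs S T U p q \<longleftrightarrow>
     finite U \<and> p \<in> S \<rightarrow> U \<and> q \<in> T \<rightarrow> U \<and> map p ys = map q xs \<and>
     (\<forall>(V :: nat set) p' q'. finite V \<and> p' \<in> S \<rightarrow> V \<and> q' \<in> T \<rightarrow> V \<and> map p' ys = map q' xs \<longrightarrow>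
        (\<exists>!h. h \<in> U \<rightarrow>\<^sub>E V \<and> (\<forall>s\<in>S. h (p s) = p' s) \<and> (\<forall>t\<in>T. h (q t) = q' t)))"

fun pushout_composite :: "cospan \<Rightarrow> cospan \<Rightarrow> cospan \<Rightarrow> bool" where
  "pushout_composite (S, xs, ys) (T, xs', ys') w \<longleftrightarrow>
     (\<exists>U p q. is_pushout ys xs' S T U p q \<and> w = (U, map p xs, map q ys'))"

fun cospan_sum :: "cospan \<Rightarrow> cospan \<Rightarrow> cospan" where
  "cospan_sum (S, xs, ys) (T, xs', ys') =
     (sum_encode ` (S <+> T),
      map (\<lambda>s. sum_encode (Inl s)) xs @ map (\<lambda>t. sum_encode (Inr t)) xs',
      map (\<lambda>s. sum_encode (Inl s)) ys @ map (\<lambda>t. sum_encode (Inr t)) ys')"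

definition id_cospan :: "nat \<Rightarrow> cospan" where
  "id_cospan n = ({0..<n}, [0..<n], [0..<n])"

definition WW :: "(nat, cospan set) smpo" where
  "WW = \<lparr>
     Objs = UNIV,
     Homs = (\<lambda>m n. carrier (poset_reflection (cospans m n) cospan_le)),
     Ident = (\<lambda>n. cospan_class (id_cospan n)),
     comp = (\<lambda>Y X. \<Union>{cospan_class w | w. \<exists>x\<in>X. \<exists>y\<in>Y. pushout_composite x y w}),
     leq = (\<lambda>X Y. \<exists>x\<in>X. \<exists>y\<in>Y. cospan_le x y),
     tensO = (+),
     tensA = (\<lambda>X Y. \<Union>{cospan_class (cospan_sum x y) | x y. x \<in> X \<and> y \<in> Y}),
     unitO = 0,
     assoc = (\<lambda>a b c. cospan_class (id_cospan (a + b + c))),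
     lunit = (\<lambda>n. cospan_class (id_cospan n)),
     runit = (\<lambda>n. cospan_class (id_cospan n)),
     symm = (\<lambda>m n. cospan_class ({0..<m+n}, [0..<m+n], [m..<m+n] @ [0..<m]))\<rparr>"


section \<open>Supplies of the cospan prop\<close>

locale supplies_WW = sm_po_category C for C :: "('o, 'a) smpo" (structure) +
  fixes s :: "'o \<Rightarrow> cospan set \<Rightarrow> 'a"
  assumes supply_functor: "c \<in> Objs C \<Longrightarrow>
      strong_sm_po_functor WW C (tpow C c) (s c) (tpow_add C c) (Ident C (unitO C))"
    and supply_tens: "c \<in> Objs C \<Longrightarrow> d \<in> Objs C \<Longrightarrow> \<omega> \<in> Homs WW m n \<Longrightarrow>
      tpow_zip C c d n \<cdot> (s c \<omega> \<boxtimes> s d \<omega>) = s (c \<otimes> d) \<omega> \<cdot> tpow_zip C c d m"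
    and supply_unit: "\<omega> \<in> Homs WW m n \<Longrightarrow> tpow_unit C n \<cdot> s (unitO C) \<omega> = tpow_unit C m"


section \<open>Coproducts of copies of the cospan prop\<close>

definition coprod_WW :: "'j set \<Rightarrow> ('j \<Rightarrow> nat, 'j \<Rightarrow> cospan set) smpo" where
  "coprod_WW J = \<lparr>
     Objs = {n. finite {j. n j \<noteq> 0} \<and> {j. n j \<noteq> 0} \<subseteq> J},
     Homs = (\<lambda>m n. {f. finite {j. m j \<noteq> 0} \<and> {j. m j \<noteq> 0} \<subseteq> J \<and>
                        finite {j. n j \<noteq> 0} \<and> {j. n j \<noteq> 0} \<subseteq> J \<and>
                        (\<forall>j. f j \<in> Homs WW (m j) (n j)) \<and>
                        finite {j. f j \<noteq> Ident WW 0} \<and> {j. f j \<noteq> Ident WW 0} \<subseteq> J}),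
     Ident = (\<lambda>n j. Ident WW (n j)),
     comp = (\<lambda>g f j. g j \<cdot>\<^bsub>WW\<^esub> f j),
     leq = (\<lambda>f g. \<forall>j. f j \<preceq>\<^bsub>WW\<^esub> g j),
     tensO = (\<lambda>m n j. m j \<otimes>\<^bsub>WW\<^esub> n j),
     tensA = (\<lambda>f g j. f j \<boxtimes>\<^bsub>WW\<^esub> g j),
     unitO = (\<lambda>j. unitO WW),
     assoc = (\<lambda>a b c j. assoc WW (a j) (b j) (c j)),
     lunit = (\<lambda>n j. lunit WW (n j)),
     runit = (\<lambda>n j. runit WW (n j)),
     symm = (\<lambda>m n j. symm WW (m j) (n j))\<rparr>"

text \<open>The supply of the prop in itself: \<open>k\<close> disjoint copies of a cospan \<open>m \<rightarrow> S \<leftarrow> n\<close>, with apex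
  \<open>S \<times> k\<close>. The tensor power \<open>k\<^sup>\<otimes>\<^sup>m = k + \<dots> + k\<close> consists of \<open>m\<close> blocks of length \<open>k\<close>, so the legs list
  the copies of the first point, then those of the second, and so on; this is the symmetry relating
  them to the legs of the \<open>k\<close>-fold sum.\<close>

definition copies :: "nat \<Rightarrow> nat list \<Rightarrow> nat list" where
  "copies k xs = concat (map (\<lambda>x. map (\<lambda>r. prod_encode (x, r)) [0..<k]) xs)"

fun cospan_copies :: "nat \<Rightarrow> cospan \<Rightarrow> cospan" where
  "cospan_copies k (S, xs, ys) = (prod_encode ` (S \<times> {0..<k}), copies k xs, copies k ys)"

definition WW_supply :: "nat \<Rightarrow> cospan set \<Rightarrow> cospan set" where
  "WW_supply k X = \<Union>{cospan_class (cospan_copies k x) | x. x \<in> X}"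

definition coprod_supply :: "('j \<Rightarrow> nat) \<Rightarrow> cospan set \<Rightarrow> 'j \<Rightarrow> cospan set" where
  "coprod_supply c \<omega> = (\<lambda>j. WW_supply (c j) \<omega>)"


section \<open>Regular calculi\<close>

definition unit_poset :: "unit gorder" where
  "unit_poset = \<lparr>carrier = UNIV, eq = (=), le = (\<lambda>_ _. True)\<rparr>"

definition prod_poset :: "'p gorder \<Rightarrow> 'q gorder \<Rightarrow> ('p \<times> 'q) gorder" where
  "prod_poset A B = \<lparr>carrier = carrier A \<times> carrier B, eq = (=),
     le = (\<lambda>x y. fst x \<sqsubseteq>\<^bsub>A\<^esub> fst y \<and> snd x \<sqsubseteq>\<^bsub>B\<^esub> snd y)\<rparr>"

definition monotone_map :: "'p gorder \<Rightarrow> 'q gorder \<Rightarrow> ('p \<Rightarrow> 'q) \<Rightarrow> bool" where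
  "monotone_map A B f \<longleftrightarrow> f \<in> carrier A \<rightarrow> carrier B \<and> isotone A B f"

definition right_adjoint :: "'p gorder \<Rightarrow> 'q gorder \<Rightarrow> ('p \<Rightarrow> 'q) \<Rightarrow> bool" where
  "right_adjoint A B r \<longleftrightarrow>
     (\<exists>l. galois_connection \<lparr>orderA = B, orderB = A, lower = l, upper = r\<rparr>)"

text \<open>Data of a lax monoidal functor into posets: its action on objects and morphisms and its two
  laxators. The category of posets has no fixed type of elements closed under products, so
  the functor laws below are those of a lax symmetric monoidal functor to
  (posets, \<open>\<times>\<close>, \<open>1\<close>) spelled out on elements; maps matter only on the carriers.\<close>

record ('o, 'a, 'p) lax_poset_functor =
  PObj :: "'o \<Rightarrow> 'p gorder"
  PArr :: "'a \<Rightarrow> 'p \<Rightarrow> 'p"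
  laxator :: "'o \<Rightarrow> 'o \<Rightarrow> 'p \<times> 'p \<Rightarrow> 'p"
  unit_laxator :: "unit \<Rightarrow> 'p"

locale right_ajax = sm_po_category C for C :: "('o, 'a) smpo" (structure) +
  fixes P :: "('o, 'a, 'p) lax_poset_functor"
  assumes PObj_poset: "c \<in> Objs C \<Longrightarrow> partial_order (PObj P c)"
    and PArr_monotone: "f \<in> Homs C c d \<Longrightarrow> monotone_map (PObj P c) (PObj P d) (PArr P f)"
    and PArr_Ident: "c \<in> Objs C \<Longrightarrow> x \<in> carrier (PObj P c) \<Longrightarrow> PArr P (Ident C c) x = x"
    and PArr_comp: "f \<in> Homs C c d \<Longrightarrow> g \<in> Homs C d e \<Longrightarrow> x \<in> carrier (PObj P c) \<Longrightarrow>
      PArr P (g \<cdot> f) x = PArr P g (PArr P f x)"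
    and PArr_mono: "f \<in> Homs C c d \<Longrightarrow> g \<in> Homs C c d \<Longrightarrow> f \<preceq> g \<Longrightarrow> x \<in> carrier (PObj P c) \<Longrightarrow>
      PArr P f x \<sqsubseteq>\<^bsub>PObj P d\<^esub> PArr P g x"
    and laxator_monotone: "c \<in> Objs C \<Longrightarrow> d \<in> Objs C \<Longrightarrow>
      monotone_map (prod_poset (PObj P c) (PObj P d)) (PObj P (c \<otimes> d)) (laxator P c d)"
    and unit_laxator_monotone: "monotone_map unit_poset (PObj P (unitO C)) (unit_laxator P)"
    and laxator_natural: "f \<in> Homs C c c' \<Longrightarrow> g \<in> Homs C d d' \<Longrightarrow>
      x \<in> carrier (PObj P c) \<Longrightarrow> y \<in> carrier (PObj P d) \<Longrightarrow>
      laxator P c' d' (PArr P f x, PArr P g y) = PArr P (f \<boxtimes> g) (laxator P c d (x, y))"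
    and laxator_assoc: "c \<in> Objs C \<Longrightarrow> d \<in> Objs C \<Longrightarrow> e \<in> Objs C \<Longrightarrow>
      x \<in> carrier (PObj P c) \<Longrightarrow> y \<in> carrier (PObj P d) \<Longrightarrow> z \<in> carrier (PObj P e) \<Longrightarrow>
      PArr P (assoc C c d e) (laxator P (c \<otimes> d) e (laxator P c d (x, y), z)) =
      laxator P c (d \<otimes> e) (x, laxator P d e (y, z))"
    and laxator_lunit: "c \<in> Objs C \<Longrightarrow> x \<in> carrier (PObj P c) \<Longrightarrow>
      PArr P (lunit C c) (laxator P (unitO C) c (unit_laxator P (), x)) = x"
    and laxator_runit: "c \<in> Objs C \<Longrightarrow> x \<in> carrier (PObj P c) \<Longrightarrow>
      PArr P (runit C c) (laxator P c (unitO C) (x, unit_laxator P ())) = x"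
    and laxator_symm: "c \<in> Objs C \<Longrightarrow> d \<in> Objs C \<Longrightarrow>
      x \<in> carrier (PObj P c) \<Longrightarrow> y \<in> carrier (PObj P d) \<Longrightarrow>
      PArr P (symm C c d) (laxator P c d (x, y)) = laxator P d c (y, x)"
    and laxator_right_adjoint: "c \<in> Objs C \<Longrightarrow> d \<in> Objs C \<Longrightarrow>
      right_adjoint (prod_poset (PObj P c) (PObj P d)) (PObj P (c \<otimes> d)) (laxator P c d)"
    and unit_laxator_right_adjoint:
      "right_adjoint unit_poset (PObj P (unitO C)) (unit_laxator P)"

locale regular_calculus = supplies_WW C s + right_ajax C P
  for C :: "('o, 'a) smpo" (structure) and s :: "'o \<Rightarrow> cospan set \<Rightarrow> 'a"
    and P :: "('o, 'a, 'p) lax_poset_functor"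


section \<open>Regular theories\<close>

text \<open>A context is a list of sorts, one for each of its variables. Formulae use de Bruijn indices
  (variable \<open>i\<close> is the \<open>i\<close>-th entry of the context, and \<open>Ex s\<close> prepends a variable of sort \<open>s\<close>), so
  that \<open>\<alpha>\<close>-equivalent formulae in context are equal.\<close>

datatype ('s, 'r) formula =
    Top
  | Conj "('s, 'r) formula" "('s, 'r) formula"
  | Equal nat nat
  | Rel 'r "nat list"
  | Ex 's "('s, 'r) formula"

type_synonym ('s, 'r) sequent = "'s list \<times> ('s, 'r) formula \<times> ('s, 'r) formula"

record ('s, 'r) reg_theory =
  sorts :: "'s set"
  relsyms :: "'r set"
  arity :: "'r \<Rightarrow> 's list"
  theory_axioms :: "('s, 'r) sequent set"

primrec formula_in :: "('s, 'r) reg_theory \<Rightarrow> 's list \<Rightarrow> ('s, 'r) formula \<Rightarrow> bool" where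
  "formula_in T \<Gamma> Top \<longleftrightarrow> set \<Gamma> \<subseteq> sorts T"
| "formula_in T \<Gamma> (Conj \<phi> \<psi>) \<longleftrightarrow> formula_in T \<Gamma> \<phi> \<and> formula_in T \<Gamma> \<psi>"
| "formula_in T \<Gamma> (Equal i j) \<longleftrightarrow>
     set \<Gamma> \<subseteq> sorts T \<and> i < length \<Gamma> \<and> j < length \<Gamma> \<and> \<Gamma> ! i = \<Gamma> ! j"
| "formula_in T \<Gamma> (Rel R is) \<longleftrightarrow>
     set \<Gamma> \<subseteq> sorts T \<and> R \<in> relsyms T \<and> (\<forall>i\<in>set is. i < length \<Gamma>) \<and> map ((!) \<Gamma>) is = arity T R"
| "formula_in T \<Gamma> (Ex s \<phi>) \<longleftrightarrow> formula_in T (s # \<Gamma>) \<phi>"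

locale regular_theory =
  fixes T :: "('s, 'r) reg_theory"
  assumes arity_sorts: "R \<in> relsyms T \<Longrightarrow> set (arity T R) \<subseteq> sorts T"
    and axioms_wf: "(\<Gamma>, \<phi>, \<psi>) \<in> theory_axioms T \<Longrightarrow> formula_in T \<Gamma> \<phi> \<and> formula_in T \<Gamma> \<psi>"

primrec rename :: "(nat \<Rightarrow> nat) \<Rightarrow> ('s, 'r) formula \<Rightarrow> ('s, 'r) formula" where
  "rename f Top = Top"
| "rename f (Conj \<phi> \<psi>) = Conj (rename f \<phi>) (rename f \<psi>)"
| "rename f (Equal i j) = Equal (f i) (f j)"
| "rename f (Rel R is) = Rel R (map f is)"
| "rename f (Ex s \<phi>) = Ex s (rename (case_nat 0 (\<lambda>i. Suc (f i))) \<phi>)"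

text \<open>Sequents \<open>\<phi> \<turnstile>\<^sub>\<Gamma> \<psi>\<close> derivable from the axioms. There are no function symbols, so terms are
  variables and substitution is sort-preserving renaming; \<open>rename Suc\<close> is weakening by a fresh
  first variable.\<close>

inductive provable ::
  "('s, 'r) reg_theory \<Rightarrow> 's list \<Rightarrow> ('s, 'r) formula \<Rightarrow> ('s, 'r) formula \<Rightarrow> bool"
  for T :: "('s, 'r) reg_theory" where
  Axiom: "(\<Gamma>, \<phi>, \<psi>) \<in> theory_axioms T \<Longrightarrow> provable T \<Gamma> \<phi> \<psi>"
| Identity: "formula_in T \<Gamma> \<phi> \<Longrightarrow> provable T \<Gamma> \<phi> \<phi>"
| Cut: "provable T \<Gamma> \<phi> \<psi> \<Longrightarrow> provable T \<Gamma> \<psi> \<chi> \<Longrightarrow> provable T \<Gamma> \<phi> \<chi>"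
| Substitution: "provable T \<Gamma> \<phi> \<psi> \<Longrightarrow> set \<Delta> \<subseteq> sorts T \<Longrightarrow>
    (\<And>i. i < length \<Gamma> \<Longrightarrow> f i < length \<Delta> \<and> \<Delta> ! f i = \<Gamma> ! i) \<Longrightarrow>
    provable T \<Delta> (rename f \<phi>) (rename f \<psi>)"
| Top_intro: "formula_in T \<Gamma> \<phi> \<Longrightarrow> provable T \<Gamma> \<phi> Top"
| Conj_left: "formula_in T \<Gamma> \<phi> \<Longrightarrow> formula_in T \<Gamma> \<psi> \<Longrightarrow> provable T \<Gamma> (Conj \<phi> \<psi>) \<phi>"
| Conj_right: "formula_in T \<Gamma> \<phi> \<Longrightarrow> formula_in T \<Gamma> \<psi> \<Longrightarrow> provable T \<Gamma> (Conj \<phi> \<psi>) \<psi>"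
| Conj_intro: "provable T \<Gamma> \<phi> \<psi> \<Longrightarrow> provable T \<Gamma> \<phi> \<chi> \<Longrightarrow> provable T \<Gamma> \<phi> (Conj \<psi> \<chi>)"
| Equal_refl: "formula_in T \<Gamma> (Equal i i) \<Longrightarrow> provable T \<Gamma> Top (Equal i i)"
| Equal_subst: "formula_in T \<Gamma> (Equal i j) \<Longrightarrow> formula_in T \<Gamma> \<phi> \<Longrightarrow>
    provable T \<Gamma> (Conj (Equal i j) \<phi>) (rename (id(i := j)) \<phi>)"
| Ex_left: "formula_in T \<Gamma> \<psi> \<Longrightarrow> provable T (s # \<Gamma>) \<phi> (rename Suc \<psi>) \<Longrightarrow> provable T \<Gamma> (Ex s \<phi>) \<psi>"
| Ex_right: "provable T \<Gamma> (Ex s \<phi>) \<psi> \<Longrightarrow> provable T (s # \<Gamma>) \<phi> (rename Suc \<psi>)"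
| Frobenius: "formula_in T \<Gamma> \<phi> \<Longrightarrow> formula_in T (s # \<Gamma>) \<psi> \<Longrightarrow>
    provable T \<Gamma> (Conj \<phi> (Ex s \<psi>)) (Ex s (Conj (rename Suc \<phi>) \<psi>))"

definition formula_poset :: "('s, 'r) reg_theory \<Rightarrow> 's list \<Rightarrow> ('s, 'r) formula set gorder" where
  "formula_poset T \<Gamma> = poset_reflection {\<phi>. formula_in T \<Gamma> \<phi>} (provable T \<Gamma>)"

text \<open>A listing of \<open>n \<sigma>\<close> variables of each sort \<open>\<sigma>\<close>; it exists when \<open>n\<close> has finite support, and the
  sorts are not ordered, so an arbitrary listing is chosen.\<close>

definition context_of :: "('s \<Rightarrow> nat) \<Rightarrow> 's list" where
  "context_of n = (SOME \<Gamma>. \<forall>\<sigma>. count_list \<Gamma> \<sigma> = n \<sigma>)"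

end

theory Submission
  imports Defs
begin

text \<open>Two faithful translations remove all pushouts and all quantifier bookkeeping. A cospan
  \<open>xs : m \<rightarrow> S \<leftarrow> n : ys\<close> defines, for every set \<open>V\<close>, the relation \<open>{(h \<circ> xs, h \<circ> ys) | h : S \<rightarrow> V}\<close> between lists
  of length \<open>m\<close> and \<open>n\<close> over \<open>V\<close>. Inclusion of these relations for all finite \<open>V\<close> is the order of the
  hom-posets, pushouts become composites of relations, sums become concatenation, and the \<open>k\<close>-fold
  copy of a cospan becomes its relation over \<open>V\<^sup>k\<close>; so every law of the prop and of its supply is an identity
  between relations on lists.

  For a morphism \<open>\<omega>\<close> and a formula \<open>\<phi>\<close> the functor takes the formula \<open>\<exists>s. \<phi>(s \<circ> xs) \<and> y = s \<circ> ys\<close>. It is used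
  only through its universal property: it entails \<open>\<psi>\<close> iff \<open>\<phi>[a] \<turnstile> \<psi>[b]\<close> in every context, for
  every pair \<open>(a, b)\<close> of tuples of its variables related by \<open>\<omega>\<close>. With the Frobenius and Beck-Chevalley
  properties built into this characterization, functoriality and the monoidal laws follow from
  the calculus of relations and the Yoneda lemma for posets.\<close>

section \<open>Cospans as relations on value lists\<close>

text \<open>The obstacle is choice: hom-sets consist of classes, and apexes and contexts are picked
  arbitrarily. Both translations are complete invariants, so representatives need not be compared
  with each other. Value sets may have any type, because formulae use the variables of a context as
  values and the supply uses lists; but pushouts are universal only against finite sets of naturals,
  which forces a transport along an injection. Gluing is done without quotients: for finitely many
  pairs, \<open>representatives\<close> gives a function that equates each pair and moves every
  point only within any equivalence containing the pairs. The apex of a pushout is an image of such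
  a function; in the logic the same function collapses provably equal variables. The universal
  property of a pushed formula carries a side formula because naturality of the laxator needs one,
  and a change of context because composition needs it. The laxators are conjunctions of formulae in
  separate variables, so their left adjoints come from existential quantification along the two
  inclusions of variables.\<close>

lemma representatives:
  fixes E :: "('a \<times> 'a) list"
  shows "\<exists>r. (\<forall>(a, b)\<in>set E. r a = r b) \<and>
    (\<forall>x P. equivp P \<longrightarrow> (\<forall>(a, b)\<in>set E. P a b) \<longrightarrow> P x (r x))"
proof (induction E)
  case Nil
  show ?case by (rule exI[of _ id]) (auto intro: equivp_reflp)
next
  case (Cons e E)
  obtain a b where e: "e = (a, b)" by (cases e)
  from Cons obtain r where r: "(\<forall>(a, b)\<in>set E. r a = r b) \<and>
    (\<forall>x P. equivp P \<longrightarrow> (\<forall>(a, b)\<in>set E. P a b) \<longrightarrow> P x (r x))" by (rule exE)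
  then have r1: "\<forall>(a, b)\<in>set E. r a = r b"
    and r2: "\<And>x P. equivp P \<Longrightarrow> \<forall>(a, b)\<in>set E. P a b \<Longrightarrow> P x (r x)"
    by iprover+
  \<comment> \<open>The new pair \<open>(a, b)\<close> joins two classes: whatever had the
    representative of \<open>a\<close> now takes that of \<open>b\<close>. In an equivalence
    containing all pairs, such an \<open>x\<close> is linked to \<open>r b\<close> through
    \<open>r a\<close>, \<open>a\<close> and \<open>b\<close>.\<close>
  let ?r = "\<lambda>x. if r x = r a then r b else r x"
  have "P x (?r x)" if P: "equivp P" "\<forall>(a, b)\<in>set (e # E). P a b" for P x
  proof -
    have r3: "P y (r y)" for y using r2[OF P(1)] P(2) by simp
    have "P a b" using P(2) e by simp
    then have "P x (r b)" if "r x = r a"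
      using r3[of x] r3[of a] r3[of b] that by (metis P(1) equivp_symp equivp_transp)
    then show ?thesis using r3 by simp
  qed
  moreover have "\<forall>(a, b)\<in>set (e # E). ?r a = ?r b" using e r1 by fastforce
  ultimately show ?case by (intro exI[of _ ?r]) blast
qed

text \<open>These are the pairs in the image of the span of restriction maps, from functions on the
  apex to functions on the two feet. The type of values stays free: the order is tested on sets of
  naturals, but the supply takes lists as values.\<close>

definition crel :: "cospan \<Rightarrow> 'v set \<Rightarrow> ('v list \<times> 'v list) set" where
  "crel w V = {(map h (fst (snd w)), map h (snd (snd w))) | h. h \<in> fst w \<rightarrow> V}"

lemma crel_simp: "crel (S, xs, ys) V = {(map h xs, map h ys) | h. h \<in> S \<rightarrow> V}"
  by (simp add: crel_def)

lemma crelI: "h \<in> S \<rightarrow> V \<Longrightarrow> (map h xs, map h ys) \<in> crel (S, xs, ys) V"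
  by (auto simp: crel_simp)

lemma crel_mono:
  assumes "cospan_le x y" shows "crel x V \<subseteq> crel y V"
proof -
  obtain S xs ys where x: "x = (S, xs, ys)" by (cases x)
  obtain S' xs' ys' where y: "y = (S', xs', ys')" by (cases y)
  from assms obtain h where h: "h \<in> S' \<rightarrow> S" "map h xs' = xs" "map h ys' = ys"
    by (auto simp: x y)
  have "(map g xs, map g ys) \<in> crel y V" if "g \<in> S \<rightarrow> V" for g
    unfolding y h(2)[symmetric] h(3)[symmetric] map_map
    using h(1) that by (intro crelI) auto
  then show ?thesis unfolding x crel_simp by auto
qed

text \<open>Yoneda: over its own apex \<open>S\<close> the cospan \<open>x\<close> has the
  tautological pair \<open>(xs, ys)\<close>, given by the identity, and a function witnessing this
  pair for \<open>y\<close> is a map of apexes commuting with the legs. Finiteness of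
  \<open>S\<close> makes it an admissible test set.\<close>

lemma cospan_le_iff:
  assumes "x \<in> cospans m n"
  shows "cospan_le x y \<longleftrightarrow> (\<forall>V::nat set. finite V \<longrightarrow> crel x V \<subseteq> crel y V)"
proof
  assume *: "\<forall>V::nat set. finite V \<longrightarrow> crel x V \<subseteq> crel y V"
  obtain S xs ys where x: "x = (S, xs, ys)" by (cases x)
  obtain S' xs' ys' where y: "y = (S', xs', ys')" by (cases y)
  have "(map id xs, map id ys) \<in> crel x S" unfolding x by (rule crelI) simp
  moreover have "finite S" using assms by (simp add: x cospans_def)
  ultimately have "(xs, ys) \<in> crel y S" using * by auto
  then show "cospan_le x y" by (auto simp: x y crel_simp)
qed (auto dest: crel_mono)

lemma cospan_class_eq:
  assumes "x \<in> cospans m n"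
  shows "cospan_class x = {y \<in> cospans m n. cospan_le x y \<and> cospan_le y x}"
  using assms by (cases x) (auto simp: refl_class_def cospans_def)

declare cospan_class.simps [simp del]

lemma cospan_class_eq_crel:
  assumes "x \<in> cospans m n"
  shows "cospan_class x = {y \<in> cospans m n. \<forall>V::nat set. finite V \<longrightarrow> crel y V = crel x V}"
proof -
  have "cospan_le x y \<and> cospan_le y x \<longleftrightarrow> (\<forall>V::nat set. finite V \<longrightarrow> crel y V = crel x V)"
    if "y \<in> cospans m n" for y
    unfolding cospan_le_iff[OF assms] cospan_le_iff[OF that] set_eq_subset by iprover
  then show ?thesis unfolding cospan_class_eq[OF assms] by (intro Collect_cong conj_cong) simp_all
qed

lemma mem_cospan_class: "x \<in> cospans m n \<Longrightarrow> x \<in> cospan_class x"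
  by (simp add: cospan_class_eq_crel)

lemma Homs_WW: "X \<in> Homs WW m n \<longleftrightarrow> (\<exists>x\<in>cospans m n. X = cospan_class x)"
proof -
  have "cospan_class x = refl_class (cospans m n) cospan_le x" if "x \<in> cospans m n" for x
    using that by (cases x) (auto simp: cospans_def cospan_class.simps)
  then show ?thesis by (auto simp: WW_def poset_reflection_def)
qed

text \<open>All members of a class have the same relation, so the union equals that of any member
  (\<open>wrel_eq_crel\<close>) and no representative has to be chosen.\<close>

definition wrel :: "cospan set \<Rightarrow> 'v set \<Rightarrow> ('v list \<times> 'v list) set" where
  "wrel X V = (\<Union>x\<in>X. crel x V)"

lemma wrel_cospan_class:
  assumes "x \<in> cospans m n" shows "wrel (cospan_class x) V = crel x V"
proof
  show "wrel (cospan_class x) V \<subseteq> crel x V"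
    unfolding wrel_def cospan_class_eq[OF assms] by (intro UN_least crel_mono) simp
  show "crel x V \<subseteq> wrel (cospan_class x) V"
    unfolding wrel_def by (rule UN_upper[OF mem_cospan_class[OF assms]])
qed

lemma wrel_eq_crel:
  assumes "X \<in> Homs WW m n" "x \<in> X" shows "wrel X V = crel x V" "x \<in> cospans m n"
proof -
  from assms(1) obtain y where y: "y \<in> cospans m n" "X = cospan_class y"
    by (auto simp: Homs_WW)
  then show x: "x \<in> cospans m n" using assms(2) by (auto simp: cospan_class_eq)
  have "cospan_le x y" "cospan_le y x" using y assms(2) by (auto simp: cospan_class_eq)
  then have "crel x V = crel y V" by (intro subset_antisym crel_mono)
  then show "wrel X V = crel x V" using y by (simp add: wrel_cospan_class)
qed

text \<open>Extensionality for morphisms. A class consists of all cospans with prescribed relations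
  over finite sets of naturals, so these relations recover it.\<close>

lemma WW_eqI:
  assumes "X \<in> Homs WW m n" "Y \<in> Homs WW m n"
    and "\<And>V::nat set. finite V \<Longrightarrow> wrel X V = wrel Y V"
  shows "X = Y"
proof -
  obtain x where x: "x \<in> cospans m n" "X = cospan_class x"
    using assms(1) by (auto simp only: Homs_WW)
  obtain y where y: "y \<in> cospans m n" "Y = cospan_class y"
    using assms(2) by (auto simp only: Homs_WW)
  have "crel x V = crel y V" if "finite V" for V :: "nat set"
    using assms(3)[OF that] x y by (simp add: wrel_cospan_class)
  then show ?thesis unfolding x(2) y(2) cospan_class_eq_crel[OF x(1)] cospan_class_eq_crel[OF y(1)]
    by simp
qed

lemma Homs_WW_nonempty:
  assumes "X \<in> Homs WW m n" obtains x where "x \<in> X" "x \<in> cospans m n" "X = cospan_class x"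
  using assms mem_cospan_class by (auto simp only: Homs_WW)

lemma leq_WW:
  assumes "X \<in> Homs WW m n" "Y \<in> Homs WW m n"
  shows "leq WW X Y \<longleftrightarrow> (\<forall>V::nat set. finite V \<longrightarrow> wrel X V \<subseteq> wrel Y V)"
proof -
  have "leq WW X Y \<longleftrightarrow> (\<exists>x\<in>X. \<exists>y\<in>Y. cospan_le x y)" by (simp add: WW_def)
  also have "\<dots> \<longleftrightarrow> (\<exists>x\<in>X. \<exists>y\<in>Y. \<forall>V::nat set. finite V \<longrightarrow> wrel X V \<subseteq> wrel Y V)"
    by (intro bex_cong refl)
      (simp add: cospan_le_iff[OF wrel_eq_crel(2)[OF assms(1)]] wrel_eq_crel(1)[OF assms(1)]
        wrel_eq_crel(1)[OF assms(2)])
  also have "\<dots> \<longleftrightarrow> (\<forall>V::nat set. finite V \<longrightarrow> wrel X V \<subseteq> wrel Y V)"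
    unfolding bex_triv using Homs_WW_nonempty[OF assms(1)] Homs_WW_nonempty[OF assms(2)] by metis
  finally show ?thesis .
qed

lemma leq_WW_wrel_mono:
  assumes "X \<in> Homs WW m n" "Y \<in> Homs WW m n" "leq WW X Y"
  shows "wrel X V \<subseteq> wrel Y V"
proof -
  obtain x y where "x \<in> X" "y \<in> Y" "cospan_le x y" using assms(3) by (auto simp: WW_def)
  then show ?thesis using wrel_eq_crel(1) assms(1,2) crel_mono by metis
qed

lemma wrel_repr:
  assumes "X \<in> Homs WW m n"
  obtains S xs ys where "(S, xs, ys) \<in> X" "finite S" "length xs = m" "length ys = n"
    "set xs \<subseteq> S" "set ys \<subseteq> S" "X = cospan_class (S, xs, ys)"
proof -
  obtain x where x: "x \<in> X" "x \<in> cospans m n" "X = cospan_class x"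
    using assms by (rule Homs_WW_nonempty)
  obtain S xs ys where "x = (S, xs, ys)" by (cases x)
  then show thesis using x by (intro that) (auto simp: cospans_def)
qed

lemma wrel_iff:
  assumes "X \<in> Homs WW m n" "(S, xs, ys) \<in> X"
  shows "(a, b) \<in> wrel X V \<longleftrightarrow> (\<exists>h\<in>S \<rightarrow> V. a = map h xs \<and> b = map h ys)"
  unfolding wrel_eq_crel(1)[OF assms] by (auto simp: crel_simp)

lemma wrel_length:
  assumes "X \<in> Homs WW m n" "(a, b) \<in> wrel X V"
  shows "length a = m" "length b = n" "set a \<subseteq> V" "set b \<subseteq> V"
proof -
  obtain S xs ys where x: "(S, xs, ys) \<in> X" "length xs = m" "length ys = n" "set xs \<subseteq> S" "set ys \<subseteq> S"
    using assms(1) by (rule wrel_repr)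
  have "(a, b) \<in> crel (S, xs, ys) V" using wrel_eq_crel(1)[OF assms(1) x(1)] assms(2) by blast
  then show "length a = m" "length b = n" "set a \<subseteq> V" "set b \<subseteq> V"
    using x by (auto simp: crel_simp Pi_iff subset_iff)
qed

text \<open>Naturality in the value set: compose the witness with \<open>f\<close>. It serves twice
  later, for renaming the variables of a context and for cutting blocks of length
  \<open>k + l\<close> into two.\<close>

lemma wrel_map:
  assumes "X \<in> Homs WW m n" "(a, b) \<in> wrel X V" "f \<in> V \<rightarrow> W"
  shows "(map f a, map f b) \<in> wrel X W"
proof -
  obtain S xs ys where x: "(S, xs, ys) \<in> X" using assms(1) by (rule wrel_repr)
  obtain h where h: "h \<in> S \<rightarrow> V" "a = map h xs" "b = map h ys"
    using assms(2) unfolding wrel_iff[OF assms(1) x] by blast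
  have "f \<circ> h \<in> S \<rightarrow> W" using h(1) assms(3) by auto
  then show ?thesis unfolding wrel_iff[OF assms(1) x] by (rule bexI[rotated]) (simp add: h)
qed

section \<open>Pushouts and composition of cospans\<close>

lemma pushout_exists:
  assumes "(S, xs, ys) \<in> cospans m n" "(T, xs', ys') \<in> cospans n p"
  shows "\<exists>w. pushout_composite (S, xs, ys) (T, xs', ys') w"
proof -
  let ?l = "\<lambda>s. sum_encode (Inl s)" and ?r = "\<lambda>t. sum_encode (Inr t)"
  \<comment> \<open>\<open>A\<close> is the disjoint union of the two apexes inside the naturals and
    \<open>E\<close> lists the pairs to be glued. The pushout apex will be the image of
    \<open>A\<close> under \<open>r\<close>, again a finite set of naturals.\<close>
  define A where "A = sum_encode ` (S <+> T)"
  define E where "E = zip (map ?l ys) (map ?r xs')"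
  have len: "length ys = length xs'" and sub: "set ys \<subseteq> S" "set xs' \<subseteq> T" and fin: "finite S" "finite T"
    using assms by (auto simp: cospans_def)
  obtain r where r1: "\<forall>(a, b)\<in>set E. r a = r b"
    and r2: "\<And>x P. equivp P \<Longrightarrow> \<forall>(a, b)\<in>set E. P a b \<Longrightarrow> P x (r x)"
    using representatives[of E] by blast
  have E: "(a, b) \<in> set E \<Longrightarrow> \<exists>i<length ys. a = ?l (ys ! i) \<and> b = ?r (xs' ! i)" for a b
    unfolding E_def by (auto simp: set_zip len)
  let ?p = "\<lambda>s. r (?l s)" and ?q = "\<lambda>t. r (?r t)"
  \<comment> \<open>The kernel of \<open>h\<close> is an equivalence, so by \<open>r2\<close> a
    function that equates the glued pairs does not separate a point from its representative.\<close>
  have compat: "h (r x) = h x" if "\<And>i. i < length ys \<Longrightarrow> h (?l (ys ! i)) = h (?r (xs' ! i))"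
    for h :: "nat \<Rightarrow> 'x" and x
  proof -
    have "equivp (\<lambda>x y. h x = h y)" by (auto intro!: equivpI reflpI sympI transpI)
    moreover have "\<forall>(a, b)\<in>set E. h a = h b" using E that by fastforce
    ultimately show ?thesis using r2 by fastforce
  qed
  have pq: "map ?p ys = map ?q xs'"
  proof (rule nth_equalityI)
    fix i assume i: "i < length (map ?p ys)"
    then have "(?l (ys ! i), ?r (xs' ! i)) \<in> set E" unfolding E_def set_zip
      using len by (intro CollectI exI[of _ i]) simp
    then show "map ?p ys ! i = map ?q xs' ! i" using r1 i len by auto
  qed (simp add: len)
  have univ: "\<exists>!h. h \<in> r ` A \<rightarrow>\<^sub>E V \<and> (\<forall>s\<in>S. h (?p s) = p' s) \<and> (\<forall>t\<in>T. h (?q t) = q' t)"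
    if "p' \<in> S \<rightarrow> V" "q' \<in> T \<rightarrow> V" "map p' ys = map q' xs'" for V :: "nat set" and p' q'
  proof
    let ?hd = "\<lambda>z. case sum_decode z of Inl s \<Rightarrow> p' s | Inr t \<Rightarrow> q' t"
    let ?h = "restrict ?hd (r ` A)"
    have "?hd (r x) = ?hd x" for x
    proof (rule compat[of ?hd])
      fix i assume "i < length ys"
      then have "map p' ys ! i = map q' xs' ! i" "i < length xs'" using that(3) len by auto
      then show "?hd (?l (ys ! i)) = ?hd (?r (xs' ! i))" using \<open>i < length ys\<close> by simp
    qed
    then have h: "s \<in> S \<Longrightarrow> ?h (?p s) = p' s" "t \<in> T \<Longrightarrow> ?h (?q t) = q' t" for s t
      by (auto simp: A_def)
    then show H: "?h \<in> r ` A \<rightarrow>\<^sub>E V \<and> (\<forall>s\<in>S. ?h (?p s) = p' s) \<and> (\<forall>t\<in>T. ?h (?q t) = q' t)"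
    proof (intro conjI ballI PiE_I)
      fix u assume "u \<in> r ` A"
      then obtain z where "u = r (sum_encode z)" "z \<in> S <+> T" by (auto simp: A_def)
      then show "?h u \<in> V" using h that(1,2) by (auto simp del: restrict_apply)
    qed auto
    fix h' assume h': "h' \<in> r ` A \<rightarrow>\<^sub>E V \<and> (\<forall>s\<in>S. h' (?p s) = p' s) \<and> (\<forall>t\<in>T. h' (?q t) = q' t)"
    show "h' = ?h"
    proof (rule PiE_ext[of _ "r ` A" "\<lambda>_. V"])
      fix u assume "u \<in> r ` A"
      then obtain z where "u = r (sum_encode z)" "z \<in> S <+> T" by (auto simp: A_def)
      then show "h' u = ?h u" using h h' by (auto simp del: restrict_apply)
    qed (use H h' in blast)+
  qed
  have "finite (r ` A)" "?p \<in> S \<rightarrow> r ` A" "?q \<in> T \<rightarrow> r ` A"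
    using fin by (auto simp: A_def)
  then have "is_pushout ys xs' S T (r ` A) ?p ?q"
    unfolding is_pushout_def by (intro conjI allI impI pq; (elim conjE)?) (assumption | rule univ)+
  then show ?thesis by auto
qed

text \<open>Functions on a pushout are pairs of functions on the two apexes that agree on the shared
  foot, and agreement there means having the same middle list. So the relation of the composite is
  the composite of the relations.\<close>

lemma crel_pushout:
  assumes x: "x \<in> cospans m n" and y: "y \<in> cospans n p" and w: "pushout_composite x y w"
  shows "w \<in> cospans m p" "crel w V = crel x V O crel y V"
proof -
  obtain S xs ys where x': "x = (S, xs, ys)" by (cases x)
  obtain T xs' ys' where y': "y = (T, xs', ys')" by (cases y)
  note xy = x' y'
  obtain U f g where U: "is_pushout ys xs' S T U f g" and weq: "w = (U, map f xs, map g ys')"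
    using w by (auto simp: xy)
  have set: "set xs \<subseteq> S" "set ys \<subseteq> S" "set xs' \<subseteq> T" "set ys' \<subseteq> T" "finite S" "finite T"
    using x y by (auto simp: xy cospans_def)
  have fg: "finite U" "f \<in> S \<rightarrow> U" "g \<in> T \<rightarrow> U" "map f ys = map g xs'"
    using U by (auto simp: is_pushout_def)
  show "w \<in> cospans m p" using fg set x y by (auto simp: weq xy cospans_def)
  show "crel w V = crel x V O crel y V"
  proof (intro subset_antisym subrelI)
    fix a b assume "(a, b) \<in> crel w V"
    then obtain h where h: "h \<in> U \<rightarrow> V" "a = map (h \<circ> f) xs" "b = map (h \<circ> g) ys'"
      by (auto simp: weq crel_simp)
    have "map (h \<circ> f) ys = map (h \<circ> g) xs'" using fg(4) by (metis map_map)
    moreover have "h \<circ> f \<in> S \<rightarrow> V" "h \<circ> g \<in> T \<rightarrow> V" using h(1) fg by auto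
    ultimately have "(a, map (h \<circ> f) ys) \<in> crel x V" "(map (h \<circ> f) ys, b) \<in> crel y V"
      unfolding xy h(2,3) by (metis crelI)+
    then show "(a, b) \<in> crel x V O crel y V" by blast
  next
    fix a b assume "(a, b) \<in> crel x V O crel y V"
    then obtain c where "(a, c) \<in> crel x V" "(c, b) \<in> crel y V" by blast
    then obtain h k where h: "h \<in> S \<rightarrow> V" "a = map h xs" "c = map h ys"
      and k: "k \<in> T \<rightarrow> V" "map k xs' = map h ys" "b = map k ys'" by (auto simp: xy crel_simp)
    \<comment> \<open>The universal property is available only for finite sets of naturals, while
      \<open>V\<close> is arbitrary. The two functions have a finite joint range \<open>W\<close>,
      which an injection \<open>e\<close> carries into the naturals; the mediating function is
      pulled back along \<open>e\<close>.\<close>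
    define W where "W = h ` S \<union> k ` T"
    have finW: "finite W" using set by (simp add: W_def)
    then obtain e :: "_ \<Rightarrow> nat" where e: "inj_on e W"
      using finite_imp_inj_to_nat_seg[OF finW] by metis
    let ?h = "e \<circ> h" and ?k = "e \<circ> k"
    have "map ?h ys = map ?k xs'" using k(2) by (metis map_map)
    moreover have "?h \<in> S \<rightarrow> e ` W" "?k \<in> T \<rightarrow> e ` W" "finite (e ` W)"
      using finW by (auto simp: W_def)
    ultimately have "\<exists>!l. l \<in> U \<rightarrow>\<^sub>E e ` W \<and> (\<forall>s\<in>S. l (f s) = ?h s) \<and> (\<forall>t\<in>T. l (g t) = ?k t)"
      by (intro U[unfolded is_pushout_def, THEN conjunct2, THEN conjunct2, THEN conjunct2,
            THEN conjunct2, rule_format] conjI)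
    then obtain l where l: "l \<in> U \<rightarrow>\<^sub>E e ` W" "\<forall>s\<in>S. l (f s) = ?h s" "\<forall>t\<in>T. l (g t) = ?k t"
      by blast
    let ?l = "inv_into W e \<circ> l"
    have "?l \<in> U \<rightarrow> V"
    proof
      fix u assume "u \<in> U"
      then have "?l u \<in> W" using l(1) by (auto intro!: inv_into_into)
      then show "?l u \<in> V" using h(1) k(1) by (auto simp: W_def)
    qed
    moreover have "map ?l (map f xs) = a" "map ?l (map g ys') = b"
      using l(2,3) set e by (auto simp: h k W_def subset_iff)
    ultimately show "(a, b) \<in> crel w V" unfolding weq by (metis crelI)
  qed
qed

text \<open>Composition, tensor and supply are defined as unions of classes over all choices of
  representatives. When all candidates have the same relation, named \<open>Q\<close>, they lie in
  one class and the union is that class.\<close>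

lemma Union_cospan_class:
  assumes "\<Phi> w" and "\<And>w. \<Phi> w \<Longrightarrow> w \<in> cospans m n"
    and "\<And>w (V::nat set). \<Phi> w \<Longrightarrow> crel w V = Q V"
  shows "\<Union>{cospan_class w | w. \<Phi> w} = cospan_class w"
proof -
  have "cospan_class v = cospan_class w" if "\<Phi> v" for v
    by (simp add: cospan_class_eq_crel[OF assms(2)[OF that]] cospan_class_eq_crel[OF assms(2)[OF assms(1)]]
        assms(3)[OF that] assms(3)[OF assms(1)])
  then show ?thesis using assms(1) by blast
qed

lemma comp_WW:
  assumes "X \<in> Homs WW m n" "Y \<in> Homs WW n p"
  shows "comp WW Y X \<in> Homs WW m p" "wrel (comp WW Y X) V = wrel X V O wrel Y V"
proof -
  let ?\<Phi> = "\<lambda>w. \<exists>x\<in>X. \<exists>y\<in>Y. pushout_composite x y w"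
  obtain S xs ys where x: "(S, xs, ys) \<in> X" using assms(1) by (rule wrel_repr)
  obtain T xs' ys' where y: "(T, xs', ys') \<in> Y" using assms(2) by (rule wrel_repr)
  note X = wrel_eq_crel[OF assms(1)] and Y = wrel_eq_crel[OF assms(2)]
  obtain w where w: "?\<Phi> w" using pushout_exists X(2)[OF x] Y(2)[OF y] x y by blast
  have \<Phi>: "v \<in> cospans m p" if "?\<Phi> v" for v
    using that crel_pushout(1) X(2) Y(2) by blast
  have \<Phi>': "crel v V = wrel X V O wrel Y V" if "?\<Phi> v" for v
    using that crel_pushout(2) X Y by metis
  \<comment> \<open>The same equation at sets of naturals, as required to identify classes; the
    \<open>V\<close> of the statement may have values of another type.\<close>
  have \<Phi>'': "crel v V = wrel X V O wrel Y V" if "?\<Phi> v" for v and V :: "nat set"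
    using that crel_pushout(2) X Y by metis
  have "comp WW Y X = \<Union>{cospan_class w | w. ?\<Phi> w}" by (simp add: WW_def)
  also have "\<dots> = cospan_class w"
    using w by (rule Union_cospan_class[where m = m and n = p]) (use \<Phi> \<Phi>'' in auto)
  finally have eq: "comp WW Y X = cospan_class w" .
  show "comp WW Y X \<in> Homs WW m p" unfolding Homs_WW eq by (rule bexI, rule refl) (rule \<Phi>, rule w)
  show "wrel (comp WW Y X) V = wrel X V O wrel Y V"
    unfolding eq wrel_cospan_class[OF \<Phi>[OF w]] by (rule \<Phi>'[OF w])
qed

section \<open>Identities, tensor and symmetry as relations\<close>

lemma map_upt_eq: "{map h [0..<n] | h. h \<in> {0..<n} \<rightarrow> V} = {v. length v = n \<and> set v \<subseteq> V}"
proof (intro Set.set_eqI iffI)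
  fix v assume "v \<in> {v. length v = n \<and> set v \<subseteq> V}"
  then have "v = map ((!) v) [0..<n]" "(!) v \<in> {0..<n} \<rightarrow> V" by (auto simp: map_nth)
  then show "v \<in> {map h [0..<n] | h. h \<in> {0..<n} \<rightarrow> V}" by blast
qed (auto simp: Pi_iff)

lemma Ident_WW: "Ident WW n = cospan_class (id_cospan n)"
  and assoc_WW: "assoc WW a b c = Ident WW (a + b + c)"
  and lunit_WW: "lunit WW n = Ident WW n"
  and runit_WW: "runit WW n = Ident WW n"
  and Objs_WW: "Objs WW = UNIV"
  and tensO_WW: "tensO WW = (+)"
  and unitO_WW: "unitO WW = 0"
  by (simp_all add: WW_def)

lemma Ident_WW_in: "Ident WW n \<in> Homs WW n n"
  unfolding Homs_WW Ident_WW by (rule bexI, rule refl) (simp add: id_cospan_def cospans_def)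

lemma wrel_Ident: "(a, b) \<in> wrel (Ident WW n) V \<longleftrightarrow> a = b \<and> length a = n \<and> set a \<subseteq> V"
proof -
  have "id_cospan n \<in> cospans n n" by (simp add: id_cospan_def cospans_def)
  then have "(a, b) \<in> wrel (Ident WW n) V \<longleftrightarrow> a = b \<and> a \<in> {map h [0..<n] | h. h \<in> {0..<n} \<rightarrow> V}"
    unfolding Ident_WW by (auto simp: wrel_cospan_class id_cospan_def crel_simp)
  then show ?thesis unfolding map_upt_eq by simp
qed

definition rtens :: "('v list \<times> 'v list) set \<Rightarrow> ('v list \<times> 'v list) set \<Rightarrow> ('v list \<times> 'v list) set" where
  "rtens R Q = {(a @ c, b @ d) | a b c d. (a, b) \<in> R \<and> (c, d) \<in> Q}"

lemma rtensI: "(a, b) \<in> R \<Longrightarrow> (c, d) \<in> Q \<Longrightarrow> (a @ c, b @ d) \<in> rtens R Q"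
  by (auto simp: rtens_def)

lemma rtensE:
  assumes "(u, v) \<in> rtens R Q"
  obtains a b c d where "u = a @ c" "v = b @ d" "(a, b) \<in> R" "(c, d) \<in> Q"
  using assms by (auto simp: rtens_def)

lemma rtens_mono: "R \<subseteq> R' \<Longrightarrow> Q \<subseteq> Q' \<Longrightarrow> rtens R Q \<subseteq> rtens R' Q'"
  unfolding rtens_def by blast

lemma rtens_assoc: "rtens (rtens R Q) P = rtens R (rtens Q P)"
proof (intro subset_antisym subrelI)
  fix u v assume "(u, v) \<in> rtens R (rtens Q P)"
  then obtain a b c d e f where "u = (a @ c) @ e" "v = (b @ d) @ f" "(a, b) \<in> R" "(c, d) \<in> Q" "(e, f) \<in> P"
    by (auto elim!: rtensE)
  then show "(u, v) \<in> rtens (rtens R Q) P" by (simp add: rtensI del: append_assoc)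
next
  fix u v assume "(u, v) \<in> rtens (rtens R Q) P"
  then obtain a b c d e f where "u = a @ (c @ e)" "v = b @ (d @ f)" "(a, b) \<in> R" "(c, d) \<in> Q" "(e, f) \<in> P"
    by (auto elim!: rtensE)
  then show "(u, v) \<in> rtens R (rtens Q P)" by (simp add: rtensI)
qed

text \<open>The hypothesis fixes where the middle list is cut. Its two decompositions have first
  parts of equal length, so they coincide and the pieces compose separately.\<close>

lemma rtens_O:
  assumes "\<And>a b c d. (a, b) \<in> R \<Longrightarrow> (c, d) \<in> R' \<Longrightarrow> length b = length c"
  shows "rtens (R O R') (Q O Q') = rtens R Q O rtens R' Q'"
proof (intro subset_antisym subrelI)
  fix u v assume "(u, v) \<in> rtens R Q O rtens R' Q'"
  then obtain w where "(u, w) \<in> rtens R Q" "(w, v) \<in> rtens R' Q'" by blast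
  then obtain a b c d b' e d' f where *: "u = a @ c" "w = b @ d" "(a, b) \<in> R" "(c, d) \<in> Q"
    "w = b' @ d'" "v = e @ f" "(b', e) \<in> R'" "(d', f) \<in> Q'" by (elim rtensE) blast
  then have "b = b'" "d = d'" using assms[of a b b' e] by auto
  then show "(u, v) \<in> rtens (R O R') (Q O Q')" using * by (auto intro!: rtensI)
qed (auto elim!: rtensE intro!: rtensI)

lemma crel_cospan_sum:
  "crel (cospan_sum x y) V = rtens (crel x V) (crel y V)"
proof -
  obtain S xs ys where x: "x = (S, xs, ys)" by (cases x)
  obtain T xs' ys' where y: "y = (T, xs', ys')" by (cases y)
  let ?l = "\<lambda>s. sum_encode (Inl s)" and ?r = "\<lambda>t. sum_encode (Inr t)"
  show ?thesis
  proof (intro subset_antisym subrelI)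
    fix u v assume "(u, v) \<in> crel (cospan_sum x y) V"
    then obtain h where h: "h \<in> sum_encode ` (S <+> T) \<rightarrow> V"
      "u = map (h \<circ> ?l) xs @ map (h \<circ> ?r) xs'" "v = map (h \<circ> ?l) ys @ map (h \<circ> ?r) ys'"
      by (auto simp: x y crel_simp)
    have "h \<circ> ?l \<in> S \<rightarrow> V" "h \<circ> ?r \<in> T \<rightarrow> V" using h(1) by auto
    from this[THEN crelI] show "(u, v) \<in> rtens (crel x V) (crel y V)"
      unfolding x y h(2,3) by (intro rtensI)
  next
    fix u v assume "(u, v) \<in> rtens (crel x V) (crel y V)"
    then obtain h k where h: "h \<in> S \<rightarrow> V" "k \<in> T \<rightarrow> V" "u = map h xs @ map k xs'" "v = map h ys @ map k ys'"
      by (auto simp: x y crel_simp elim!: rtensE)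
    let ?h = "\<lambda>z. case sum_decode z of Inl s \<Rightarrow> h s | Inr t \<Rightarrow> k t"
    have "?h \<in> sum_encode ` (S <+> T) \<rightarrow> V" using h(1,2) by auto
    from crelI[OF this, of "map ?l xs @ map ?r xs'" "map ?l ys @ map ?r ys'"]
    show "(u, v) \<in> crel (cospan_sum x y) V" by (simp add: x y h(3,4) o_def)
  qed
qed

lemma cospan_sum_in: "x \<in> cospans m n \<Longrightarrow> y \<in> cospans p q \<Longrightarrow> cospan_sum x y \<in> cospans (m + p) (n + q)"
  by (cases x; cases y) (auto simp: cospans_def)

lemma Setcompr_image2: "{f (g x y) | x y. x \<in> X \<and> y \<in> Y} = {f w | w. \<exists>x\<in>X. \<exists>y\<in>Y. w = g x y}"
  by blast

lemma tensA_WW: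
  assumes "X \<in> Homs WW m n" "Y \<in> Homs WW p q"
  shows "tensA WW X Y \<in> Homs WW (m + p) (n + q)"
    "wrel (tensA WW X Y) V = rtens (wrel X V) (wrel Y V)"
proof -
  let ?\<Phi> = "\<lambda>w. \<exists>x\<in>X. \<exists>y\<in>Y. w = cospan_sum x y"
  obtain x where x: "x \<in> X" using assms(1) by (rule Homs_WW_nonempty)
  obtain y where y: "y \<in> Y" using assms(2) by (rule Homs_WW_nonempty)
  note X = wrel_eq_crel[OF assms(1)] and Y = wrel_eq_crel[OF assms(2)]
  have w: "?\<Phi> (cospan_sum x y)" using x y by blast
  have \<Phi>: "v \<in> cospans (m + p) (n + q)" if "?\<Phi> v" for v
    using that cospan_sum_in X(2) Y(2) by blast
  have \<Phi>': "crel v V = rtens (wrel X V) (wrel Y V)"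
    if v: "?\<Phi> v" for v and V :: "nat set"
  proof -
    obtain x y where xy: "x \<in> X" "y \<in> Y" "v = cospan_sum x y" using v by blast
    show ?thesis unfolding xy(3) crel_cospan_sum X(1)[OF xy(1)] Y(1)[OF xy(2)] ..
  qed
  have "tensA WW X Y = \<Union>{cospan_class w | w. ?\<Phi> w}"
    unfolding Setcompr_image2[symmetric] by (simp add: WW_def)
  also have "\<dots> = cospan_class (cospan_sum x y)"
    using w by (rule Union_cospan_class[where m = "m + p" and n = "n + q"]) (use \<Phi> \<Phi>' in auto)
  finally have eq: "tensA WW X Y = cospan_class (cospan_sum x y)" .
  show "tensA WW X Y \<in> Homs WW (m + p) (n + q)"
    unfolding Homs_WW eq by (rule bexI, rule refl) (rule \<Phi>, rule w)
  show "wrel (tensA WW X Y) V = rtens (wrel X V) (wrel Y V)"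
    unfolding eq wrel_cospan_class[OF \<Phi>[OF w]] crel_cospan_sum X(1)[OF x] Y(1)[OF y] ..
qed

lemma symm_WW:
  shows "symm WW m n \<in> Homs WW (m + n) (n + m)"
    "wrel (symm WW m n) V = {(a @ b, b @ a) | a b. length a = m \<and> length b = n \<and> set a \<subseteq> V \<and> set b \<subseteq> V}"
proof -
  let ?w = "({0..<m+n}, [0..<m+n], [m..<m+n] @ [0..<m]) :: cospan"
  have w: "?w \<in> cospans (m + n) (n + m)" by (auto simp: cospans_def)
  have eq: "symm WW m n = cospan_class ?w" by (simp add: WW_def)
  show "symm WW m n \<in> Homs WW (m + n) (n + m)"
    unfolding Homs_WW eq by (rule bexI, rule refl) (rule w)
  have "wrel (symm WW m n) V = {(v, drop m v @ take m v) | v. v \<in> {map h [0..<m+n] | h. h \<in> {0..<m+n} \<rightarrow> V}}"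
    unfolding eq wrel_cospan_class[OF w] crel_simp by (force simp: drop_map take_map)
  also have "\<dots> = {(v, drop m v @ take m v) | v. length v = m + n \<and> set v \<subseteq> V}"
    unfolding map_upt_eq by simp
  also have "\<dots> = {(a @ b, b @ a) | a b. length a = m \<and> length b = n \<and> set a \<subseteq> V \<and> set b \<subseteq> V}"
  proof (intro subset_antisym subrelI)
    fix u v assume "(u, v) \<in> {(v, drop m v @ take m v) | v. length v = m + n \<and> set v \<subseteq> V}"
    then have "u = take m u @ drop m u" "v = drop m u @ take m u" "length (take m u) = m"
      "length (drop m u) = n" "set (take m u) \<subseteq> V" "set (drop m u) \<subseteq> V"
      using set_take_subset set_drop_subset by (auto dest!: subsetD[of "set _"]) fastforce+
    then show "(u, v) \<in> {(a @ b, b @ a) | a b. length a = m \<and> length b = n \<and> set a \<subseteq> V \<and> set b \<subseteq> V}"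
      by blast
  qed auto
  finally show "wrel (symm WW m n) V = {(a @ b, b @ a) | a b. length a = m \<and> length b = n \<and> set a \<subseteq> V \<and> set b \<subseteq> V}" .
qed

section \<open>The symmetric monoidal laws of the prop\<close>

lemmas comp_WW_in = comp_WW(1) and wrel_comp = comp_WW(2)
lemmas tensA_WW_in = tensA_WW(1) and wrel_tensA = tensA_WW(2)
lemmas symm_WW_in = symm_WW(1) and wrel_symm = symm_WW(2)

lemma cospans_eq: "x \<in> cospans m n \<Longrightarrow> x \<in> cospans m' n' \<Longrightarrow> m = m' \<and> n = n'"
  by (auto simp: cospans_def)

lemma wrel_symmE:
  assumes "(u, v) \<in> wrel (symm WW m n) V"
  obtains a b where "u = a @ b" "v = b @ a" "length a = m" "length b = n" "set a \<subseteq> V" "set b \<subseteq> V"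
  using assms unfolding wrel_symm by blast

lemma po_category_WW: "po_category WW"
proof
  fix X :: "cospan set" and m n m' n' assume "X \<in> Homs WW m n" "X \<in> Homs WW m' n'"
  then show "m = m' \<and> n = n'"
    by (metis Homs_WW_nonempty wrel_eq_crel(2) cospans_eq)
next
  fix X Y Z :: "cospan set" and m n p q
  assume X: "X \<in> Homs WW m n" and Y: "Y \<in> Homs WW n p" and Z: "Z \<in> Homs WW p q"
  show "comp WW (comp WW Z Y) X = comp WW Z (comp WW Y X)"
    by (rule WW_eqI[of _ m q])
      (simp_all add: comp_WW[OF X comp_WW_in[OF Y Z]] comp_WW[OF Y Z] comp_WW[OF X Y]
        comp_WW[OF comp_WW_in[OF X Y] Z] O_assoc)
next
  fix X :: "cospan set" and m n assume X: "X \<in> Homs WW m n"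
  note I = comp_WW[OF Ident_WW_in X] comp_WW[OF X Ident_WW_in]
  show "comp WW (Ident WW n) X = X"
    by (rule WW_eqI[OF _ X]) (auto simp: I wrel_Ident wrel_length[OF X])
  show "comp WW X (Ident WW m) = X"
    by (rule WW_eqI[OF _ X]) (auto simp: I wrel_Ident wrel_length[OF X])
next
  fix X Y :: "cospan set" and m n assume X: "X \<in> Homs WW m n" "Y \<in> Homs WW m n"
    and "leq WW X Y" "leq WW Y X"
  then show "X = Y" unfolding leq_WW[OF X] leq_WW[OF X(2,1)] by (intro WW_eqI[OF X]) auto
next
  fix X X' Y Y' :: "cospan set" and m n p
  assume X: "X \<in> Homs WW m n" "X' \<in> Homs WW m n" and Y: "Y \<in> Homs WW n p" "Y' \<in> Homs WW n p"
  assume "leq WW X X'" "leq WW Y Y'"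
  then show "leq WW (comp WW Y X) (comp WW Y' X')"
    unfolding leq_WW[OF X] leq_WW[OF Y] leq_WW[OF comp_WW_in[OF X(1) Y(1)] comp_WW_in[OF X(2) Y(2)]]
    by (simp add: wrel_comp[OF X(1) Y(1)] wrel_comp[OF X(2) Y(2)] relcomp_mono)
qed (simp_all add: Objs_WW Ident_WW_in comp_WW_in leq_WW, blast)

interpretation WW: po_category WW by (rule po_category_WW)

lemma tensA_WW_assoc:
  assumes X: "X \<in> Homs WW m n" and Y: "Y \<in> Homs WW p q" and Z: "Z \<in> Homs WW r s"
  shows "tensA WW (tensA WW X Y) Z = tensA WW X (tensA WW Y Z)"
proof (rule WW_eqI[of _ "m + p + r" "n + q + s"])
  note [simp] = tensA_WW[OF X tensA_WW_in[OF Y Z]] tensA_WW[OF Y Z] tensA_WW[OF X Y]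
    tensA_WW[OF tensA_WW_in[OF X Y] Z]
  show "tensA WW (tensA WW X Y) Z \<in> Homs WW (m + p + r) (n + q + s)" by simp
  show "tensA WW X (tensA WW Y Z) \<in> Homs WW (m + p + r) (n + q + s)"
    using tensA_WW_in[OF X tensA_WW_in[OF Y Z]] by (simp add: add.assoc)
  fix V :: "nat set"
  show "wrel (tensA WW (tensA WW X Y) Z) V = wrel (tensA WW X (tensA WW Y Z)) V"
    by (simp add: rtens_assoc)
qed

lemma tensA_WW_unit:
  assumes X: "X \<in> Homs WW m n"
  shows "tensA WW (Ident WW 0) X = X" "tensA WW X (Ident WW 0) = X"
proof -
  show "tensA WW (Ident WW 0) X = X"
    by (rule WW_eqI[OF _ X])
      (use tensA_WW_in[OF Ident_WW_in X, of 0] in simp, auto simp: wrel_tensA[OF Ident_WW_in X] wrel_Ident rtens_def)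
  show "tensA WW X (Ident WW 0) = X"
    by (rule WW_eqI[OF _ X])
      (use tensA_WW_in[OF X Ident_WW_in, of 0] in simp, auto simp: wrel_tensA[OF X Ident_WW_in] wrel_Ident rtens_def)
qed

lemma tensA_WW_Ident: "tensA WW (Ident WW m) (Ident WW n) = Ident WW (m + n)"
proof (rule WW_eqI[OF tensA_WW_in[OF Ident_WW_in Ident_WW_in] Ident_WW_in], intro subset_antisym subrelI)
  fix V :: "nat set" and a b
  assume "(a, b) \<in> wrel (Ident WW (m + n)) V"
  then have "a = take m a @ drop m a" "b = take m a @ drop m a"
    "(take m a, take m a) \<in> wrel (Ident WW m) V" "(drop m a, drop m a) \<in> wrel (Ident WW n) V"
    using set_take_subset[of m a] set_drop_subset[of m a] by (auto simp: wrel_Ident)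
  then show "(a, b) \<in> wrel (tensA WW (Ident WW m) (Ident WW n)) V"
    unfolding wrel_tensA[OF Ident_WW_in Ident_WW_in] by (metis rtensI)
qed (auto elim!: rtensE simp: wrel_Ident wrel_tensA[OF Ident_WW_in Ident_WW_in])

lemma tensA_WW_comp:
  assumes f: "f \<in> Homs WW a b" "f' \<in> Homs WW b c" and g: "g \<in> Homs WW p q" "g' \<in> Homs WW q r"
  shows "tensA WW (comp WW f' f) (comp WW g' g) = comp WW (tensA WW f' g') (tensA WW f g)" (is "?l = ?r")
proof (rule WW_eqI)
  note ff = comp_WW[OF f] and gg = comp_WW[OF g]
  note t = tensA_WW[OF f(1) g(1)] and t' = tensA_WW[OF f(2) g(2)]
  show "?l \<in> Homs WW (a + p) (c + r)"
    by (rule tensA_WW_in[OF ff(1) gg(1)])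
  show "?r \<in> Homs WW (a + p) (c + r)"
    by (rule comp_WW_in[OF t(1) t'(1)])
  fix V :: "nat set"
  show "wrel ?l V = wrel ?r V"
    unfolding comp_WW[OF t(1) t'(1)] tensA_WW[OF ff(1) gg(1)] ff gg t t'
    by (rule rtens_O) (simp add: wrel_length[OF f(1)] wrel_length[OF f(2)])
qed

lemma symm_WW_natural:
  assumes f: "f \<in> Homs WW a a'" and g: "g \<in> Homs WW b b'"
  shows "comp WW (symm WW a' b') (tensA WW f g) = comp WW (tensA WW g f) (symm WW a b)" (is "?l = ?r")
proof (rule WW_eqI)
  note l = comp_WW[OF tensA_WW_in[OF f g] symm_WW_in] and r = comp_WW[OF symm_WW_in tensA_WW_in[OF g f]]
  show "?l \<in> Homs WW (a + b) (b' + a')"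
    "?r \<in> Homs WW (a + b) (b' + a')" by (rule l r)+
  fix V :: "nat set"
  show "wrel ?l V = wrel ?r V"
  proof (intro subset_antisym subrelI)
    fix u v assume "(u, v) \<in> wrel ?l V"
    then obtain w where w: "(u, w) \<in> rtens (wrel f V) (wrel g V)" "(w, v) \<in> wrel (symm WW a' b') V"
      unfolding l wrel_tensA[OF f g] by blast
    from w(1) obtain p r q s where **: "u = p @ r" "w = q @ s" "(p, q) \<in> wrel f V" "(r, s) \<in> wrel g V"
      by (rule rtensE)
    moreover have "length q = a'" using wrel_length[OF f **(3)] by simp
    ultimately have *: "u = p @ r" "v = s @ q" "(p, q) \<in> wrel f V" "(r, s) \<in> wrel g V"
      using w(2) by (auto simp: wrel_symm)
    then have "(u, r @ p) \<in> wrel (symm WW a b) V" "(r @ p, v) \<in> wrel (tensA WW g f) V"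
      using wrel_length[OF f *(3)] wrel_length[OF g *(4)] unfolding wrel_symm wrel_tensA[OF g f] *
      by (blast, intro rtensI *)
    then show "(u, v) \<in> wrel ?r V" unfolding r by blast
  next
    fix u v assume "(u, v) \<in> wrel ?r V"
    then obtain w where w: "(w, v) \<in> rtens (wrel g V) (wrel f V)" "(u, w) \<in> wrel (symm WW a b) V"
      unfolding r wrel_tensA[OF g f] by blast
    from w(1) obtain r p s q where **: "w = r @ p" "v = s @ q" "(r, s) \<in> wrel g V" "(p, q) \<in> wrel f V"
      by (rule rtensE)
    moreover have "length p = a" "length r = b" using wrel_length[OF g **(3)] wrel_length[OF f **(4)] by simp_all
    ultimately have *: "u = p @ r" "v = s @ q" "(p, q) \<in> wrel f V" "(r, s) \<in> wrel g V"
      using w(2) by (auto simp: wrel_symm)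
    then have "(u, q @ s) \<in> wrel (tensA WW f g) V" "(q @ s, v) \<in> wrel (symm WW a' b') V"
      using wrel_length[OF f *(3)] wrel_length[OF g *(4)] unfolding wrel_symm wrel_tensA[OF f g] *
      by (intro rtensI *, blast)
    then show "(u, v) \<in> wrel ?l V" unfolding l by blast
  qed
qed

lemma symm_WW_symm: "comp WW (symm WW n m) (symm WW m n) = Ident WW (m + n)"
proof (rule WW_eqI[OF comp_WW_in[OF symm_WW_in symm_WW_in] Ident_WW_in], intro subset_antisym subrelI)
  fix V :: "nat set" and a b assume "(a, b) \<in> wrel (Ident WW (m + n)) V"
  then have "b = a" "a = take m a @ drop m a" "length (take m a) = m" "length (drop m a) = n"
    "set (take m a) \<subseteq> V" "set (drop m a) \<subseteq> V"
    using set_take_subset[of m a] set_drop_subset[of m a] by (auto simp: wrel_Ident)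
  then show "(a, b) \<in> wrel (comp WW (symm WW n m) (symm WW m n)) V"
    unfolding wrel_comp[OF symm_WW_in symm_WW_in] wrel_symm by (intro relcompI[of _ "drop m a @ take m a"]) blast+
qed (auto simp: wrel_comp[OF symm_WW_in symm_WW_in] wrel_symm wrel_Ident)

text \<open>What remains of the hexagon once associators are identities: a block of length
  \<open>a\<close> crosses \<open>b + c\<close> entries by crossing \<open>b\<close> of them and
  then the other \<open>c\<close>.\<close>

lemma symm_WW_hexagon:
  "symm WW a (b + c) = comp WW (tensA WW (Ident WW b) (symm WW a c)) (tensA WW (symm WW a b) (Ident WW c))" (is "_ = ?r")
proof (rule WW_eqI[of _ "a + b + c" "b + c + a"])
  note t = tensA_WW[OF Ident_WW_in symm_WW_in, of b a c] and t' = tensA_WW[OF symm_WW_in Ident_WW_in, of a b c]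
  have t'': "tensA WW (Ident WW b) (symm WW a c) \<in> Homs WW (b + a + c) (b + c + a)"
    using t(1) by (simp add: add.assoc)
  note r = comp_WW[OF t'(1) t'']
  show "symm WW a (b + c) \<in> Homs WW (a + b + c) (b + c + a)" using symm_WW_in[of a "b + c"] by (simp add: add.assoc)
  show "?r \<in> Homs WW (a + b + c) (b + c + a)"
    by (rule r)
  fix V :: "nat set"
  show "wrel (symm WW a (b + c)) V =
    wrel ?r V"
  proof (intro subset_antisym subrelI)
    fix u v assume "(u, v) \<in> wrel (symm WW a (b + c)) V"
    then obtain x y where xy: "u = x @ y" "v = y @ x" "length x = a" "length y = b + c" "set x \<subseteq> V" "set y \<subseteq> V"
      by (auto simp: wrel_symm)
    define y1 y2 where "y1 = take b y" and "y2 = drop b y"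
    have y: "y = y1 @ y2" "length y1 = b" "length y2 = c" using xy by (auto simp: y1_def y2_def)
    have "(x @ y1, y1 @ x) \<in> wrel (symm WW a b) V" "(y2, y2) \<in> wrel (Ident WW c) V"
      "(y1, y1) \<in> wrel (Ident WW b) V" "(x @ y2, y2 @ x) \<in> wrel (symm WW a c) V"
      using xy y by (auto simp: wrel_symm wrel_Ident)
    then have "((x @ y1) @ y2, (y1 @ x) @ y2) \<in> wrel (tensA WW (symm WW a b) (Ident WW c)) V"
      "(y1 @ (x @ y2), y1 @ (y2 @ x)) \<in> wrel (tensA WW (Ident WW b) (symm WW a c)) V"
      unfolding t t' by - (rule rtensI; assumption)+
    then show "(u, v) \<in> wrel ?r V"
      unfolding r xy y by auto
  next
    fix u v assume "(u, v) \<in> wrel ?r V"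
    then obtain w where "(u, w) \<in> wrel (tensA WW (symm WW a b) (Ident WW c)) V"
      "(w, v) \<in> wrel (tensA WW (Ident WW b) (symm WW a c)) V" unfolding r by blast
    then have w: "(u, w) \<in> rtens (wrel (symm WW a b) V) (wrel (Ident WW c) V)"
      "(w, v) \<in> rtens (wrel (Ident WW b) V) (wrel (symm WW a c) V)" unfolding t t' .
    from w(1) obtain p z q z1 where 1: "u = p @ z" "w = q @ z1" "(p, q) \<in> wrel (symm WW a b) V"
      "(z, z1) \<in> wrel (Ident WW c) V" by (rule rtensE)
    from w(2) obtain y' p' y1 q' where 2: "w = y' @ p'" "v = y1 @ q'" "(y', y1) \<in> wrel (Ident WW b) V"
      "(p', q') \<in> wrel (symm WW a c) V" by (rule rtensE)
    from 1(3) obtain x y where 3: "p = x @ y" "q = y @ x" "length x = a" "length y = b" "set x \<subseteq> V" "set y \<subseteq> V"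
      by (rule wrel_symmE)
    from 2(4) obtain x' z' where 4: "p' = x' @ z'" "q' = z' @ x'" "length x' = a" "length z' = c"
      by (rule wrel_symmE)
    have l: "z1 = z" "y1 = y'" "length z = c" "length y' = b" "set z \<subseteq> V"
      using 1(4) 2(3) by (auto simp: wrel_Ident)
    \<comment> \<open>Both tensors cut the middle list into pieces of lengths \<open>b\<close>,
      \<open>a\<close> and \<open>c\<close>, so the pieces agree one by one.\<close>
    have "y @ x @ z = y' @ x' @ z'" using 1(2) 2(1) 3 4 l by simp
    then have "y' = y" "x' = x" "z' = z" using l 3 4 by auto
    then have "u = x @ (y @ z)" "v = (y @ z) @ x" using 1 2 3 4 l by auto
    then show "(u, v) \<in> wrel (symm WW a (b + c)) V"
      unfolding wrel_symm by (intro CollectI exI[of _ x] exI[of _ "y @ z"]) (use l 3 in simp)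
  qed
qed

lemma iso_arr_Ident: "po_category C \<Longrightarrow> a \<in> Objs C \<Longrightarrow> iso_arr C a a (Ident C a)"
  unfolding iso_arr_def inverse_arrs_def
  by (metis po_category.Ident_in po_category.comp_Ident_left)

text \<open>The prop is strict: addition of objects is associative and unital on the nose, and
  associators and unitors are identities. Pentagon and triangle collapse, naturality of these
  isomorphisms becomes strict associativity and unitality of the tensor, and only the symmetry has
  content of its own.\<close>

lemma sm_po_category_WW: "sm_po_category WW"
proof (unfold_locales, goal_cases)
  case (5 f a b f' b' g p q g' r) then show ?case by (rule tensA_WW_comp)
next
  case (6 f a b f' g c d g')
  then show ?case
    by (simp add: leq_WW[OF tensA_WW_in[OF 6(1,3)] tensA_WW_in[OF 6(2,4)]] leq_WW[OF 6(1,2)] leq_WW[OF 6(3,4)]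
       tensA_WW[OF 6(1,3)] tensA_WW[OF 6(2,4)] tensO_WW rtens_mono)
next
  case (7 a b c) then show ?case
    using iso_arr_Ident[OF po_category_WW, of "a + b + c"] by (simp add: assoc_WW tensO_WW Objs_WW add.assoc)
next
  case (8 a) then show ?case
    using iso_arr_Ident[OF po_category_WW, of a] by (simp add: lunit_WW tensO_WW Objs_WW unitO_WW)
next
  case (9 a) then show ?case
    using iso_arr_Ident[OF po_category_WW, of a] by (simp add: runit_WW tensO_WW Objs_WW unitO_WW)
next
  case (12 f a a' g b b' h c c')
  have "tensA WW (tensA WW f g) h \<in> Homs WW (a + b + c) (a' + b' + c')"
    using 12 by (intro tensA_WW_in)
  then show ?case using 12
    by (simp add: assoc_WW WW.comp_Ident_left WW.comp_Ident_right tensA_WW_assoc)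
next
  case (16 a b c d)
  then show ?case by (simp add: assoc_WW tensO_WW tensA_WW_Ident WW.comp_Ident_left[OF Ident_WW_in] add.assoc)
next
  case (17 a b)
  then show ?case by (simp add: assoc_WW lunit_WW runit_WW tensO_WW unitO_WW tensA_WW_Ident WW.comp_Ident_left[OF Ident_WW_in])
next
  case (18 a b c)
  have s: "symm WW a (b + c) \<in> Homs WW (a + b + c) (b + c + a)" using symm_WW_in[of a "b + c"] by (simp add: add.assoc)
  have t: "tensA WW (symm WW a b) (Ident WW c) \<in> Homs WW (a + b + c) (b + a + c)"
    using symm_WW_in Ident_WW_in by (rule tensA_WW_in)
  show ?case by (simp add: assoc_WW tensO_WW WW.comp_Ident_left[OF s] WW.comp_Ident_right[OF s] symm_WW_hexagon[symmetric]
     WW.comp_Ident_left[OF t])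
qed (auto simp: Objs_WW tensO_WW unitO_WW Ident_WW_in lunit_WW runit_WW tensA_WW_in tensA_WW_Ident symm_WW_in symm_WW_symm
    tensA_WW_unit WW.comp_Ident_left WW.comp_Ident_right symm_WW_natural)

section \<open>The supply of the cospan prop in itself\<close>

definition blocks :: "nat \<Rightarrow> 'v set \<Rightarrow> 'v list set" where
  "blocks k V = {v. length v = k \<and> set v \<subseteq> V}"

definition flat :: "('v list list \<times> 'v list list) set \<Rightarrow> ('v list \<times> 'v list) set" where
  "flat R = {(concat A, concat B) | A B. (A, B) \<in> R}"

lemma flatI: "(A, B) \<in> R \<Longrightarrow> (concat A, concat B) \<in> flat R"
  by (auto simp: flat_def)

lemma flatE:
  assumes "(u, v) \<in> flat R" obtains A B where "u = concat A" "v = concat B" "(A, B) \<in> R"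
  using assms by (auto simp: flat_def)

lemma flat_mono: "R \<subseteq> Q \<Longrightarrow> flat R \<subseteq> flat Q"
  unfolding flat_def by blast

lemma length_concat_blocks: "set A \<subseteq> blocks k V \<Longrightarrow> length (concat A) = length A * k"
  by (induction A) (auto simp: blocks_def)

lemma set_concat_blocks: "set A \<subseteq> blocks k V \<Longrightarrow> set (concat A) \<subseteq> V"
  by (auto simp: blocks_def)

text \<open>Blocks of one length, equally many on both sides, leave only one way to cut the list.
  Through this uniqueness flattening commutes with composition of relations.\<close>

lemma concat_blocks_inject:
  assumes "set A \<subseteq> blocks k V" "set B \<subseteq> blocks k V" "length A = length B" "concat A = concat B"
  shows "A = B"
  using assms(4,3)
proof (rule concat_injective)
  show "\<forall>(x, y)\<in>set (zip A B). length x = length y"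
  proof clarify
    fix x y assume "(x, y) \<in> set (zip A B)"
    then have "x \<in> set A" "y \<in> set B" by (auto dest: set_zip_leftD set_zip_rightD)
    then show "length x = length y" using assms(1,2) by (auto simp: blocks_def)
  qed
qed

lemma blocks_exist:
  assumes "length v = n * k" "set v \<subseteq> V"
  obtains A where "v = concat A" "length A = n" "set A \<subseteq> blocks k V"
proof -
  have "\<exists>A. v = concat A \<and> length A = n \<and> set A \<subseteq> blocks k V" using assms
  proof (induction n arbitrary: v)
    case (Suc n)
    have "length (drop k v) = n * k" "set (drop k v) \<subseteq> V"
      using Suc.prems set_drop_subset[of k v] by auto
    then obtain A where A: "drop k v = concat A" "length A = n" "set A \<subseteq> blocks k V"
      using Suc.IH by blast
    have "take k v \<in> blocks k V" using Suc.prems set_take_subset[of k v] by (auto simp: blocks_def)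
    then show ?case using A by (intro exI[of _ "take k v # A"]) (simp flip: A(1))
  qed simp
  then show thesis using that by blast
qed

lemma copies_in: "x \<in> cospans m n \<Longrightarrow> cospan_copies k x \<in> cospans (m * k) (n * k)"
  by (cases x) (auto simp: cospans_def copies_def length_concat o_def sum_list_triv)

text \<open>Currying: a function from \<open>S \<times> {0..<k}\<close> to \<open>V\<close> is a
  function from \<open>S\<close> to lists of length \<open>k\<close>. As \<open>copies\<close> keeps
  the copies of one point together, its values appear as consecutive blocks.\<close>

lemma crel_copies:
  assumes "x \<in> cospans m n"
  shows "crel (cospan_copies k x) V = flat (crel x (blocks k V))"
proof -
  obtain S xs ys where x: "x = (S, xs, ys)" by (cases x)
  have sub: "set xs \<subseteq> S" "set ys \<subseteq> S" using assms by (auto simp: x cospans_def)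
  have map_copies: "map h (copies k zs) = concat (map (\<lambda>s. map (\<lambda>r. h (prod_encode (s, r))) [0..<k]) zs)"
    for h :: "nat \<Rightarrow> 'a" and zs
    by (simp add: copies_def map_concat o_def)
  show ?thesis
  proof (intro subset_antisym subrelI)
    fix u v assume "(u, v) \<in> crel (cospan_copies k x) V"
    then obtain h where h: "h \<in> prod_encode ` (S \<times> {0..<k}) \<rightarrow> V" "u = map h (copies k xs)" "v = map h (copies k ys)"
      by (auto simp: x crel_simp)
    have "(\<lambda>s. map (\<lambda>r. h (prod_encode (s, r))) [0..<k]) \<in> S \<rightarrow> blocks k V"
      using h(1) by (auto simp: blocks_def Pi_iff)
    from crelI[OF this] show "(u, v) \<in> flat (crel x (blocks k V))"
      unfolding x h map_copies by (rule flatI)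
  next
    fix u v assume "(u, v) \<in> flat (crel x (blocks k V))"
    then obtain h where h: "h \<in> S \<rightarrow> blocks k V" "u = concat (map h xs)" "v = concat (map h ys)"
      by (auto simp: x crel_simp elim!: flatE)
    define g where "g z = (case prod_decode z of (s, r) \<Rightarrow> h s ! r)" for z
    have len: "length (h s) = k" if "s \<in> S" for s using h(1) that by (auto simp: blocks_def)
    have "g \<in> prod_encode ` (S \<times> {0..<k}) \<rightarrow> V"
    proof
      fix z assume "z \<in> prod_encode ` (S \<times> {0..<k})"
      then obtain s r where z: "z = prod_encode (s, r)" "s \<in> S" "r < k" by auto
      then have "h s ! r \<in> set (h s)" by (simp add: len)
      then show "g z \<in> V" using h(1) z by (auto simp: g_def blocks_def)
    qed
    moreover have "map g (copies k zs) = concat (map h zs)" if "set zs \<subseteq> S" for zs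
      unfolding map_copies using that len
      by (intro arg_cong[of _ _ concat] map_cong refl) (auto simp: g_def intro!: nth_equalityI)
    ultimately show "(u, v) \<in> crel (cospan_copies k x) V"
      unfolding x cospan_copies.simps h(2,3) using sub by (metis crelI)
  qed
qed

lemma Setcompr_image1: "{f (g x) | x. x \<in> X} = {f w | w. \<exists>x\<in>X. w = g x}"
  by blast

lemma WW_supply:
  assumes X: "X \<in> Homs WW m n"
  shows "WW_supply k X \<in> Homs WW (m * k) (n * k)" "wrel (WW_supply k X) V = flat (wrel X (blocks k V))"
proof -
  let ?\<Phi> = "\<lambda>w. \<exists>x\<in>X. w = cospan_copies k x"
  obtain x where x: "x \<in> X" using X by (rule Homs_WW_nonempty)
  note X' = wrel_eq_crel[OF X]
  have w: "?\<Phi> (cospan_copies k x)" using x by blast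
  have \<Phi>: "v \<in> cospans (m * k) (n * k)" if "?\<Phi> v" for v
    using that copies_in X'(2) by blast
  have \<Phi>': "crel v V = flat (wrel X (blocks k V))" if v: "?\<Phi> v" for v and V :: "nat set"
  proof -
    obtain x where x: "x \<in> X" "v = cospan_copies k x" using v by blast
    show ?thesis unfolding x(2) crel_copies[OF X'(2)[OF x(1)]] X'(1)[OF x(1)] ..
  qed
  have "WW_supply k X = \<Union>{cospan_class w | w. ?\<Phi> w}"
    unfolding WW_supply_def by (intro arg_cong[of _ _ Union] Setcompr_image1)
  also have "\<dots> = cospan_class (cospan_copies k x)"
    using w by (rule Union_cospan_class[where m = "m * k" and n = "n * k"]) (use \<Phi> \<Phi>' in auto)
  finally have eq: "WW_supply k X = cospan_class (cospan_copies k x)" .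
  show "WW_supply k X \<in> Homs WW (m * k) (n * k)"
    unfolding Homs_WW eq by (rule bexI, rule refl) (rule \<Phi>, rule w)
  show "wrel (WW_supply k X) V = flat (wrel X (blocks k V))"
    unfolding eq wrel_cospan_class[OF \<Phi>[OF w]] crel_copies[OF X'(2)[OF x]] X'(1)[OF x] ..
qed

lemmas WW_supply_in = WW_supply(1) and wrel_supply = WW_supply(2)

lemma WW_supply_Ident: "WW_supply k (Ident WW n) = Ident WW (n * k)"
proof (rule WW_eqI[OF WW_supply_in[OF Ident_WW_in] Ident_WW_in], intro subset_antisym subrelI)
  fix V :: "nat set" and u v
  assume "(u, v) \<in> wrel (Ident WW (n * k)) V"
  then have u: "v = u" "length u = n * k" "set u \<subseteq> V" by (auto simp: wrel_Ident)
  obtain A where "u = concat A" "length A = n" "set A \<subseteq> blocks k V"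
    using u(2,3) by (rule blocks_exist)
  then show "(u, v) \<in> wrel (WW_supply k (Ident WW n)) V"
    by (simp add: u wrel_supply[OF Ident_WW_in] flatI wrel_Ident)
next
  fix V :: "nat set" and u v
  assume "(u, v) \<in> wrel (WW_supply k (Ident WW n)) V"
  then obtain A where "u = concat A" "v = concat A" "length A = n" "set A \<subseteq> blocks k V"
    unfolding wrel_supply[OF Ident_WW_in] by (auto simp: wrel_Ident elim!: flatE)
  then show "(u, v) \<in> wrel (Ident WW (n * k)) V"
    using length_concat_blocks set_concat_blocks unfolding wrel_Ident by metis
qed

lemma WW_supply_comp:
  assumes X: "X \<in> Homs WW m n" and Y: "Y \<in> Homs WW n p"
  shows "WW_supply k (comp WW Y X) = comp WW (WW_supply k Y) (WW_supply k X)"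
proof (rule WW_eqI)
  note l = WW_supply[OF comp_WW_in[OF X Y], of k] and r = comp_WW[OF WW_supply_in[OF X] WW_supply_in[OF Y], of k]
  show "WW_supply k (comp WW Y X) \<in> Homs WW (m * k) (p * k)" by (rule l)
  show "comp WW (WW_supply k Y) (WW_supply k X) \<in> Homs WW (m * k) (p * k)" by (rule r)
  fix V :: "nat set"
  show "wrel (WW_supply k (comp WW Y X)) V = wrel (comp WW (WW_supply k Y) (WW_supply k X)) V"
    unfolding l r wrel_supply[OF X] wrel_supply[OF Y] wrel_comp[OF X Y]
  proof (intro subset_antisym subrelI)
    fix u v assume "(u, v) \<in> flat (wrel X (blocks k V)) O flat (wrel Y (blocks k V))"
    then obtain A B B' C where *: "u = concat A" "v = concat C" "concat B = concat B'"
      "(A, B) \<in> wrel X (blocks k V)" "(B', C) \<in> wrel Y (blocks k V)"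
      by (elim relcompE flatE) auto
    have "B = B'"
      by (rule concat_blocks_inject[OF wrel_length(4)[OF X *(4)] wrel_length(3)[OF Y *(5)] _ *(3)])
        (simp add: wrel_length[OF X *(4)] wrel_length[OF Y *(5)])
    then show "(u, v) \<in> flat (wrel X (blocks k V) O wrel Y (blocks k V))"
      using * by (auto intro: flatI)
  qed (auto elim!: flatE intro: flatI)
qed

lemma WW_supply_mono:
  assumes X: "X \<in> Homs WW m n" "Y \<in> Homs WW m n" and "leq WW X Y"
  shows "leq WW (WW_supply k X) (WW_supply k Y)"
  unfolding leq_WW[OF WW_supply_in[OF X(1)] WW_supply_in[OF X(2)]] wrel_supply[OF X(1)] wrel_supply[OF X(2)]
  by (intro allI impI flat_mono leq_WW_wrel_mono[OF assms])

lemma WW_supply_tensA: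
  assumes X: "X \<in> Homs WW m n" and Y: "Y \<in> Homs WW p q"
  shows "WW_supply k (tensA WW X Y) = tensA WW (WW_supply k X) (WW_supply k Y)"
proof (rule WW_eqI)
  note l = WW_supply[OF tensA_WW_in[OF X Y], of k] and r = tensA_WW[OF WW_supply_in[OF X] WW_supply_in[OF Y], of k k]
  show "WW_supply k (tensA WW X Y) \<in> Homs WW (m * k + p * k) (n * k + q * k)"
    using l(1) by (simp add: distrib_right)
  show "tensA WW (WW_supply k X) (WW_supply k Y) \<in> Homs WW (m * k + p * k) (n * k + q * k)" by (rule r)
  fix V :: "nat set"
  show "wrel (WW_supply k (tensA WW X Y)) V = wrel (tensA WW (WW_supply k X) (WW_supply k Y)) V"
    unfolding l r wrel_supply[OF X] wrel_supply[OF Y] wrel_tensA[OF X Y]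
  proof (intro subset_antisym subrelI)
    fix u v assume "(u, v) \<in> rtens (flat (wrel X (blocks k V))) (flat (wrel Y (blocks k V)))"
    then obtain A B C D where *: "u = concat (A @ C)" "v = concat (B @ D)"
      "(A, B) \<in> wrel X (blocks k V)" "(C, D) \<in> wrel Y (blocks k V)"
      by (elim rtensE flatE) auto
    then show "(u, v) \<in> flat (rtens (wrel X (blocks k V)) (wrel Y (blocks k V)))"
      unfolding *(1,2) by (intro flatI rtensI)
  next
    fix u v assume "(u, v) \<in> flat (rtens (wrel X (blocks k V)) (wrel Y (blocks k V)))"
    then obtain A B C D where *: "u = concat A @ concat C" "v = concat B @ concat D"
      "(A, B) \<in> wrel X (blocks k V)" "(C, D) \<in> wrel Y (blocks k V)"
      by (elim flatE rtensE) auto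
    then show "(u, v) \<in> rtens (flat (wrel X (blocks k V))) (flat (wrel Y (blocks k V)))"
      unfolding *(1,2) by (intro flatI rtensI)
  qed
qed

lemma WW_supply_symm: "WW_supply k (symm WW m n) = symm WW (m * k) (n * k)"
proof (rule WW_eqI)
  note l = WW_supply[OF symm_WW_in, of k]
  show "WW_supply k (symm WW m n) \<in> Homs WW (m * k + n * k) (n * k + m * k)"
    using l(1)[of m n] by (simp add: distrib_right)
  show "symm WW (m * k) (n * k) \<in> Homs WW (m * k + n * k) (n * k + m * k)" by (rule symm_WW_in)
  fix V :: "nat set"
  show "wrel (WW_supply k (symm WW m n)) V = wrel (symm WW (m * k) (n * k)) V"
    unfolding l
  proof (intro subset_antisym subrelI)
    fix u v assume "(u, v) \<in> flat (wrel (symm WW m n) (blocks k V))"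
    then obtain A B where *: "u = concat A @ concat B" "v = concat B @ concat A" "length A = m" "length B = n"
      "set A \<subseteq> blocks k V" "set B \<subseteq> blocks k V"
      by (elim flatE wrel_symmE) auto
    show "(u, v) \<in> wrel (symm WW (m * k) (n * k)) V"
      unfolding wrel_symm *(1,2)
      using *(3-) length_concat_blocks[OF *(5)] length_concat_blocks[OF *(6)]
        set_concat_blocks[OF *(5)] set_concat_blocks[OF *(6)] by blast
  next
    fix u v assume "(u, v) \<in> wrel (symm WW (m * k) (n * k)) V"
    then obtain a b where *: "u = a @ b" "v = b @ a" "length a = m * k" "length b = n * k" "set a \<subseteq> V" "set b \<subseteq> V"
      by (rule wrel_symmE)
    obtain A where A: "a = concat A" "length A = m" "set A \<subseteq> blocks k V"
      using *(3,5) by (rule blocks_exist)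
    obtain B where B: "b = concat B" "length B = n" "set B \<subseteq> blocks k V"
      using *(4,6) by (rule blocks_exist)
    have "(A @ B, B @ A) \<in> wrel (symm WW m n) (blocks k V)" using A B unfolding wrel_symm by blast
    from flatI[OF this] show "(u, v) \<in> flat (wrel (symm WW m n) (blocks k V))"
      by (simp add: * A B)
  qed
qed

text \<open>There is exactly one block of length 0, so every related pair flattens to two empty
  lists, and a pair exists because a constant function on the apex does. This gives the supply
  finite support in the coproduct and makes it trivial at the unit object.\<close>

lemma WW_supply_zero:
  assumes X: "X \<in> Homs WW m n" shows "WW_supply 0 X = Ident WW 0"
proof (rule WW_eqI[of _ 0 0])
  show "WW_supply 0 X \<in> Homs WW 0 0" using WW_supply_in[OF X, of 0] by simp
  fix V :: "nat set"
  have blocks: "blocks 0 V = {[]}" by (auto simp: blocks_def)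
  obtain S xs ys where x: "(S, xs, ys) \<in> X" using X by (rule wrel_repr)
  have "\<exists>A B. (A, B) \<in> wrel X {[] :: nat list}"
    unfolding wrel_iff[OF X x] 
    by (rule exI[of _ "map (\<lambda>_. []) xs"], rule exI[of _ "map (\<lambda>_. []) ys"], rule bexI[of _ "\<lambda>_. []"]) simp_all
  moreover have "concat A = [] \<and> concat B = []" if "(A, B) \<in> wrel X {[] :: nat list}" for A B
    using wrel_length(3,4)[OF X that] by auto
  ultimately have flat: "flat (wrel X {[] :: nat list}) = {([], [])}" unfolding flat_def by force
  show "wrel (WW_supply 0 X) V = wrel (Ident WW 0) V"
    unfolding wrel_supply[OF X] blocks flat by (intro subset_antisym subrelI) (simp_all add: wrel_Ident)
qed (rule Ident_WW_in)

section \<open>Interleaving of blocks and the tensor of objects\<close>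

definition WW_swap :: "nat \<Rightarrow> nat \<Rightarrow> nat \<Rightarrow> nat \<Rightarrow> cospan set" where
  "WW_swap a b c d = tensA WW (Ident WW a) (tensA WW (symm WW b c) (Ident WW d))"

lemma WW_swap:
  shows "WW_swap a b c d \<in> Homs WW (a + b + (c + d)) (a + c + (b + d))"
    "wrel (WW_swap a b c d) V = {(x @ y @ z @ w, x @ z @ y @ w) | x y z w.
      x \<in> blocks a V \<and> y \<in> blocks b V \<and> z \<in> blocks c V \<and> w \<in> blocks d V}" (is "_ = ?R")
proof -
  note s = tensA_WW[OF symm_WW_in Ident_WW_in, of b c d]
  note M = tensA_WW[OF Ident_WW_in s(1), of a]
  show "WW_swap a b c d \<in> Homs WW (a + b + (c + d)) (a + c + (b + d))"
    using M(1) by (simp add: WW_swap_def add.assoc)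
  show "wrel (WW_swap a b c d) V = ?R"
    unfolding WW_swap_def M(2) s(2)
  proof (intro subset_antisym subrelI)
    fix u v assume "(u, v) \<in> rtens (wrel (Ident WW a) V) (rtens (wrel (symm WW b c) V) (wrel (Ident WW d) V))"
    then obtain x y z w where "u = x @ y @ z @ w" "v = x @ z @ y @ w" "x \<in> blocks a V" "y \<in> blocks b V"
      "z \<in> blocks c V" "w \<in> blocks d V"
      by (elim rtensE wrel_symmE) (auto simp: wrel_Ident blocks_def)
    then show "(u, v) \<in> ?R" by blast
  next
    fix u v assume "(u, v) \<in> ?R"
    then obtain x y z w where *: "u = x @ ((y @ z) @ w)" "v = x @ ((z @ y) @ w)" "x \<in> blocks a V" "y \<in> blocks b V"
      "z \<in> blocks c V" "w \<in> blocks d V" by auto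
    have "(y @ z, z @ y) \<in> wrel (symm WW b c) V" using * unfolding wrel_symm blocks_def by blast
    then show "(u, v) \<in> rtens (wrel (Ident WW a) V) (rtens (wrel (symm WW b c) V) (wrel (Ident WW d) V))"
      unfolding *(1,2) using *(3,6) by (intro rtensI) (auto simp: wrel_Ident blocks_def)
  qed
qed

text \<open>The value of \<open>tpow_zip\<close> in the prop, with \<open>WW_swap\<close> in the
  role of \<open>middle_swap\<close> now that associators are identities. The recursion starts at 0,
  whereas \<open>tpow_zip\<close> treats 0 and 1 separately; \<open>block_zip_one\<close> reconciles
  the two.\<close>

fun block_zip :: "nat \<Rightarrow> nat \<Rightarrow> nat \<Rightarrow> cospan set" where
  "block_zip k l 0 = Ident WW 0"
| "block_zip k l (Suc n) = comp WW (tensA WW (block_zip k l n) (Ident WW (k + l)))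
     (WW_swap (n * k) k (n * l) l)"

definition zipped :: "nat \<Rightarrow> nat \<Rightarrow> nat \<Rightarrow> 'v set \<Rightarrow> ('v list \<times> 'v list) set" where
  "zipped k l n V = {(concat A @ concat B, concat (map2 (@) A B)) | A B.
     length A = n \<and> length B = n \<and> set A \<subseteq> blocks k V \<and> set B \<subseteq> blocks l V}"

lemma block_zip:
  shows "block_zip k l n \<in> Homs WW (n * k + n * l) (n * (k + l))"
    "wrel (block_zip k l n) V = zipped k l n V"
proof (induction n)
  case 0
  { case 1 show ?case by (simp add: Ident_WW_in) }
  { case 2 show ?case by (auto simp: wrel_Ident zipped_def) }
next
  case (Suc n)
  note t = tensA_WW[OF Suc(1) Ident_WW_in, of "k + l"]
  note s = WW_swap[of "n * k" k "n * l" l]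
  have s1: "WW_swap (n * k) k (n * l) l
    \<in> Homs WW (n * k + k + (n * l + l)) (n * k + n * l + (k + l))" using s(1) by simp
  note c = comp_WW[OF s1 t(1)]
  { case 1 show ?case using c(1) by (simp add: add.commute) }
  { case 2 show ?case unfolding block_zip.simps c(2)
    proof (intro subset_antisym subrelI)
      fix u v
      assume "(u, v) \<in> wrel (WW_swap (n * k) k (n * l) l) V O
        wrel (tensA WW (block_zip k l n) (Ident WW (k + l))) V"
      then obtain w where w: "(u, w) \<in> wrel (WW_swap (n * k) k (n * l) l) V"
        "(w, v) \<in> rtens (wrel (block_zip k l n) V) (wrel (Ident WW (k + l)) V)"
        unfolding t by blast
      from w(1) obtain x y z r where 1: "u = x @ y @ z @ r" "w = x @ z @ y @ r" "x \<in> blocks (n * k) V"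
        "y \<in> blocks k V" "z \<in> blocks (n * l) V" "r \<in> blocks l V" unfolding s by blast
      from w(2) obtain A B e where 2: "w = concat A @ concat B @ e" "v = concat (map2 (@) A B) @ e"
        "length A = n" "length B = n" "set A \<subseteq> blocks k V" "set B \<subseteq> blocks l V" "e \<in> blocks (k + l) V"
        unfolding Suc(2) zipped_def by (elim rtensE) (auto simp: wrel_Ident blocks_def)
      \<comment> \<open>Swap and tensor both cut the middle list after \<open>n * k\<close> and then
        \<open>n * l\<close> entries; the remainder \<open>e\<close>, of length
        \<open>k + l\<close>, holds the two last blocks.\<close>
      have "x = concat A" "z = concat B" "e = y @ r"
        using 1(2,3,5) 2(1) length_concat_blocks[OF 2(5)] length_concat_blocks[OF 2(6)] 2(3,4)
        by (auto simp: blocks_def)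
      then have "u = concat (A @ [y]) @ concat (B @ [r])" "v = concat (map2 (@) (A @ [y]) (B @ [r]))"
        using 1 2 by auto
      moreover have "length (A @ [y]) = Suc n" "length (B @ [r]) = Suc n"
        "set (A @ [y]) \<subseteq> blocks k V" "set (B @ [r]) \<subseteq> blocks l V" using 1 2 by auto
      ultimately show "(u, v) \<in> zipped k l (Suc n) V" unfolding zipped_def by blast
    next
      fix u v assume "(u, v) \<in> zipped k l (Suc n) V"
      then obtain A' B' where AB': "u = concat A' @ concat B'" "v = concat (map2 (@) A' B')"
        "length A' = Suc n" "length B' = Suc n" "set A' \<subseteq> blocks k V" "set B' \<subseteq> blocks l V" unfolding zipped_def by blast
      obtain A y where A: "A' = A @ [y]" using AB'(3) by (cases A' rule: rev_cases) auto
      obtain B r where B: "B' = B @ [r]" using AB'(4) by (cases B' rule: rev_cases) auto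
      have len: "length A = n" "length B = n" and set: "set A \<subseteq> blocks k V" "set B \<subseteq> blocks l V" "y \<in> blocks k V" "r \<in> blocks l V"
        using AB' A B by auto
      have "concat A \<in> blocks (n * k) V" "concat B \<in> blocks (n * l) V"
        using length_concat_blocks[OF set(1)] length_concat_blocks[OF set(2)] set_concat_blocks[OF set(1)]
          set_concat_blocks[OF set(2)] len by (auto simp: blocks_def)
      then have "(concat A @ y @ concat B @ r, concat A @ concat B @ y @ r)
        \<in> wrel (WW_swap (n * k) k (n * l) l) V"
        unfolding s using set by blast
      moreover have "((concat A @ concat B) @ (y @ r), concat (map2 (@) A B) @ (y @ r))
        \<in> wrel (tensA WW (block_zip k l n) (Ident WW (k + l))) V"
        unfolding t
      proof (rule rtensI)
        show "(concat A @ concat B, concat (map2 (@) A B)) \<in> wrel (block_zip k l n) V"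
          unfolding Suc(2) zipped_def using len set by blast
        show "(y @ r, y @ r) \<in> wrel (Ident WW (k + l)) V" using set by (auto simp: wrel_Ident blocks_def)
      qed
      ultimately show "(u, v) \<in> wrel (WW_swap (n * k) k (n * l) l) V O
        wrel (tensA WW (block_zip k l n) (Ident WW (k + l))) V"
        using AB' A B len by auto
    qed }
qed

lemma blocks_split:
  assumes "set C \<subseteq> blocks (k + l) V"
  shows "C = map2 (@) (map (take k) C) (map (drop k) C)" "set (map (take k) C) \<subseteq> blocks k V"
    "set (map (drop k) C) \<subseteq> blocks l V"
  using assms by (auto simp: zip_map_map zip_same_conv_map blocks_def o_def dest: in_set_takeD in_set_dropD)

text \<open>A function from the apex to blocks of length \<open>k + l\<close> is a pair of functions
  to blocks of lengths \<open>k\<close> and \<open>l\<close>: two such functions are joined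
  pointwise by append, and a single one is split by \<open>take k\<close> and \<open>drop k\<close>.
  Unique cutting of flattened lists makes the legs fit.\<close>

lemma WW_supply_zip:
  assumes X: "X \<in> Homs WW m n"
  shows "comp WW (block_zip k l n) (tensA WW (WW_supply k X) (WW_supply l X)) =
    comp WW (WW_supply (k + l) X) (block_zip k l m)" (is "?l = ?r")
proof (rule WW_eqI)
  note t = tensA_WW[OF WW_supply_in[OF X] WW_supply_in[OF X], of k l]
  note L = comp_WW[OF t(1) block_zip(1)] and R = comp_WW[OF block_zip(1) WW_supply_in[OF X]]
  show "?l \<in> Homs WW (m * k + m * l) (n * (k + l))"
    "?r \<in> Homs WW (m * k + m * l) (n * (k + l))" by (rule L R)+
  fix V :: "nat set"
  obtain S xs ys where x: "(S, xs, ys) \<in> X" "length xs = m" "length ys = n" "set xs \<subseteq> S" "set ys \<subseteq> S" using X by (rule wrel_repr)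
  have ml: "map (take k) (map2 (@) A B) = A" "map (drop k) (map2 (@) A B) = B"
    if "length A = length B" "set A \<subseteq> blocks k V" for A B :: "nat list list"
    using that by (induction A B rule: list_induct2) (auto simp: blocks_def)
  show "wrel ?l V =
    wrel ?r V"
    unfolding L R t wrel_supply[OF X] block_zip(2)
  proof (intro subset_antisym subrelI)
    fix u v assume "(u, v) \<in> rtens (flat (wrel X (blocks k V))) (flat (wrel X (blocks l V))) O zipped k l n V"
    then obtain A B A' B' C D where *: "u = concat A @ concat B" "concat A' @ concat B' = concat C @ concat D"
      "v = concat (map2 (@) C D)" "length C = n" "length D = n" "set C \<subseteq> blocks k V" "set D \<subseteq> blocks l V"
      "(A, A') \<in> wrel X (blocks k V)" "(B, B') \<in> wrel X (blocks l V)"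
      unfolding zipped_def by (elim relcompE rtensE flatE) auto
    note A = wrel_length[OF X *(8)] and B = wrel_length[OF X *(9)]
    have "length (concat A') = length (concat C)"
      using length_concat_blocks[OF A(4)] length_concat_blocks[OF *(6)] A *(4) by simp
    then have "concat A' = concat C" "concat B' = concat D" using *(2) by auto
    then have C: "A' = C" "B' = D"
      using concat_blocks_inject[OF A(4) *(6)] concat_blocks_inject[OF B(4) *(7)] A B *(4,5) by auto
    obtain h where h: "h \<in> S \<rightarrow> blocks k V" "A = map h xs" "C = map h ys"
      using *(8) unfolding C wrel_iff[OF X x(1)] by blast
    obtain g where g: "g \<in> S \<rightarrow> blocks l V" "B = map g xs" "D = map g ys"
      using *(9) unfolding C wrel_iff[OF X x(1)] by blast
    have "(\<lambda>s. h s @ g s) \<in> S \<rightarrow> blocks (k + l) V" using h(1) g(1) by (auto simp: blocks_def Pi_iff)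
    then have "(map2 (@) A B, map2 (@) C D) \<in> wrel X (blocks (k + l) V)"
      unfolding wrel_iff[OF X x(1)] h g by (rule bexI[rotated]) (simp add: zip_map_map zip_same_conv_map o_def)
    from flatI[OF this] have "(concat (map2 (@) A B), v) \<in> flat (wrel X (blocks (k + l) V))"
      unfolding *(3) .
    moreover have "(u, concat (map2 (@) A B)) \<in> zipped k l m V"
      unfolding zipped_def using *(1) A B by blast
    ultimately show "(u, v) \<in> zipped k l m V O flat (wrel X (blocks (k + l) V))" by blast
  next
    fix u v assume "(u, v) \<in> zipped k l m V O flat (wrel X (blocks (k + l) V))"
    then obtain A B C D where *: "u = concat A @ concat B" "length A = m" "length B = m" "set A \<subseteq> blocks k V"
      "set B \<subseteq> blocks l V" "concat C = concat (map2 (@) A B)" "v = concat D" "(C, D) \<in> wrel X (blocks (k + l) V)"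
      unfolding zipped_def by (elim relcompE flatE) auto
    note C = wrel_length[OF X *(8)]
    have "set (map2 (@) A B) \<subseteq> blocks (k + l) V"
      using *(4,5) by (fastforce simp: blocks_def dest: set_zip_leftD set_zip_rightD)
    then have AB: "map2 (@) A B = C"
      using concat_blocks_inject[OF _ C(3) _ *(6)[symmetric]] C(1) *(2,3) by simp
    have A: "A = map (take k) C" "B = map (drop k) C" using ml[of A B] *(2-4) by (simp_all add: AB)
    have "take k \<in> blocks (k + l) V \<rightarrow> blocks k V" "drop k \<in> blocks (k + l) V \<rightarrow> blocks l V"
      by (auto simp: blocks_def dest: in_set_takeD in_set_dropD)
    from this[THEN wrel_map[OF X *(8)]]
    have "(u, concat (map (take k) D) @ concat (map (drop k) D)) \<in>
      rtens (flat (wrel X (blocks k V))) (flat (wrel X (blocks l V)))"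
      unfolding *(1) A by (intro rtensI flatI)
    moreover have "(concat (map (take k) D) @ concat (map (drop k) D), v) \<in> zipped k l n V"
      using blocks_split[OF C(4)] C(2) unfolding *(7) zipped_def
      by (intro CollectI exI[of _ "map (take k) D"] exI[of _ "map (drop k) D"]) simp
    ultimately show "(u, v) \<in> rtens (flat (wrel X (blocks k V))) (flat (wrel X (blocks l V))) O zipped k l n V" by blast
  qed
qed

section \<open>Coproducts of the cospan prop\<close>

text \<open>\<open>e\<close> is the default entry: 0 for objects, the identity of 0 for morphisms.
  The condition is preserved by every pointwise operation that sends defaults to the
  default.\<close>

definition fsupp :: "'j set \<Rightarrow> 'x \<Rightarrow> ('j \<Rightarrow> 'x) \<Rightarrow> bool" where
  "fsupp J e f \<longleftrightarrow> finite {j. f j \<noteq> e} \<and> {j. f j \<noteq> e} \<subseteq> J"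

lemma fsupp_map:
  assumes "fsupp J e f" "h e = e'" shows "fsupp J e' (\<lambda>j. h (f j))"
proof -
  have "{j. h (f j) \<noteq> e'} \<subseteq> {j. f j \<noteq> e}" using assms(2) by auto
  then show ?thesis using assms(1) unfolding fsupp_def by (meson finite_subset order_trans)
qed

lemma fsupp_map2:
  assumes "fsupp J e f" "fsupp J e' g" "h e e' = e''" shows "fsupp J e'' (\<lambda>j. h (f j) (g j))"
proof -
  have "{j. h (f j) (g j) \<noteq> e''} \<subseteq> {j. f j \<noteq> e} \<union> {j. g j \<noteq> e'}" using assms(3) by auto
  then show ?thesis using assms(1,2) unfolding fsupp_def by (meson finite_subset finite_UnI Un_least order_trans)
qed

lemma fsupp_const: "fsupp J e (\<lambda>_. e)"
  by (simp add: fsupp_def)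

interpretation WW: sm_po_category WW by (rule sm_po_category_WW)

context
  fixes J :: "'j set"
begin

abbreviation (input) CJ where "CJ \<equiv> coprod_WW J"

lemma Objs_C: "n \<in> Objs CJ \<longleftrightarrow> fsupp J 0 n"
  by (simp add: coprod_WW_def fsupp_def)

lemma Homs_C: "f \<in> Homs CJ m n \<longleftrightarrow> m \<in> Objs CJ \<and> n \<in> Objs CJ \<and>
    (\<forall>j. f j \<in> Homs WW (m j) (n j)) \<and> fsupp J (Ident WW 0) f"
  unfolding Objs_C by (auto simp: coprod_WW_def fsupp_def)

lemma coprod_fields:
  "Ident CJ n = (\<lambda>j. Ident WW (n j))"
  "comp CJ g f = (\<lambda>j. comp WW (g j) (f j))"
  "leq CJ f g \<longleftrightarrow> (\<forall>j. leq WW (f j) (g j))"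
  "tensO CJ m n = (\<lambda>j. m j + n j)"
  "tensA CJ f g = (\<lambda>j. tensA WW (f j) (g j))"
  "unitO CJ = (\<lambda>j. 0)"
  "assoc CJ a b c = Ident CJ (\<lambda>j. a j + b j + c j)"
  "lunit CJ n = Ident CJ n"
  "runit CJ n = Ident CJ n"
  "symm CJ m n = (\<lambda>j. symm WW (m j) (n j))"
  by (simp_all add: coprod_WW_def tensO_WW unitO_WW assoc_WW lunit_WW runit_WW)

lemma Homs_C_D:
  assumes "f \<in> Homs CJ m n"
  shows "f j \<in> Homs WW (m j) (n j)" "m \<in> Objs CJ" "n \<in> Objs CJ"
  using assms by (auto simp: Homs_C)

lemma Ident_C_in: "n \<in> Objs CJ \<Longrightarrow> Ident CJ n \<in> Homs CJ n n"
  using fsupp_map[of J 0 n "Ident WW" "Ident WW 0"]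
  by (auto simp: Homs_C coprod_fields Objs_C Ident_WW_in)

lemma unitO_C_in: "unitO CJ \<in> Objs CJ"
  by (simp add: coprod_fields Objs_C fsupp_const)

lemma tensO_C_in: "a \<in> Objs CJ \<Longrightarrow> b \<in> Objs CJ \<Longrightarrow> tensO CJ a b \<in> Objs CJ"
  by (auto simp: coprod_fields Objs_C intro!: fsupp_map2[where h = "(+)"])

lemma comp_C_in: "f \<in> Homs CJ a b \<Longrightarrow> g \<in> Homs CJ b c \<Longrightarrow> comp CJ g f \<in> Homs CJ a c"
  unfolding Homs_C coprod_fields
  by (intro conjI allI fsupp_map2[where h = "comp WW" and e = "Ident WW 0" and e' = "Ident WW 0"])
    (auto intro: comp_WW_in simp: WW.comp_Ident_left[OF Ident_WW_in])

lemma tensA_C_in: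
  "f \<in> Homs CJ a b \<Longrightarrow> g \<in> Homs CJ c d \<Longrightarrow> tensA CJ f g \<in> Homs CJ (tensO CJ a c) (tensO CJ b d)"
  using tensO_C_in[of a c] tensO_C_in[of b d] unfolding Homs_C
  unfolding coprod_fields
  by (intro conjI allI fsupp_map2[where h = "tensA WW" and e = "Ident WW 0" and e' = "Ident WW 0"])
    (auto intro: tensA_WW_in simp: tensA_WW_unit[OF Ident_WW_in])

lemma symm_zero: "symm WW 0 0 = Ident WW 0"
  by (simp add: WW_def id_cospan_def)

lemma symm_C_in: "a \<in> Objs CJ \<Longrightarrow> b \<in> Objs CJ \<Longrightarrow> symm CJ a b \<in> Homs CJ (tensO CJ a b) (tensO CJ b a)"
  using tensO_C_in[of a b] tensO_C_in[of b a] unfolding Homs_C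
  unfolding coprod_fields
  by (intro conjI allI fsupp_map2[where h = "symm WW" and e = 0 and e' = 0])
    (auto intro: symm_WW_in simp: symm_zero Objs_C)

lemma po_category_C: "po_category CJ"
proof (standard, goal_cases)
  case (2 f a b a' b')
  have "a j = a' j \<and> b j = b' j" for j
    using WW.Homs_disjoint Homs_C_D(1)[OF 2(1)] Homs_C_D(1)[OF 2(2)] by blast
  then show ?case by auto
next
  case (9 f a b g) then show ?case
    unfolding coprod_fields by (intro ext) (meson WW.leq_antisym Homs_C_D)
next
  case (10 f a b g h) then show ?case
    unfolding coprod_fields by (meson WW.leq_trans Homs_C_D)
next
  case (11 f a b f' g c g') then show ?case
    unfolding coprod_fields by (meson WW.comp_mono Homs_C_D)
next
  case (7 f a b g c h d) show ?case
    unfolding coprod_fields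
    by (intro ext WW.comp_assoc) (rule 7[THEN Homs_C_D(1)])+
next
  case (5 f a b) show ?case
    unfolding coprod_fields by (intro ext WW.comp_Ident_left) (rule 5[THEN Homs_C_D(1)])
next
  case (6 f a b) show ?case
    unfolding coprod_fields by (intro ext WW.comp_Ident_right) (rule 6[THEN Homs_C_D(1)])
next
  case (8 f a b) show ?case
    unfolding coprod_fields by (intro allI WW.leq_refl) (rule 8[THEN Homs_C_D(1)])
qed (blast intro: Ident_C_in comp_C_in dest: Homs_C_D)+

lemma tensO_C_assoc: "(\<lambda>j. a j + b j + c j) = tensO CJ (tensO CJ a b) c"
  "tensO CJ a (tensO CJ b c) = tensO CJ (tensO CJ a b) c"
  by (simp_all add: coprod_fields add.assoc)

lemma tensO_C_unit: "tensO CJ (unitO CJ) a = a" "tensO CJ a (unitO CJ) = a"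
  by (simp_all add: coprod_fields)

lemma sm_po_category_C: "sm_po_category CJ"
proof -
  interpret po_category CJ by (rule po_category_C)
  show ?thesis
  proof (unfold_locales, goal_cases)
    case (4 a b) then show ?case by (simp add: coprod_fields tensA_WW_Ident)
  next
    case (5 f a b f' b' g p q g' r) show ?case
      unfolding coprod_fields by (intro ext tensA_WW_comp) (rule 5[THEN Homs_C_D(1)])+
  next
    case (6 f a b f' g c d g') then show ?case
      unfolding coprod_fields by (meson WW.tensA_mono Homs_C_D)
  next
    case (7 a b c)
    then show ?case unfolding coprod_fields(7) tensO_C_assoc
      by (intro iso_arr_Ident po_category_C tensO_C_in)
  next
    case (8 a) then show ?case
      unfolding coprod_fields(8) tensO_C_unit by (intro iso_arr_Ident po_category_C)
  next
    case (9 a) then show ?case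
      unfolding coprod_fields(9) tensO_C_unit by (intro iso_arr_Ident po_category_C)
  next
    case (11 a b) then show ?case by (simp add: coprod_fields symm_WW_symm)
  next
    case (12 f a a' g b b' h c c')
    have "tensA CJ (tensA CJ f g) h = tensA CJ f (tensA CJ g h)"
      unfolding coprod_fields by (intro ext tensA_WW_assoc) (rule 12[THEN Homs_C_D(1)])+
    moreover have "tensA CJ (tensA CJ f g) h \<in> Homs CJ (tensO CJ (tensO CJ a b) c) (tensO CJ (tensO CJ a' b') c')"
      by (intro tensA_C_in 12)
    ultimately show ?case unfolding coprod_fields(7) tensO_C_assoc
      by (simp add: comp_Ident_left comp_Ident_right)
  next
    case (13 f a b)
    have "tensA CJ (Ident CJ (unitO CJ)) f = f"
      unfolding coprod_fields by (intro ext tensA_WW_unit) (rule 13[THEN Homs_C_D(1)])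
    then show ?case using 13 by (simp add: coprod_fields(8) comp_Ident_left comp_Ident_right)
  next
    case (14 f a b)
    have "tensA CJ f (Ident CJ (unitO CJ)) = f"
      unfolding coprod_fields by (intro ext tensA_WW_unit) (rule 14[THEN Homs_C_D(1)])
    then show ?case using 14 by (simp add: coprod_fields(9) comp_Ident_left comp_Ident_right)
  next
    case (15 f a a' g b b')
    show ?case unfolding coprod_fields by (intro ext symm_WW_natural) (rule 15[THEN Homs_C_D(1)])+
  next
    case (16 a b c d)
    show ?case using WW.pentagon[unfolded Objs_WW tensO_WW assoc_WW]
      by (simp add: coprod_fields)
  next
    case (17 a b)
    show ?case using WW.triangle[unfolded Objs_WW tensO_WW assoc_WW lunit_WW runit_WW unitO_WW]
      by (simp add: coprod_fields)
  next
    case (18 a b c)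
    show ?case using WW.hexagon[unfolded Objs_WW tensO_WW assoc_WW]
      by (simp add: coprod_fields)
  qed (simp_all add: unitO_C_in tensO_C_in tensA_C_in symm_C_in)
qed

interpretation CJ: sm_po_category CJ by (rule sm_po_category_C)

section \<open>Tensor powers and canonical isomorphisms in the coproduct\<close>

lemma inverse_Ident: "a \<in> Objs CJ \<Longrightarrow> (THE g. inverse_arrs CJ a a (Ident CJ a) g) = Ident CJ a"
  by (rule the_equality)
    (auto simp: inverse_arrs_def CJ.Ident_in CJ.comp_Ident_left[OF CJ.Ident_in] CJ.comp_Ident_right)

lemma assoc_inv_C: "a \<in> Objs CJ \<Longrightarrow> b \<in> Objs CJ \<Longrightarrow> c \<in> Objs CJ \<Longrightarrow>
    assoc_inv CJ a b c = Ident CJ (tensO CJ (tensO CJ a b) c)"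
  unfolding assoc_inv_def coprod_fields(7) tensO_C_assoc by (intro inverse_Ident tensO_C_in)

lemma tpow_C: "tpow CJ c m = (\<lambda>j. m * c j)"
  by (induction CJ c m rule: tpow.induct) (auto simp: coprod_fields)

lemma tpow_C_in: "c \<in> Objs CJ \<Longrightarrow> tpow CJ c m \<in> Objs CJ"
  unfolding tpow_C Objs_C by (rule fsupp_map) auto

text \<open>The tensor of objects is strict, so both ends of every unitor and associator involved
  are the same object and the canonical map is an identity. The case split only follows the clauses
  of \<open>tpow_add\<close>.\<close>

lemma tpow_add_C: "c \<in> Objs CJ \<Longrightarrow> tpow_add CJ c m n = Ident CJ (tpow CJ c (m + n))"
proof (induction n)
  case 0 show ?case by (simp add: coprod_fields)
next
  case (Suc n)
  show ?case
  proof (cases m)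
    case 0 then show ?thesis by (simp add: coprod_fields)
  next
    case m: (Suc m')
    show ?thesis
    proof (cases n)
      case 0 then show ?thesis by (simp add: m)
    next
      case n: (Suc n')
      have t: "tensO CJ (tpow CJ c (m + n)) c = tpow CJ c (m + Suc n)" by (simp add: m n)
      have "tensO CJ (tensO CJ (tpow CJ c m) (tpow CJ c n)) c = tpow CJ c (m + Suc n)"
        by (simp add: tpow_C coprod_fields algebra_simps)
      then have "assoc_inv CJ (tpow CJ c m) (tpow CJ c n) c = Ident CJ (tpow CJ c (m + Suc n))"
        using Suc.prems by (simp add: assoc_inv_C tpow_C_in)
      then show ?thesis
        using Suc CJ.tensA_Ident[of "tpow CJ c (m + n)" c] t
        by (simp add: m n tpow_C_in CJ.comp_Ident_left[OF CJ.Ident_in] del: tpow.simps)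
    qed
  qed
qed

lemma middle_swap_C:
  assumes "a \<in> Objs CJ" "b \<in> Objs CJ" "c \<in> Objs CJ" "d \<in> Objs CJ"
  shows "middle_swap CJ a b c d = tensA CJ (Ident CJ a) (tensA CJ (symm CJ b c) (Ident CJ d))"
proof -
  let ?S = "tensA CJ (Ident CJ a) (tensA CJ (symm CJ b c) (Ident CJ d))"
  have "?S \<in> Homs CJ (tensO CJ a (tensO CJ (tensO CJ b c) d)) (tensO CJ a (tensO CJ (tensO CJ c b) d))"
    using assms by (intro tensA_C_in symm_C_in Ident_C_in)
  then have S: "?S \<in> Homs CJ (tensO CJ (tensO CJ (tensO CJ a b) c) d) (tensO CJ (tensO CJ (tensO CJ a c) b) d)"
    by (simp only: tensO_C_assoc(2))
  note [simp] = assms tensO_C_in Ident_C_in CJ.tensA_Ident tensO_C_assoc(2)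
  show ?thesis
    unfolding middle_swap_def coprod_fields(7) tensO_C_assoc(1)
    by (simp add: assoc_inv_C CJ.comp_Ident_left[OF S] CJ.comp_Ident_right[OF S] CJ.comp_Ident_left[OF Ident_C_in])
qed

lemma block_zip_one: "block_zip k l (Suc 0) = Ident WW (k + l)"
proof -
  have "symm WW k 0 = Ident WW k" by (simp add: WW_def id_cospan_def)
  then show ?thesis
    by (simp add: WW_swap_def tensA_WW_Ident WW.comp_Ident_left[OF Ident_WW_in])
qed

lemma tpow_zip_C:
  assumes "c \<in> Objs CJ" "d \<in> Objs CJ"
  shows "tpow_zip CJ c d n = (\<lambda>j. block_zip (c j) (d j) n)"
proof (induction n rule: less_induct)
  case (less n)
  consider "n = 0" | "n = Suc 0" | n' where "n = Suc (Suc n')" by (metis not0_implies_Suc)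
  then show ?case
  proof cases
    case 3
    then have "tpow_zip CJ c d (Suc n') = (\<lambda>j. block_zip (c j) (d j) (Suc n'))"
      by (intro less) simp
    moreover have "middle_swap CJ (tpow CJ c (Suc n')) c (tpow CJ d (Suc n')) d = (\<lambda>j.
      tensA WW (Ident WW (Suc n' * c j)) (tensA WW (symm WW (c j) (Suc n' * d j)) (Ident WW (d j))))"
      unfolding middle_swap_C[OF tpow_C_in[OF assms(1)] assms(1) tpow_C_in[OF assms(2)] assms(2)]
      by (simp only: coprod_fields tpow_C)
    ultimately show ?thesis
      unfolding 3 tpow_zip.simps block_zip.simps(2)[of _ _ "Suc n'"] WW_swap_def by (simp only: coprod_fields)
  qed (simp_all add: coprod_fields block_zip_one del: block_zip.simps(2))
qed

lemma tpow_unit_C: "tpow_unit CJ n = Ident CJ (unitO CJ)"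
proof (induction n rule: less_induct)
  case (less n)
  consider "n = 0" | "n = Suc 0" | n' where "n = Suc (Suc n')" by (metis not0_implies_Suc)
  then show ?case
  proof cases
    case 3
    have t: "tpow CJ (unitO CJ) (Suc n') = unitO CJ" by (simp add: tpow_C coprod_fields)
    show ?thesis
      unfolding 3 tpow_unit.simps(3) coprod_fields(9) t
      using less[of "Suc n'"] by (simp add: 3 CJ.comp_Ident_left[OF CJ.Ident_in] unitO_C_in)
  qed simp_all
qed

text \<open>The same cospan is copied at every sort. Finite support survives because at a sort where
  \<open>c\<close> is 0 the component is zero copies, which is the identity of 0.\<close>

lemma coprod_supply_in:
  assumes c: "c \<in> Objs CJ" and X: "X \<in> Homs WW m n"
  shows "coprod_supply c X \<in> Homs CJ (tpow CJ c m) (tpow CJ c n)"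
  unfolding Homs_C
proof (intro conjI allI)
  show "fsupp J (Ident WW 0) (coprod_supply c X)"
    unfolding coprod_supply_def using c WW_supply_zero[OF X] by (auto simp: Objs_C intro!: fsupp_map[where h = "\<lambda>k. WW_supply k X"])
  fix j show "coprod_supply c X j \<in> Homs WW (tpow CJ c m j) (tpow CJ c n j)"
    by (simp add: coprod_supply_def WW_supply_in[OF X] tpow_C)
qed (rule tpow_C_in[OF c])+

lemma coprod_supply_Ident: "coprod_supply c (Ident WW n) = Ident CJ (tpow CJ c n)"
  by (simp add: coprod_supply_def coprod_fields tpow_C WW_supply_Ident)

lemma coprod_supply_symm: "coprod_supply c (symm WW m n) = symm CJ (tpow CJ c m) (tpow CJ c n)"
  by (simp add: coprod_supply_def coprod_fields tpow_C WW_supply_symm)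

lemma coprod_supply_tensA:
  assumes "X \<in> Homs WW m n" "Y \<in> Homs WW p q"
  shows "coprod_supply c (tensA WW X Y) = tensA CJ (coprod_supply c X) (coprod_supply c Y)"
  by (simp add: coprod_supply_def coprod_fields WW_supply_tensA[OF assms])

lemma tpow_C_add: "tensO CJ (tpow CJ c m) (tpow CJ c n) = tpow CJ c (m + n)"
  by (simp add: coprod_fields tpow_C add_mult_distrib)

lemma coprod_supply_functor:
  assumes c: "c \<in> Objs CJ"
  shows "strong_sm_po_functor WW CJ (tpow CJ c) (coprod_supply c) (tpow_add CJ c) (Ident CJ (unitO CJ))"
proof -
  have u: "unitO CJ = tpow CJ c 0" by simp
  show ?thesis
  proof (unfold_locales, goal_cases)
    case (1 a) show ?case by (rule tpow_C_in[OF c])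
  next
    case (2 f a b) then show ?case by (rule coprod_supply_in[OF c])
  next
    case (3 a) show ?case by (rule coprod_supply_Ident)
  next
    case (4 f a b g) then show ?case by (simp add: coprod_supply_def coprod_fields WW_supply_comp)
  next
    case (5 f a b g) then show ?case by (auto simp: coprod_supply_def coprod_fields intro: WW_supply_mono)
  next
    case (6 a b) show ?case
      unfolding tpow_add_C[OF c] tpow_C_add tensO_WW by (intro iso_arr_Ident po_category_C tpow_C_in c)
  next
    case 7 show ?case
      unfolding unitO_WW u[symmetric] by (intro iso_arr_Ident po_category_C unitO_C_in)
  next
    case (8 f a a' g b b')
    have "tensA CJ (coprod_supply c f) (coprod_supply c g) \<in> Homs CJ (tpow CJ c (a + b)) (tpow CJ c (a' + b'))"
      using tensA_C_in[OF coprod_supply_in[OF c 8(1)] coprod_supply_in[OF c 8(2)]] by (simp only: tpow_C_add)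
    then show ?case
      unfolding tpow_add_C[OF c] coprod_supply_tensA[OF 8]
      by (simp add: CJ.comp_Ident_left CJ.comp_Ident_right)
  next
    case (9 x y z) show ?case
      unfolding tpow_add_C[OF c] assoc_WW coprod_supply_Ident coprod_fields(7) tensO_C_assoc tensO_WW
      by (simp add: CJ.tensA_Ident tpow_C_in c tpow_C_add CJ.comp_Ident_left[OF CJ.Ident_in] add.assoc)
  next
    case (10 a)
    show ?case unfolding tpow_add_C[OF c] lunit_WW coprod_supply_Ident coprod_fields(8) unitO_WW
      using CJ.tensA_Ident[OF unitO_C_in tpow_C_in[OF c, of a]]
      by (simp add: tensO_C_unit CJ.comp_Ident_left[OF CJ.Ident_in] tpow_C_in c del: tpow.simps)
  next
    case (11 a)
    show ?case unfolding tpow_add_C[OF c] runit_WW coprod_supply_Ident coprod_fields(9) unitO_WW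
      using CJ.tensA_Ident[OF tpow_C_in[OF c, of a] unitO_C_in]
      by (simp add: tensO_C_unit CJ.comp_Ident_left[OF CJ.Ident_in] tpow_C_in c del: tpow.simps)
  next
    case (12 a b)
    have "symm CJ (tpow CJ c a) (tpow CJ c b) \<in> Homs CJ (tpow CJ c (a + b)) (tpow CJ c (b + a))"
      using symm_C_in[OF tpow_C_in[OF c, of a] tpow_C_in[OF c, of b]] by (simp only: tpow_C_add)
    then show ?case
      unfolding tpow_add_C[OF c] coprod_supply_symm by (simp add: CJ.comp_Ident_left CJ.comp_Ident_right)
  qed
qed

lemma supplies_WW_C: "supplies_WW CJ coprod_supply"
proof (intro supplies_WW.intro sm_po_category_C supplies_WW_axioms.intro, goal_cases)
  case (1 c) then show ?case by (rule coprod_supply_functor)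
next
  case (2 c d X m n)
  then show ?case
    by (simp add: tpow_zip_C coprod_fields coprod_supply_def WW_supply_zip)
next
  case (3 X m n)
  have "coprod_supply (unitO CJ) X = Ident CJ (unitO CJ)"
    by (simp add: coprod_supply_def coprod_fields WW_supply_zero[OF 3])
  then show ?case by (simp add: tpow_unit_C CJ.comp_Ident_left[OF CJ.Ident_in] unitO_C_in)
qed

end

section \<open>Derived rules of regular logic\<close>

text \<open>A substitution between contexts in a signature without function symbols. Values beyond
  the length of \<open>\<Gamma>\<close> are left free, so renamings with the same effect are
  recognised through \<open>rename_cong\<close> rather than as equal functions.\<close>

definition renaming :: "'s list \<Rightarrow> 's list \<Rightarrow> (nat \<Rightarrow> nat) \<Rightarrow> bool" where
  "renaming \<Gamma> \<Delta> f \<longleftrightarrow> (\<forall>i<length \<Gamma>. f i < length \<Delta> \<and> \<Delta> ! f i = \<Gamma> ! i)"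

lemma renaming_comp: "renaming \<Gamma> \<Delta> f \<Longrightarrow> renaming \<Delta> \<Lambda> g \<Longrightarrow> renaming \<Gamma> \<Lambda> (g \<circ> f)"
  by (simp add: renaming_def)

lemma renaming_id: "renaming \<Gamma> \<Gamma> id"
  by (simp add: renaming_def)

lemma renaming_lift: "renaming \<Gamma> \<Delta> f \<Longrightarrow> renaming (s # \<Gamma>) (s # \<Delta>) (case_nat 0 (\<lambda>i. Suc (f i)))"
  by (auto simp: renaming_def split: nat.splits)

lemma formula_in_sorts: "formula_in T \<Gamma> \<phi> \<Longrightarrow> set \<Gamma> \<subseteq> sorts T"
proof (induction \<phi> arbitrary: \<Gamma>)
  case (Ex s \<phi>)
  then have "set (s # \<Gamma>) \<subseteq> sorts T" by (intro Ex.IH) simp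
  then show ?case by simp
qed auto

lemma rename_rename: "rename f (rename g \<phi>) = rename (f \<circ> g) \<phi>"
proof (induction \<phi> arbitrary: f g)
  case (Ex s \<phi>)
  have "case_nat 0 (\<lambda>i. Suc (f i)) \<circ> case_nat 0 (\<lambda>i. Suc (g i)) = case_nat 0 (\<lambda>i. Suc ((f \<circ> g) i))"
    by (auto split: nat.splits)
  then show ?case by (simp add: Ex)
qed auto

lemma rename_cong:
  "formula_in T \<Gamma> \<phi> \<Longrightarrow> (\<And>i. i < length \<Gamma> \<Longrightarrow> f i = g i) \<Longrightarrow> rename f \<phi> = rename g \<phi>"
proof (induction \<phi> arbitrary: f g \<Gamma>)
  case (Ex s \<phi>)
  have "rename (case_nat 0 (\<lambda>i. Suc (f i))) \<phi> = rename (case_nat 0 (\<lambda>i. Suc (g i))) \<phi>"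
  proof (rule Ex.IH)
    show "formula_in T (s # \<Gamma>) \<phi>" using Ex.prems by simp
    show "case_nat 0 (\<lambda>i. Suc (f i)) i = case_nat 0 (\<lambda>i. Suc (g i)) i" if "i < length (s # \<Gamma>)" for i
      using that Ex.prems by (cases i) simp_all
  qed
  then show ?case by simp
next
  case (Conj \<phi> \<psi>)
  have "rename f \<phi> = rename g \<phi>" "rename f \<psi> = rename g \<psi>"
    using Conj.prems by (auto intro!: Conj.IH[of \<Gamma>])
  then show ?case by simp
qed simp_all

lemma rename_id [simp]: "rename id \<phi> = \<phi>"
proof (induction \<phi>)
  case (Ex s \<phi>)
  have "case_nat 0 (\<lambda>i. Suc (id i)) = id" by (auto split: nat.splits)
  then show ?case using Ex by (simp only: rename.simps)
qed auto

lemma formula_in_rename: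
  "formula_in T \<Gamma> \<phi> \<Longrightarrow> renaming \<Gamma> \<Delta> f \<Longrightarrow> set \<Delta> \<subseteq> sorts T \<Longrightarrow> formula_in T \<Delta> (rename f \<phi>)"
proof (induction \<phi> arbitrary: f \<Gamma> \<Delta>)
  case (Ex s \<phi>)
  then have \<phi>: "formula_in T (s # \<Gamma>) \<phi>" by simp
  have "formula_in T (s # \<Delta>) (rename (case_nat 0 (\<lambda>i. Suc (f i))) \<phi>)"
    using formula_in_sorts[OF \<phi>] Ex.prems by (intro Ex.IH[OF \<phi>] renaming_lift) simp_all
  then show ?case by simp
next
  case (Conj \<phi> \<psi>)
  then show ?case by (simp add: Conj.IH[of \<Gamma>])
next
  case (Rel R xs)
  then have "map ((!) \<Delta> \<circ> f) xs = map ((!) \<Gamma>) xs" by (intro map_cong) (simp_all add: renaming_def)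
  with Rel show ?case by (simp add: renaming_def)
qed (simp_all add: renaming_def)

text \<open>The head of the list is bound innermost, since it is variable 0 of
  \<open>\<Theta> @ \<Delta>\<close>. Hence the bound variables are the indices below
  \<open>length \<Theta>\<close>, and weakening by \<open>\<Theta>\<close> adds
  \<open>length \<Theta>\<close>.\<close>

primrec exs :: "'s list \<Rightarrow> ('s, 'r) formula \<Rightarrow> ('s, 'r) formula" where
  "exs [] \<phi> = \<phi>"
| "exs (s # \<Theta>) \<phi> = exs \<Theta> (Ex s \<phi>)"

definition eqs :: "(nat \<times> nat) list \<Rightarrow> ('s, 'r) formula" where
  "eqs L = foldr (\<lambda>(i, j) \<phi>. Conj (Equal i j) \<phi>) L Top"

lemma eqs_simps [simp]: "eqs [] = Top" "eqs (p # L) = Conj (Equal (fst p) (snd p)) (eqs L)"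
  by (auto simp: eqs_def split: prod.splits)

lemma rename_eqs: "rename f (eqs L) = eqs (map (map_prod f f) L)"
  by (induction L) auto

lemma formula_in_eqs:
  "formula_in T \<Gamma> (eqs L) \<longleftrightarrow> set \<Gamma> \<subseteq> sorts T \<and> (\<forall>p\<in>set L. formula_in T \<Gamma> (Equal (fst p) (snd p)))"
  by (induction L) auto

lemma formula_in_exs: "formula_in T \<Delta> (exs \<Theta> \<phi>) \<longleftrightarrow> formula_in T (\<Theta> @ \<Delta>) \<phi>"
  by (induction \<Theta> arbitrary: \<phi>) auto

lemma rename_exs:
  "rename g (exs \<Theta> \<phi>) = exs \<Theta> (rename (\<lambda>i. if i < length \<Theta> then i else length \<Theta> + g (i - length \<Theta>)) \<phi>)"
proof (induction \<Theta> arbitrary: \<phi>)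
  case Nil show ?case by simp
next
  case (Cons s \<Theta>)
  have "case_nat 0 (\<lambda>i. Suc (if i < length \<Theta> then i else length \<Theta> + g (i - length \<Theta>))) =
    (\<lambda>i. if i < length (s # \<Theta>) then i else length (s # \<Theta>) + g (i - length (s # \<Theta>)))"
    by (auto split: nat.splits)
  then show ?case by (simp add: Cons)
qed

context regular_theory
begin

abbreviation entails ("(_ \<turnstile>[_] _)" [56, 0, 56] 55) where
  "\<phi> \<turnstile>[\<Gamma>] \<psi> \<equiv> provable T \<Gamma> \<phi> \<psi>"

abbreviation wff :: "'s list \<Rightarrow> ('s, 'r) formula \<Rightarrow> bool" where
  "wff \<equiv> formula_in T"

lemma renaming_Suc: "renaming \<Gamma> (s # \<Gamma>) Suc"
  by (simp add: renaming_def)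

lemma entails_wff: "\<phi> \<turnstile>[\<Gamma>] \<psi> \<Longrightarrow> wff \<Gamma> \<phi> \<and> wff \<Gamma> \<psi>"
proof (induction rule: provable.induct)
  case (Substitution \<Gamma> \<phi> \<psi> \<Delta> f)
  then show ?case by (auto simp: renaming_def intro!: formula_in_rename[of T \<Gamma>])
next
  case (Equal_subst \<Gamma> i j \<phi>)
  then have "renaming \<Gamma> \<Gamma> (id(i := j))" "set \<Gamma> \<subseteq> sorts T" by (auto simp: renaming_def)
  then show ?case using Equal_subst by (auto intro!: formula_in_rename[of T \<Gamma>])
next
  case (Ex_right \<Gamma> s \<phi> \<psi>)
  then show ?case using formula_in_sorts[of T "s # \<Gamma>" \<phi>]
    by (auto intro!: formula_in_rename[of T \<Gamma>] renaming_Suc)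
next
  case (Frobenius \<Gamma> \<phi> s \<psi>)
  then show ?case using formula_in_sorts[of T "s # \<Gamma>" \<psi>]
    by (auto intro!: formula_in_rename[of T \<Gamma>] renaming_Suc)
qed (auto dest: axioms_wf formula_in_sorts)

lemma entails_rename:
  "\<phi> \<turnstile>[\<Gamma>] \<psi> \<Longrightarrow> renaming \<Gamma> \<Delta> f \<Longrightarrow> set \<Delta> \<subseteq> sorts T \<Longrightarrow> rename f \<phi> \<turnstile>[\<Delta>] rename f \<psi>"
  by (rule Substitution) (auto simp: renaming_def)

section \<open>Conjunction and equality in derived form\<close>

lemma entails_conj_iff: "\<theta> \<turnstile>[\<Gamma>] Conj \<phi> \<psi> \<longleftrightarrow> \<theta> \<turnstile>[\<Gamma>] \<phi> \<and> \<theta> \<turnstile>[\<Gamma>] \<psi>"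
  by (metis Conj_intro Conj_left Conj_right Cut entails_wff formula_in.simps(2))

lemma conj_entails1: "\<phi> \<turnstile>[\<Gamma>] \<theta> \<Longrightarrow> wff \<Gamma> \<psi> \<Longrightarrow> Conj \<phi> \<psi> \<turnstile>[\<Gamma>] \<theta>"
  by (metis Conj_left Cut entails_wff)

lemma conj_entails2: "\<psi> \<turnstile>[\<Gamma>] \<theta> \<Longrightarrow> wff \<Gamma> \<phi> \<Longrightarrow> Conj \<phi> \<psi> \<turnstile>[\<Gamma>] \<theta>"
  by (metis Conj_right Cut entails_wff)

lemma entails_Equal_refl: "wff \<Gamma> \<theta> \<Longrightarrow> i < length \<Gamma> \<Longrightarrow> \<theta> \<turnstile>[\<Gamma>] Equal i i"
  by (rule Cut[OF Top_intro Equal_refl]) (auto dest: formula_in_sorts)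

lemma entails_eqs_iff:
  "wff \<Gamma> \<theta> \<Longrightarrow> \<theta> \<turnstile>[\<Gamma>] eqs L \<longleftrightarrow> (\<forall>p\<in>set L. \<theta> \<turnstile>[\<Gamma>] Equal (fst p) (snd p))"
  by (induction L) (auto simp: entails_conj_iff Top_intro)

text \<open>\<open>Equal_subst\<close> replaces a variable at all its occurrences. Here the
  occurrences to be replaced are marked by variable 0 of \<open>\<chi>\<close>, so that other
  occurrences of \<open>a\<close> may stay.\<close>

lemma Leibniz:
  assumes eq: "\<theta> \<turnstile>[\<Gamma>] Equal a b" and \<chi>: "wff (s # \<Gamma>) \<chi>" and s: "\<Gamma> ! a = s"
    and "\<theta> \<turnstile>[\<Gamma>] rename (case_nat a id) \<chi>"
  shows "\<theta> \<turnstile>[\<Gamma>] rename (case_nat b id) \<chi>"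
proof -
  have ab: "a < length \<Gamma>" "b < length \<Gamma>" "\<Gamma> ! b = s" "set \<Gamma> \<subseteq> sorts T"
    using eq entails_wff s by fastforce+
  have sorts: "set (s # s # \<Gamma>) \<subseteq> sorts T" using formula_in_sorts[OF \<chi>] by simp
  \<comment> \<open>Two fresh variables are put in front: \<open>?f\<close> reads the marked
    variable of \<open>\<chi>\<close> as the first of them and skips the second, and
    \<open>?g\<close> finally sends them to \<open>a\<close> and \<open>b\<close>.\<close>
  let ?f = "case_nat 0 (\<lambda>i. Suc (Suc i))" and ?g = "case_nat a (case_nat b id)"
  have f: "renaming (s # \<Gamma>) (s # s # \<Gamma>) ?f" by (auto simp: renaming_def split: nat.splits)
  have g: "renaming (s # s # \<Gamma>) \<Gamma> ?g" using ab s by (auto simp: renaming_def split: nat.splits)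
  have "Conj (Equal 0 1) (rename ?f \<chi>) \<turnstile>[s # s # \<Gamma>] rename (id(0 := 1)) (rename ?f \<chi>)"
    using sorts by (intro Equal_subst formula_in_rename[OF \<chi> f]) auto
  from entails_rename[OF this g ab(4)]
  have "Conj (Equal a b) (rename (?g \<circ> ?f) \<chi>) \<turnstile>[\<Gamma>] rename (?g \<circ> (id(0 := 1) \<circ> ?f)) \<chi>"
    by (simp add: rename_rename)
  moreover have "?g \<circ> ?f = case_nat a id" "?g \<circ> (id(0 := 1) \<circ> ?f) = case_nat b id"
    by (auto split: nat.splits)
  ultimately show ?thesis using eq assms(4) Cut entails_conj_iff by metis
qed

lemma Equal_sym:
  assumes "\<theta> \<turnstile>[\<Gamma>] Equal a b" shows "\<theta> \<turnstile>[\<Gamma>] Equal b a"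
proof -
  have ab: "a < length \<Gamma>" "set \<Gamma> \<subseteq> sorts T" "wff \<Gamma> \<theta>"
    using entails_wff[OF assms] by auto
  then have "\<Gamma> ! a \<in> sorts T" by (meson nth_mem subsetD)
  then show ?thesis
    \<comment> \<open>With 0 marking the left side, the instance at \<open>a\<close> is
      \<open>Equal a a\<close> and the instance at \<open>b\<close> is
      \<open>Equal b a\<close>.\<close>
    using Leibniz[OF assms, of "\<Gamma> ! a" "Equal 0 (Suc a)"] ab entails_Equal_refl by simp
qed

lemma Equal_trans:
  assumes "\<theta> \<turnstile>[\<Gamma>] Equal a b" "\<theta> \<turnstile>[\<Gamma>] Equal b c" shows "\<theta> \<turnstile>[\<Gamma>] Equal a c"
proof -
  have ab: "a < length \<Gamma>" "b < length \<Gamma>" "\<Gamma> ! a = \<Gamma> ! b" "set \<Gamma> \<subseteq> sorts T" "wff \<Gamma> \<theta>"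
    using entails_wff[OF assms(1)] by auto
  then have "\<Gamma> ! b \<in> sorts T" by (meson nth_mem subsetD)
  then show ?thesis
    using Leibniz[OF assms(2), of "\<Gamma> ! b" "Equal (Suc a) 0"] ab assms(1) by simp
qed

text \<open>The variables are exchanged one at a time: \<open>?h k\<close> follows \<open>g\<close>
  below \<open>k\<close> and \<open>f\<close> from there on, and \<open>Leibniz\<close> changes the
  value at \<open>k\<close>, with that variable as the marked one.\<close>

lemma entails_rename_cong:
  assumes \<phi>: "wff \<Gamma> \<phi>" and f: "renaming \<Gamma> \<Delta> f" and g: "renaming \<Gamma> \<Delta> g"
    and eq: "\<And>i. i < length \<Gamma> \<Longrightarrow> \<theta> \<turnstile>[\<Delta>] Equal (f i) (g i)" and "\<theta> \<turnstile>[\<Delta>] rename f \<phi>"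
  shows "\<theta> \<turnstile>[\<Delta>] rename g \<phi>"
proof -
  have sorts: "set \<Gamma> \<subseteq> sorts T" "set \<Delta> \<subseteq> sorts T"
    using \<phi> entails_wff[OF assms(5)] by (auto dest: formula_in_sorts)
  let ?h = "\<lambda>k i. if i < k then g i else f i"
  have "\<theta> \<turnstile>[\<Delta>] rename (?h k) \<phi>" if "k \<le> length \<Gamma>" for k
    using that
  proof (induction k)
    case 0 then show ?case using assms(5) by simp
  next
    case (Suc k)
    let ?e = "\<lambda>i. if i = k then 0 else Suc (?h k i)"
    have k: "k < length \<Gamma>" using Suc.prems by simp
    then have s: "\<Delta> ! f k = \<Gamma> ! k" "\<Gamma> ! k \<in> sorts T" using f sorts by (auto simp: renaming_def)
    have e: "renaming \<Gamma> (\<Gamma> ! k # \<Delta>) ?e" using f g by (auto simp: renaming_def)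
    have \<chi>: "wff (\<Gamma> ! k # \<Delta>) (rename ?e \<phi>)"
      using sorts s by (intro formula_in_rename[OF \<phi> e]) auto
    have 1: "case_nat (f k) id \<circ> ?e = ?h k" and 2: "case_nat (g k) id \<circ> ?e = ?h (Suc k)"
      by auto
    show ?case
      using Leibniz[OF eq[OF k] \<chi> s(1)] Suc by (simp add: rename_rename 1 2)
  qed
  from this[of "length \<Gamma>"] show ?thesis
    using rename_cong[OF \<phi>, of "?h (length \<Gamma>)" g] by simp
qed

text \<open>Each quantifier is removed by its adjunction with weakening. The side formula
  \<open>A\<close> must follow under the quantifier, and \<open>Frobenius\<close> is the rule that
  takes it there.\<close>

lemma conj_exs_entails_iff:
  assumes "wff \<Delta> A" "wff (\<Theta> @ \<Delta>) \<phi>" "wff \<Delta> B"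
  shows "Conj A (exs \<Theta> \<phi>) \<turnstile>[\<Delta>] B \<longleftrightarrow>
    Conj (rename ((+) (length \<Theta>)) A) \<phi> \<turnstile>[\<Theta> @ \<Delta>] rename ((+) (length \<Theta>)) B"
  using assms(2)
proof (induction \<Theta> arbitrary: \<phi>)
  case Nil
  have "(+) 0 = (id :: nat \<Rightarrow> nat)" by auto
  then show ?case by (simp only: exs.simps list.size append_Nil rename_id)
next
  case (Cons s \<Theta>)
  let ?\<Gamma> = "\<Theta> @ \<Delta>" and ?w = "rename ((+) (length \<Theta>)) :: ('s, 'r) formula \<Rightarrow> _"
  have sorts: "set (s # ?\<Gamma>) \<subseteq> sorts T" using formula_in_sorts[OF Cons.prems] by simp
  have w: "renaming \<Delta> ?\<Gamma> ((+) (length \<Theta>))" by (simp add: renaming_def)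
  have A: "wff ?\<Gamma> (?w A)" and B: "wff ?\<Gamma> (?w B)"
    using sorts by (auto intro!: formula_in_rename[OF _ w] assms)
  have \<phi>: "wff (s # ?\<Gamma>) \<phi>" using Cons.prems by simp
  have Suc: "Suc \<circ> (+) (length \<Theta>) = (+) (length (s # \<Theta>))" by auto
  have "Conj (?w A) (Ex s \<phi>) \<turnstile>[?\<Gamma>] ?w B \<longleftrightarrow> Conj (rename Suc (?w A)) \<phi> \<turnstile>[s # ?\<Gamma>] rename Suc (?w B)"
  proof
    assume "Conj (?w A) (Ex s \<phi>) \<turnstile>[?\<Gamma>] ?w B"
    from entails_rename[OF this renaming_Suc sorts]
    have 1: "Conj (rename Suc (?w A)) (rename Suc (Ex s \<phi>)) \<turnstile>[s # ?\<Gamma>] rename Suc (?w B)" by simp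
    have A': "wff (s # ?\<Gamma>) (rename Suc (?w A))" by (rule formula_in_rename[OF A renaming_Suc sorts])
    have "\<phi> \<turnstile>[s # ?\<Gamma>] rename Suc (Ex s \<phi>)"
      using \<phi> by (intro Ex_right Identity) simp
    then have "Conj (rename Suc (?w A)) \<phi> \<turnstile>[s # ?\<Gamma>] Conj (rename Suc (?w A)) (rename Suc (Ex s \<phi>))"
      using A' \<phi> by (intro Conj_intro Conj_left conj_entails2)
    then show "Conj (rename Suc (?w A)) \<phi> \<turnstile>[s # ?\<Gamma>] rename Suc (?w B)" using 1 by (rule Cut)
  next
    assume "Conj (rename Suc (?w A)) \<phi> \<turnstile>[s # ?\<Gamma>] rename Suc (?w B)"
    then have "Ex s (Conj (rename Suc (?w A)) \<phi>) \<turnstile>[?\<Gamma>] ?w B" by (rule Ex_left[OF B])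
    then show "Conj (?w A) (Ex s \<phi>) \<turnstile>[?\<Gamma>] ?w B" by (rule Cut[OF Frobenius[OF A \<phi>]])
  qed
  then show ?case using Cons.IH[of "Ex s \<phi>"] \<phi> by (simp only: exs.simps formula_in.simps rename_rename Suc append_Cons)
qed

text \<open>The existential quantifier along a renaming \<open>f\<close> from \<open>\<Gamma>\<close> to \<open>\<Theta>\<close>.\<close>

definition image_formula :: "'s list \<Rightarrow> 's list \<Rightarrow> (nat \<Rightarrow> nat) \<Rightarrow> ('s, 'r) formula \<Rightarrow> ('s, 'r) formula" where
  "image_formula \<Gamma> \<Theta> f \<chi> = exs \<Theta> (Conj \<chi> (eqs (map (\<lambda>i. (f i, length \<Theta> + i)) [0..<length \<Gamma>])))"

lemma wff_append: "wff \<Theta> \<chi> \<Longrightarrow> set \<Gamma> \<subseteq> sorts T \<Longrightarrow> wff (\<Theta> @ \<Gamma>) \<chi>"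
  using formula_in_rename[of T \<Theta> \<chi> "\<Theta> @ \<Gamma>" id] formula_in_sorts[of T \<Theta> \<chi>]
  by (simp add: renaming_def nth_append)

lemma wff_image_formula:
  assumes "renaming \<Gamma> \<Theta> f" "wff \<Theta> \<chi>" "set \<Gamma> \<subseteq> sorts T"
  shows "wff \<Gamma> (image_formula \<Gamma> \<Theta> f \<chi>)"
  using assms wff_append[OF assms(2,3)] formula_in_sorts[OF assms(2)]
  by (auto simp: image_formula_def formula_in_exs formula_in_eqs renaming_def nth_append)

text \<open>Adjunction, Frobenius reciprocity and the Beck-Chevalley condition for \<open>image_formula\<close> at once:
  \<open>\<Lambda>\<close> ranges over the cocones under the span \<open>f\<close>, \<open>g\<close>. It suffices to test \<open>\<Lambda> = \<Theta> @ \<Delta>\<close> with both legs composed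
  with a choice of representatives for the equivalence generated by \<open>f i \<sim> g i\<close>.\<close>

lemma conj_image_formula_entails_iff:
  assumes f: "renaming \<Gamma> \<Theta> f" and \<chi>: "wff \<Theta> \<chi>" and g: "renaming \<Gamma> \<Delta> g" and A: "wff \<Delta> A" and B: "wff \<Delta> B"
  shows "Conj A (rename g (image_formula \<Gamma> \<Theta> f \<chi>)) \<turnstile>[\<Delta>] B \<longleftrightarrow>
    (\<forall>\<Lambda> u v. set \<Lambda> \<subseteq> sorts T \<and> renaming \<Theta> \<Lambda> u \<and> renaming \<Delta> \<Lambda> v \<and> (\<forall>i<length \<Gamma>. u (f i) = v (g i)) \<longrightarrow>
      Conj (rename v A) (rename u \<chi>) \<turnstile>[\<Lambda>] rename v B)" (is "?lhs \<longleftrightarrow> ?rhs")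
proof -
  define n L where "n = length \<Theta>" and "L = \<Theta> @ \<Delta>"
  \<comment> \<open>In \<open>\<Theta> @ \<Delta>\<close> the variable \<open>g i\<close> of
    \<open>\<Delta>\<close> has index \<open>n + g i\<close>; \<open>E\<close> holds the equations
    that the renamed image formula puts between the two halves.\<close>
  define E where "E = map (\<lambda>i. (f i, n + g i)) [0..<length \<Gamma>]"
  let ?up = "rename ((+) n) :: ('s, 'r) formula \<Rightarrow> _"
  have sorts: "set L \<subseteq> sorts T" using A \<chi> by (auto simp: L_def dest: formula_in_sorts)
  have up: "renaming \<Delta> L ((+) n)" by (simp add: renaming_def L_def n_def)
  have inj: "renaming \<Theta> L id" by (simp add: renaming_def L_def nth_append)
  have upA: "wff L (?up A)" and upB: "wff L (?up B)" and \<chi>L: "wff L \<chi>"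
    using formula_in_rename[OF A up sorts] formula_in_rename[OF B up sorts] formula_in_rename[OF \<chi> inj sorts]
    by simp_all
  have EL: "fst p < length L \<and> snd p < length L \<and> L ! fst p = L ! snd p" if "p \<in> set E" for p
    using that f g by (auto simp: E_def L_def n_def renaming_def nth_append)
  then have eqsL: "wff L (eqs E)" using sorts by (auto simp: formula_in_eqs)
  let ?\<theta> = "Conj (?up A) (Conj \<chi> (eqs E))"
  have \<theta>: "wff L ?\<theta>" using upA \<chi>L eqsL by simp
  \<comment> \<open>Under the binders of \<open>\<Theta>\<close> the renaming fixes the bound
    variables, so it leaves \<open>\<chi>\<close> alone and turns \<open>n + i\<close> into
    \<open>n + g i\<close>.\<close>
  have rg: "rename g (image_formula \<Gamma> \<Theta> f \<chi>) = exs \<Theta> (Conj \<chi> (eqs E))"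
  proof -
    let ?g = "\<lambda>i. if i < n then i else n + g (i - n)"
    have "rename ?g \<chi> = \<chi>" using rename_cong[OF \<chi>, of ?g id] by (simp add: n_def)
    moreover have "rename ?g (eqs (map (\<lambda>i. (f i, n + i)) [0..<length \<Gamma>])) = (eqs E :: ('s, 'r) formula)"
      unfolding rename_eqs E_def using f by (intro arg_cong[of _ _ eqs]) (auto simp: renaming_def n_def)
    ultimately show ?thesis unfolding image_formula_def rename_exs n_def[symmetric] rename.simps by simp
  qed
  have lhs: "?lhs \<longleftrightarrow> ?\<theta> \<turnstile>[L] ?up B"
    unfolding rg n_def L_def by (rule conj_exs_entails_iff) (use A B \<chi>L eqsL L_def in auto)
  show ?thesis unfolding lhs
  proof
    assume l: "?\<theta> \<turnstile>[L] ?up B"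
    show ?rhs
    proof (intro allI impI, elim conjE)
      fix \<Lambda> u v assume \<Lambda>: "set \<Lambda> \<subseteq> sorts T" and u: "renaming \<Theta> \<Lambda> u" and v: "renaming \<Delta> \<Lambda> v"
        and uv: "\<forall>i<length \<Gamma>. u (f i) = v (g i)"
      \<comment> \<open>\<open>?w\<close> is the copairing of \<open>u\<close> and \<open>v\<close>;
        as the cocone commutes, it turns the equations of \<open>E\<close> into
        reflexivities.\<close>
      let ?w = "\<lambda>i. if i < n then u i else v (i - n)"
      have w: "renaming L \<Lambda> ?w" using u v by (auto simp: renaming_def L_def n_def nth_append)
      have "?w \<circ> (+) n = v" by auto
      then have 1: "rename ?w (?up A) = rename v A" "rename ?w (?up B) = rename v B" by (simp_all add: rename_rename)
      have 2: "rename ?w \<chi> = rename u \<chi>" by (rule rename_cong[OF \<chi>]) (simp add: n_def)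
      have 3: "rename ?w (eqs E :: ('s, 'r) formula) = eqs (map (\<lambda>i. (v (g i), v (g i))) [0..<length \<Gamma>])"
        unfolding rename_eqs E_def using f uv by (intro arg_cong[of _ _ eqs]) (auto simp: renaming_def n_def)
      have C: "Conj (rename v A) (Conj (rename u \<chi>) (eqs (map (\<lambda>i. (v (g i), v (g i))) [0..<length \<Gamma>]))) \<turnstile>[\<Lambda>] rename v B"
        using entails_rename[OF l w \<Lambda>] by (simp add: 1 2 3)
      have AX: "wff \<Lambda> (rename v A)" "wff \<Lambda> (rename u \<chi>)"
        by (rule formula_in_rename[OF A v \<Lambda>], rule formula_in_rename[OF \<chi> u \<Lambda>])
      then have AX': "wff \<Lambda> (Conj (rename v A) (rename u \<chi>))" by simp
      have "Conj (rename v A) (rename u \<chi>) \<turnstile>[\<Lambda>]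
        Conj (rename v A) (Conj (rename u \<chi>) (eqs (map (\<lambda>i. (v (g i), v (g i))) [0..<length \<Gamma>])))"
        using AX AX' g v
        by (auto simp: entails_conj_iff entails_eqs_iff renaming_def intro!: Conj_left Conj_right entails_Equal_refl)
      then show "Conj (rename v A) (rename u \<chi>) \<turnstile>[\<Lambda>] rename v B" using C by (rule Cut)
    qed
  next
    assume rhs: ?rhs
    obtain r where r1: "\<forall>(a, b)\<in>set E. r a = r b"
      and r2: "\<And>x P. equivp P \<Longrightarrow> \<forall>(a, b)\<in>set E. P a b \<Longrightarrow> P x (r x)"
      using representatives[of E] by blast
    have r: "renaming L L r"
    proof -
      \<comment> \<open>Both indices valid and of the same sort, or both out of range: this is an
        equivalence containing \<open>E\<close>, so \<open>r\<close> preserves sorts and stays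
        inside the context.\<close>
      let ?P = "\<lambda>x y. (x < length L \<longleftrightarrow> y < length L) \<and> (x < length L \<longrightarrow> L ! x = L ! y)"
      have "equivp ?P" by (auto intro!: equivpI reflpI sympI transpI)
      moreover have "\<forall>(a, b)\<in>set E. ?P a b" using EL by fastforce
      ultimately have *: "?P x (r x)" for x using r2[of ?P] by blast
      show ?thesis unfolding renaming_def
      proof (intro allI impI)
        fix i assume "i < length L"
        then show "r i < length L \<and> L ! r i = L ! i" using *[of i] by simp
      qed
    qed
    have eq: "?\<theta> \<turnstile>[L] Equal x (r x)" if "x < length L" for x
    proof -
      \<comment> \<open>Provable equality is reflexive only on indices of the context, so identity
        of indices is added to obtain an equivalence on all naturals.\<close>
      let ?P = "\<lambda>x y. x = y \<or> ?\<theta> \<turnstile>[L] Equal x y"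
      have "equivp ?P" by (rule equivpI) (auto intro!: reflpI sympI transpI intro: Equal_sym Equal_trans)
      moreover have "?\<theta> \<turnstile>[L] eqs E"
        using upA \<chi>L eqsL by (intro conj_entails2 Identity)
      then have "\<forall>(a, b)\<in>set E. ?P a b" unfolding entails_eqs_iff[OF \<theta>] by auto
      ultimately have "?P x (r x)" using r2[of ?P] by blast
      then show ?thesis using entails_Equal_refl[OF \<theta> that] by auto
    qed
    have "\<forall>i<length \<Gamma>. r (f i) = (r \<circ> (+) n) (g i)" using r1 by (auto simp: E_def)
    then have "Conj (rename (r \<circ> (+) n) A) (rename (r \<circ> id) \<chi>) \<turnstile>[L] rename (r \<circ> (+) n) B"
      using rhs sorts renaming_comp[OF inj r] renaming_comp[OF up r] by auto
    then have R: "Conj (rename r (?up A)) (rename r \<chi>) \<turnstile>[L] rename r (?up B)"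
      by (simp add: rename_rename)
    \<comment> \<open>Under \<open>?\<theta>\<close> every variable equals its representative, so
      formulae may be renamed along \<open>r\<close> and back. The hypothesis at the collapsed
      cocone thereby yields the entailment for the original variables.\<close>
    have to_r: "?\<theta> \<turnstile>[L] rename r \<phi>" if "wff L \<phi>" "?\<theta> \<turnstile>[L] \<phi>" for \<phi>
      by (rule entails_rename_cong[OF that(1) renaming_id r]) (use eq that in auto)
    have of_r: "?\<theta> \<turnstile>[L] \<phi>" if "wff L \<phi>" "?\<theta> \<turnstile>[L] rename r \<phi>" for \<phi>
      using entails_rename_cong[OF that(1) r renaming_id] eq that Equal_sym by fastforce
    have "?\<theta> \<turnstile>[L] ?up A" "?\<theta> \<turnstile>[L] \<chi>"
      using upA \<chi>L eqsL by (simp_all add: Conj_left conj_entails2[OF Conj_left])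
    then have "?\<theta> \<turnstile>[L] Conj (rename r (?up A)) (rename r \<chi>)"
      using upA \<chi>L by (intro Conj_intro to_r)
    then show "?\<theta> \<turnstile>[L] ?up B" using R upB by (blast intro: Cut of_r)
  qed
qed

end

section \<open>Valuations of objects in contexts\<close>

text \<open>Together with \<open>idx\<close> this identifies an index of \<open>\<Gamma>\<close>
  with its sort and its rank among the indices of that sort, which is how a listed context is
  compared with a family of numbers.\<close>

definition pos :: "'s list \<Rightarrow> 's \<Rightarrow> nat list" where
  "pos \<Gamma> \<sigma> = filter (\<lambda>i. \<Gamma> ! i = \<sigma>) [0..<length \<Gamma>]"

definition idx :: "'s list \<Rightarrow> nat \<Rightarrow> nat" where
  "idx \<Gamma> i = count_list (take i \<Gamma>) (\<Gamma> ! i)"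

abbreviation Pos :: "'s list \<Rightarrow> 's \<Rightarrow> nat set" where
  "Pos \<Gamma> \<sigma> \<equiv> set (pos \<Gamma> \<sigma>)"

lemma Pos_iff: "i \<in> Pos \<Gamma> \<sigma> \<longleftrightarrow> i < length \<Gamma> \<and> \<Gamma> ! i = \<sigma>"
  by (auto simp: pos_def)

lemma pos_snoc: "pos (\<Gamma> @ [\<tau>]) \<sigma> = pos \<Gamma> \<sigma> @ (if \<tau> = \<sigma> then [length \<Gamma>] else [])"
proof -
  have "filter (\<lambda>i. (\<Gamma> @ [\<tau>]) ! i = \<sigma>) [0..<length \<Gamma>] = filter (\<lambda>i. \<Gamma> ! i = \<sigma>) [0..<length \<Gamma>]"
    by (rule filter_cong) (auto simp: nth_append)
  then show ?thesis by (simp add: pos_def)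
qed

lemma length_pos: "length (pos \<Gamma> \<sigma>) = count_list \<Gamma> \<sigma>"
  by (induction \<Gamma> rule: rev_induct) (simp_all add: pos_snoc, simp add: pos_def)

lemma pos_append: "\<exists>ps. pos (\<Gamma> @ \<Delta>) \<sigma> = pos \<Gamma> \<sigma> @ ps"
proof (induction \<Delta> rule: rev_induct)
  case (snoc \<tau> \<Delta>)
  then show ?case using pos_snoc[of "\<Gamma> @ \<Delta>" \<tau> \<sigma>] by auto
qed simp

lemma idx_less: "i < length \<Gamma> \<Longrightarrow> idx \<Gamma> i < count_list \<Gamma> (\<Gamma> ! i)"
  and pos_idx: "i < length \<Gamma> \<Longrightarrow> pos \<Gamma> (\<Gamma> ! i) ! idx \<Gamma> i = i"
proof -
  assume i: "i < length \<Gamma>"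
  let ?\<sigma> = "\<Gamma> ! i"
  obtain ps where ps: "pos \<Gamma> ?\<sigma> = pos (take (Suc i) \<Gamma>) ?\<sigma> @ ps"
    using pos_append[of "take (Suc i) \<Gamma>" "drop (Suc i) \<Gamma>" ?\<sigma>] by (auto simp only: append_take_drop_id)
  have eq: "pos \<Gamma> ?\<sigma> = pos (take i \<Gamma>) ?\<sigma> @ i # ps"
    unfolding ps using i by (simp add: take_Suc_conv_app_nth pos_snoc)
  have "length (pos \<Gamma> ?\<sigma>) = idx \<Gamma> i + Suc (length ps)"
    unfolding eq by (simp add: length_pos idx_def)
  then show "idx \<Gamma> i < count_list \<Gamma> (\<Gamma> ! i)" by (simp add: length_pos)
  show "pos \<Gamma> (\<Gamma> ! i) ! idx \<Gamma> i = i"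
    unfolding eq by (simp add: nth_append length_pos idx_def)
qed

lemma idx_pos:
  assumes "k < count_list \<Gamma> \<sigma>"
  shows "pos \<Gamma> \<sigma> ! k < length \<Gamma>" "\<Gamma> ! (pos \<Gamma> \<sigma> ! k) = \<sigma>" "idx \<Gamma> (pos \<Gamma> \<sigma> ! k) = k"
proof -
  let ?i = "pos \<Gamma> \<sigma> ! k"
  have "?i \<in> Pos \<Gamma> \<sigma>" using assms by (simp add: length_pos)
  then show i: "?i < length \<Gamma>" "\<Gamma> ! ?i = \<sigma>" by (simp_all add: Pos_iff)
  have "distinct (pos \<Gamma> \<sigma>)" by (simp add: pos_def)
  then show "idx \<Gamma> ?i = k"
    using idx_less[OF i(1)] pos_idx[OF i(1)] assms by (simp add: i(2) nth_eq_iff_index_eq length_pos)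
qed

section \<open>Listing the variables of an object\<close>

lemma count_list_replicate: "count_list (replicate k \<tau>) \<sigma> = (if \<tau> = \<sigma> then k else 0)"
  by (induction k) auto

lemma context_exists:
  assumes "finite A" "\<And>\<sigma>. \<sigma> \<notin> A \<Longrightarrow> n \<sigma> = 0" shows "\<exists>\<Gamma>. \<forall>\<sigma>. count_list \<Gamma> \<sigma> = n \<sigma>"
  using assms
proof (induction A arbitrary: n rule: finite_induct)
  case empty
  then show ?case by (intro exI[of _ "[]"]) simp
next
  case (insert \<tau> A)
  have "(n(\<tau> := 0)) \<sigma> = 0" if "\<sigma> \<notin> A" for \<sigma> using insert.prems that by simp
  from insert.IH[of "n(\<tau> := 0)", OF this] obtain \<Gamma> where "\<forall>\<sigma>. count_list \<Gamma> \<sigma> = (n(\<tau> := 0)) \<sigma>" by blast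
  then show ?case by (intro exI[of _ "replicate (n \<tau>) \<tau> @ \<Gamma>"]) (simp add: count_list_replicate)
qed

lemma count_context_of:
  assumes "n \<in> Objs (coprod_WW J)" shows "count_list (context_of n) \<sigma> = n \<sigma>"
proof -
  have "\<exists>\<Gamma>. \<forall>\<sigma>. count_list \<Gamma> \<sigma> = n \<sigma>"
    using assms by (intro context_exists[of "{j. n j \<noteq> 0}"]) (auto simp: Objs_C fsupp_def)
  then show ?thesis unfolding context_of_def by (rule someI2_ex) simp
qed

lemma set_context_of:
  assumes "n \<in> Objs (coprod_WW J)" shows "set (context_of n) \<subseteq> J"
proof
  fix \<sigma> assume "\<sigma> \<in> set (context_of n)"
  then have "n \<sigma> \<noteq> 0" using count_context_of[OF assms] by (metis count_list_0_iff)
  then show "\<sigma> \<in> J" using assms by (auto simp: Objs_C fsupp_def)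
qed

text \<open>A tuple of variables of \<open>\<Lambda>\<close> for the object \<open>n\<close>, kept
  sort by sort since that is how morphisms of the coproduct act. \<open>ren_of\<close> turns it into
  a renaming of the listed context and \<open>generic\<close> is the tuple of that context itself,
  so the arbitrary listing stays hidden behind these two.\<close>

definition valuation :: "('s \<Rightarrow> nat) \<Rightarrow> 's list \<Rightarrow> ('s \<Rightarrow> nat list) \<Rightarrow> bool" where
  "valuation n \<Lambda> a \<longleftrightarrow> (\<forall>\<sigma>. length (a \<sigma>) = n \<sigma> \<and> set (a \<sigma>) \<subseteq> Pos \<Lambda> \<sigma>)"

definition ren_of :: "('s \<Rightarrow> nat) \<Rightarrow> ('s \<Rightarrow> nat list) \<Rightarrow> nat \<Rightarrow> nat" where
  "ren_of n a i = a (context_of n ! i) ! idx (context_of n) i"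

abbreviation generic :: "('s \<Rightarrow> nat) \<Rightarrow> 's \<Rightarrow> nat list" where
  "generic n \<equiv> pos (context_of n)"

definition inst :: "('s \<Rightarrow> nat) \<Rightarrow> ('s \<Rightarrow> nat list) \<Rightarrow> ('s, 'r) formula \<Rightarrow> ('s, 'r) formula" where
  "inst n a \<phi> = rename (ren_of n a) \<phi>"

lemma inst_simps [simp]: "inst n a (Conj \<phi> \<psi>) = Conj (inst n a \<phi>) (inst n a \<psi>)" "inst n a Top = Top"
  by (simp_all add: inst_def)

context
  fixes J :: "'s set" and n :: "'s \<Rightarrow> nat"
  assumes n: "n \<in> Objs (coprod_WW J)"
begin

lemma valuation_generic: "valuation n (context_of n) (generic n)"
  by (simp add: valuation_def length_pos count_context_of[OF n])

lemma renaming_ren_of: "valuation n \<Lambda> a \<Longrightarrow> renaming (context_of n) \<Lambda> (ren_of n a)"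
  unfolding renaming_def
proof (intro allI impI)
  fix i assume a: "valuation n \<Lambda> a" and i: "i < length (context_of n)"
  let ?\<sigma> = "context_of n ! i"
  have "idx (context_of n) i < length (a ?\<sigma>)" "set (a ?\<sigma>) \<subseteq> Pos \<Lambda> ?\<sigma>"
    using idx_less[OF i] a by (simp_all add: count_context_of[OF n] valuation_def)
  then have "ren_of n a i \<in> Pos \<Lambda> ?\<sigma>" by (auto simp: ren_of_def)
  then show "ren_of n a i < length \<Lambda> \<and> \<Lambda> ! ren_of n a i = ?\<sigma>" by (simp add: Pos_iff)
qed

lemma ren_of_map_generic: "i < length (context_of n) \<Longrightarrow> ren_of n (\<lambda>\<sigma>. map u (generic n \<sigma>)) i = u i"
  using idx_less[of i "context_of n"] pos_idx[of i "context_of n"] by (simp add: ren_of_def length_pos)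

lemma map_ren_of_generic:
  assumes "length (a \<sigma>) = n \<sigma>" shows "map (ren_of n a) (generic n \<sigma>) = a \<sigma>"
proof (rule nth_equalityI)
  fix k assume "k < length (map (ren_of n a) (generic n \<sigma>))"
  then have "k < count_list (context_of n) \<sigma>" by (simp add: length_pos)
  from idx_pos[OF this] this show "map (ren_of n a) (generic n \<sigma>) ! k = a \<sigma> ! k"
    by (simp add: ren_of_def length_pos)
qed (simp add: assms length_pos count_context_of[OF n])

lemma ren_of_comp:
  "(\<And>\<sigma>. length (a \<sigma>) = n \<sigma>) \<Longrightarrow> i < length (context_of n) \<Longrightarrow>
    v (ren_of n a i) = ren_of n (\<lambda>\<sigma>. map v (a \<sigma>)) i"
  using idx_less[of i "context_of n"] by (simp add: ren_of_def count_context_of[OF n])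

lemma valuation_map: "valuation n \<Lambda> a \<Longrightarrow> renaming \<Lambda> \<Lambda>' v \<Longrightarrow> valuation n \<Lambda>' (\<lambda>\<sigma>. map v (a \<sigma>))"
  by (fastforce simp: valuation_def renaming_def Pos_iff subset_iff)

lemma rename_inst:
  assumes "formula_in T (context_of n) \<phi>" "\<And>\<sigma>. length (a \<sigma>) = n \<sigma>"
  shows "rename v (inst n a \<phi>) = inst n (\<lambda>\<sigma>. map v (a \<sigma>)) \<phi>"
  unfolding inst_def rename_rename using ren_of_comp[OF assms(2)] by (intro rename_cong[OF assms(1)]) simp

lemma inst_map_generic:
  assumes "formula_in T (context_of n) \<phi>"
  shows "inst n (\<lambda>\<sigma>. map v (generic n \<sigma>)) \<phi> = rename v \<phi>"
  unfolding inst_def by (rule rename_cong[OF assms]) (rule ren_of_map_generic)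

lemma inst_generic:
  assumes "formula_in T (context_of n) \<phi>" shows "inst n (generic n) \<phi> = \<phi>"
  using inst_map_generic[OF assms, of id] by simp

lemma formula_in_inst:
  assumes "formula_in T (context_of n) \<phi>" "valuation n \<Lambda> a" "set \<Lambda> \<subseteq> sorts T"
  shows "formula_in T \<Lambda> (inst n a \<phi>)"
  unfolding inst_def using assms(1) renaming_ren_of[OF assms(2)] assms(3) by (rule formula_in_rename)

end

lemma renaming_Pos: "renaming \<Lambda> \<Lambda>' v \<longleftrightarrow> (\<forall>\<sigma>. v \<in> Pos \<Lambda> \<sigma> \<rightarrow> Pos \<Lambda>' \<sigma>)"
  by (auto simp: renaming_def Pos_iff Pi_iff)

section \<open>The functor of formulae\<close>

definition related :: "('s \<Rightarrow> cospan set) \<Rightarrow> 's list \<Rightarrow> ('s \<Rightarrow> nat list) \<Rightarrow> ('s \<Rightarrow> nat list) \<Rightarrow> bool" where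
  "related \<omega> \<Lambda> a b \<longleftrightarrow> (\<forall>\<sigma>. (a \<sigma>, b \<sigma>) \<in> wrel (\<omega> \<sigma>) (Pos \<Lambda> \<sigma>))"

lemma related_valuation:
  assumes "\<omega> \<in> Homs (coprod_WW J) c d" "related \<omega> \<Lambda> a b"
  shows "valuation c \<Lambda> a" "valuation d \<Lambda> b"
proof -
  have "\<omega> \<sigma> \<in> Homs WW (c \<sigma>) (d \<sigma>)" "(a \<sigma>, b \<sigma>) \<in> wrel (\<omega> \<sigma>) (Pos \<Lambda> \<sigma>)" for \<sigma>
    using assms by (simp_all add: Homs_C_D(1) related_def)
  from wrel_length[OF this] show "valuation c \<Lambda> a" "valuation d \<Lambda> b" by (simp_all add: valuation_def)
qed

lemma related_map:
  assumes "\<omega> \<in> Homs (coprod_WW J) c d" "related \<omega> \<Lambda> a b" "renaming \<Lambda> \<Lambda>' v"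
  shows "related \<omega> \<Lambda>' (\<lambda>\<sigma>. map v (a \<sigma>)) (\<lambda>\<sigma>. map v (b \<sigma>))"
  unfolding related_def
proof
  fix \<sigma>
  show "(map v (a \<sigma>), map v (b \<sigma>)) \<in> wrel (\<omega> \<sigma>) (Pos \<Lambda>' \<sigma>)"
    using assms(2,3) by (intro wrel_map[OF Homs_C_D(1)[OF assms(1)]]) (auto simp: related_def renaming_Pos)
qed

text \<open>The apex of \<open>\<omega>\<close> as a context: the related valuations are the images of a generic pair.\<close>

lemma apex_exists:
  assumes \<omega>: "\<omega> \<in> Homs (coprod_WW J) c d"
  obtains \<Theta> x y where "set \<Theta> \<subseteq> J" "valuation c \<Theta> x" "valuation d \<Theta> y"
    "\<forall>\<Lambda> a b. related \<omega> \<Lambda> a b \<longleftrightarrow>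
      (\<exists>u. renaming \<Theta> \<Lambda> u \<and> (\<forall>\<sigma>. a \<sigma> = map u (x \<sigma>) \<and> b \<sigma> = map u (y \<sigma>)))"
proof -
  note \<omega>' = Homs_C_D(1)[OF \<omega>]
  have "\<exists>w. w \<in> \<omega> \<sigma> \<and> w \<in> cospans (c \<sigma>) (d \<sigma>)" for \<sigma>
    using \<omega>'[of \<sigma>] by (rule Homs_WW_nonempty) blast
  then obtain w where w: "\<And>\<sigma>. w \<sigma> \<in> \<omega> \<sigma>" "\<And>\<sigma>. w \<sigma> \<in> cospans (c \<sigma>) (d \<sigma>)" by metis
  define S xs ys where "S \<sigma> = fst (w \<sigma>)" and "xs \<sigma> = fst (snd (w \<sigma>))" and "ys \<sigma> = snd (snd (w \<sigma>))" for \<sigma>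
  have w_eq: "w \<sigma> = (S \<sigma>, xs \<sigma>, ys \<sigma>)" for \<sigma> by (simp add: S_def xs_def ys_def)
  have w_mem: "(S \<sigma>, xs \<sigma>, ys \<sigma>) \<in> \<omega> \<sigma>" for \<sigma> using w(1)[of \<sigma>] by (simp add: w_eq)
  have cosp: "finite (S \<sigma>)" "length (xs \<sigma>) = c \<sigma>" "length (ys \<sigma>) = d \<sigma>" "set (xs \<sigma>) \<subseteq> S \<sigma>" "set (ys \<sigma>) \<subseteq> S \<sigma>" for \<sigma>
    using w(2)[of \<sigma>] by (auto simp: w_eq cospans_def)
  \<comment> \<open>Where the morphism is the identity of 0, the pair of empty lists is related even
    over the empty set, and a function into the empty set forces the apex to be empty. Therefore
    only finitely many sorts contribute variables to \<open>\<Theta>\<close>.\<close>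
  have empty: "S \<sigma> = {}" if "\<omega> \<sigma> = Ident WW 0" for \<sigma>
  proof -
    have "([], []) \<in> wrel (\<omega> \<sigma>) ({} :: nat set)" by (simp add: that wrel_Ident)
    then show ?thesis unfolding wrel_iff[OF \<omega>' w_mem] by auto
  qed
  let ?A = "{\<sigma>. \<omega> \<sigma> \<noteq> Ident WW 0}"
  have A: "finite ?A" "?A \<subseteq> J" using \<omega> by (auto simp: Homs_C fsupp_def)
  obtain \<Theta> where \<Theta>: "\<forall>\<sigma>. count_list \<Theta> \<sigma> = card (S \<sigma>)"
    using context_exists[OF A(1), of "\<lambda>\<sigma>. card (S \<sigma>)"] empty by auto
  have "distinct (pos \<Theta> \<sigma>)" for \<sigma> by (simp add: pos_def)
  from distinct_card[OF this] have "card (Pos \<Theta> \<sigma>) = card (S \<sigma>)" for \<sigma>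
    using \<Theta> by (simp add: length_pos)
  then have "\<exists>e. bij_betw e (S \<sigma>) (Pos \<Theta> \<sigma>)" for \<sigma>
    using cosp(1) by (intro finite_same_card_bij) simp_all
  then obtain e where e: "\<And>\<sigma>. bij_betw (e \<sigma>) (S \<sigma>) (Pos \<Theta> \<sigma>)" by metis
  let ?x = "\<lambda>\<sigma>. map (e \<sigma>) (xs \<sigma>)" and ?y = "\<lambda>\<sigma>. map (e \<sigma>) (ys \<sigma>)"
  have eS: "s \<in> S \<sigma> \<Longrightarrow> e \<sigma> s \<in> Pos \<Theta> \<sigma>" for s \<sigma> using e bij_betwE by blast
  show thesis
  proof
    show "set \<Theta> \<subseteq> J"
    proof
      fix \<sigma> assume "\<sigma> \<in> set \<Theta>"
      then have "S \<sigma> \<noteq> {}" using \<Theta> by (metis card.empty count_list_0_iff)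
      then show "\<sigma> \<in> J" using empty A(2) by blast
    qed
    show "valuation c \<Theta> ?x" "valuation d \<Theta> ?y"
      using cosp eS by (auto simp: valuation_def simp del: set_filter) (meson eS subsetD)+
    show "\<forall>\<Lambda> a b. related \<omega> \<Lambda> a b \<longleftrightarrow>
      (\<exists>u. renaming \<Theta> \<Lambda> u \<and> (\<forall>\<sigma>. a \<sigma> = map u (?x \<sigma>) \<and> b \<sigma> = map u (?y \<sigma>)))"
    proof (intro allI iffI)
      fix \<Lambda> a b
      assume "related \<omega> \<Lambda> a b"
      then have "\<forall>\<sigma>. \<exists>h. h \<in> S \<sigma> \<rightarrow> Pos \<Lambda> \<sigma> \<and> a \<sigma> = map h (xs \<sigma>) \<and> b \<sigma> = map h (ys \<sigma>)"
        unfolding related_def wrel_iff[OF \<omega>' w_mem] by blast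
      then obtain h where h: "\<And>\<sigma>. h \<sigma> \<in> S \<sigma> \<rightarrow> Pos \<Lambda> \<sigma>" "\<And>\<sigma>. a \<sigma> = map (h \<sigma>) (xs \<sigma>)"
        "\<And>\<sigma>. b \<sigma> = map (h \<sigma>) (ys \<sigma>)" by metis
      \<comment> \<open>Every index of \<open>\<Theta>\<close> has one sort, so the functions
        \<open>h \<sigma>\<close> glue to a single renaming.\<close>
      let ?u = "\<lambda>i. h (\<Theta> ! i) (inv_into (S (\<Theta> ! i)) (e (\<Theta> ! i)) i)"
      have u: "?u (e \<sigma> s) = h \<sigma> s" if "s \<in> S \<sigma>" for \<sigma> s
        using eS[OF that] bij_betw_inv_into_left[OF e that] by (simp add: Pos_iff)
      have "renaming \<Theta> \<Lambda> ?u"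
        unfolding renaming_Pos
      proof (intro allI Pi_I)
        fix \<sigma> i assume i: "i \<in> Pos \<Theta> \<sigma>"
        then have "inv_into (S \<sigma>) (e \<sigma>) i \<in> S \<sigma>"
          using bij_betw_imp_surj_on[OF e[of \<sigma>]] by (intro inv_into_into) simp
        then show "?u i \<in> Pos \<Lambda> \<sigma>" using h(1)[of \<sigma>] i by (auto simp: Pos_iff)
      qed
      moreover have "a \<sigma> = map ?u (?x \<sigma>) \<and> b \<sigma> = map ?u (?y \<sigma>)" for \<sigma>
        unfolding h(2,3) map_map o_def using u cosp(4,5) by (metis (no_types, lifting) map_cong subsetD)
      ultimately show "\<exists>u. renaming \<Theta> \<Lambda> u \<and> (\<forall>\<sigma>. a \<sigma> = map u (?x \<sigma>) \<and> b \<sigma> = map u (?y \<sigma>))" by blast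
    next
      fix \<Lambda> a b
      assume "\<exists>u. renaming \<Theta> \<Lambda> u \<and> (\<forall>\<sigma>. a \<sigma> = map u (?x \<sigma>) \<and> b \<sigma> = map u (?y \<sigma>))"
      then obtain u where u: "renaming \<Theta> \<Lambda> u" "\<And>\<sigma>. a \<sigma> = map (u \<circ> e \<sigma>) (xs \<sigma>)" "\<And>\<sigma>. b \<sigma> = map (u \<circ> e \<sigma>) (ys \<sigma>)"
        by auto
      have "u \<circ> e \<sigma> \<in> S \<sigma> \<rightarrow> Pos \<Lambda> \<sigma>" for \<sigma>
        using u(1) eS unfolding renaming_Pos by fastforce
      then show "related \<omega> \<Lambda> a b"
        unfolding related_def wrel_iff[OF \<omega>' w_mem] using u(2,3) by blast
    qed
  qed
qed

section \<open>Pushing formulae forward along a morphism\<close>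

context regular_theory
begin

text \<open>This fixes \<open>\<chi>\<close> up to provable equivalence. The side formula
  \<open>A\<close> expresses Frobenius reciprocity; an arbitrary \<open>b\<close> in place of the
  generic tuple, together with \<open>v\<close>, expresses stability under substitution. Identities
  and composites of morphisms then become facts about \<open>related\<close>.\<close>

definition is_push where
  "is_push \<omega> c d \<phi> \<chi> \<longleftrightarrow> wff (context_of d) \<chi> \<and> (\<forall>\<Delta> A B b. valuation d \<Delta> b \<longrightarrow> wff \<Delta> A \<longrightarrow> wff \<Delta> B \<longrightarrow>
    (Conj A (inst d b \<chi>) \<turnstile>[\<Delta>] B \<longleftrightarrow> (\<forall>\<Lambda> v a. set \<Lambda> \<subseteq> sorts T \<longrightarrow> renaming \<Delta> \<Lambda> v \<longrightarrow>
      related \<omega> \<Lambda> a (\<lambda>\<sigma>. map v (b \<sigma>)) \<longrightarrow> Conj (rename v A) (inst c a \<phi>) \<turnstile>[\<Lambda>] rename v B)))"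

text \<open>Substitute along one leg of the apex context and quantify along the other. By
  \<open>apex_exists\<close>, a cocone over \<open>ren_of d y\<close> and \<open>ren_of d b\<close>
  amounts to a renaming \<open>v\<close> of \<open>\<Delta>\<close> with a tuple \<open>a\<close>
  related to the image of \<open>b\<close>, so the criterion for \<open>image_formula\<close> is the
  required property.\<close>

lemma push_exists:
  assumes \<omega>: "\<omega> \<in> Homs (coprod_WW (sorts T)) c d" and \<phi>: "wff (context_of c) \<phi>"
  shows "\<exists>\<chi>. is_push \<omega> c d \<phi> \<chi>"
proof -
  note c = Homs_C_D(2)[OF \<omega>] and d = Homs_C_D(3)[OF \<omega>]
  obtain \<Theta> x y where \<Theta>: "set \<Theta> \<subseteq> sorts T" and x: "valuation c \<Theta> x" and y: "valuation d \<Theta> y"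
    and rel: "\<forall>\<Lambda> a b. related \<omega> \<Lambda> a b \<longleftrightarrow>
      (\<exists>u. renaming \<Theta> \<Lambda> u \<and> (\<forall>\<sigma>. a \<sigma> = map u (x \<sigma>) \<and> b \<sigma> = map u (y \<sigma>)))"
    using \<omega> by (rule apex_exists)
  have len: "length (x \<sigma>) = c \<sigma>" "length (y \<sigma>) = d \<sigma>" for \<sigma> using x y by (simp_all add: valuation_def)
  note f = renaming_ren_of[OF d y]
  have \<chi>: "wff \<Theta> (inst c x \<phi>)" using \<phi> x \<Theta> by (rule formula_in_inst[OF c])
  let ?\<chi> = "image_formula (context_of d) \<Theta> (ren_of d y) (inst c x \<phi>)"
  show ?thesis
    unfolding is_push_def
  proof (intro exI[of _ ?\<chi>] conjI allI impI)
    show "wff (context_of d) ?\<chi>" by (rule wff_image_formula[OF f \<chi> set_context_of[OF d]])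
    fix \<Delta> A B b assume b: "valuation d \<Delta> b" and A: "wff \<Delta> A" and B: "wff \<Delta> B"
    have lenb: "length (b \<sigma>) = d \<sigma>" for \<sigma> using b by (simp add: valuation_def)
  let ?tuples = "\<forall>\<Lambda> v a. set \<Lambda> \<subseteq> sorts T \<longrightarrow> renaming \<Delta> \<Lambda> v \<longrightarrow> related \<omega> \<Lambda> a (\<lambda>\<sigma>. map v (b \<sigma>)) \<longrightarrow> Conj (rename v A) (inst c a \<phi>) \<turnstile>[\<Lambda>] rename v B"
  let ?cocones = "\<forall>\<Lambda> u v. set \<Lambda> \<subseteq> sorts T \<and> renaming \<Theta> \<Lambda> u \<and> renaming \<Delta> \<Lambda> v \<and> (\<forall>\<sigma>. map v (b \<sigma>) = map u (y \<sigma>)) \<longrightarrow> Conj (rename v A) (inst c (\<lambda>\<sigma>. map u (x \<sigma>)) \<phi>) \<turnstile>[\<Lambda>] rename v B"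
    have cocone: "(\<forall>i<length (context_of d). u (ren_of d y i) = v (ren_of d b i)) \<longleftrightarrow>
      (\<forall>\<sigma>. map v (b \<sigma>) = map u (y \<sigma>))" (is "?l \<longleftrightarrow> ?r") for u v :: "nat \<Rightarrow> nat"
    proof
      assume ?l
      then have "map (\<lambda>i. u (ren_of d y i)) (generic d \<sigma>) = map (\<lambda>i. v (ren_of d b i)) (generic d \<sigma>)" for \<sigma>
        by (intro map_cong refl) (simp add: Pos_iff)
      then have "map u (map (ren_of d y) (generic d \<sigma>)) = map v (map (ren_of d b) (generic d \<sigma>))" for \<sigma>
        by (simp add: o_def)
      then show ?r using map_ren_of_generic[OF d] len lenb by metis
    next
      assume ?r
      then show ?l using ren_of_comp[where v = u, OF d len(2)] ren_of_comp[where v = v, OF d lenb] by simp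
    qed
    have "Conj A (inst d b ?\<chi>) \<turnstile>[\<Delta>] B \<longleftrightarrow>
      (\<forall>\<Lambda> u v. set \<Lambda> \<subseteq> sorts T \<and> renaming \<Theta> \<Lambda> u \<and> renaming \<Delta> \<Lambda> v \<and>
        (\<forall>i<length (context_of d). u (ren_of d y i) = v (ren_of d b i)) \<longrightarrow>
        Conj (rename v A) (rename u (inst c x \<phi>)) \<turnstile>[\<Lambda>] rename v B)"
      unfolding inst_def[of d] by (rule conj_image_formula_entails_iff[OF f \<chi> renaming_ren_of[OF d b] A B])
    also have "\<dots> \<longleftrightarrow> ?cocones"
      unfolding cocone rename_inst[OF c \<phi> len(1)] ..
    also have "\<dots> \<longleftrightarrow> ?tuples"
    proof (intro iffI allI impI)
      fix \<Lambda> v a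
      assume *: "?cocones"
        and **: "set \<Lambda> \<subseteq> sorts T" "renaming \<Delta> \<Lambda> v" "related \<omega> \<Lambda> a (\<lambda>\<sigma>. map v (b \<sigma>))"
      from **(3) obtain u where u: "renaming \<Theta> \<Lambda> u" "\<And>\<sigma>. a \<sigma> = map u (x \<sigma>)" "\<And>\<sigma>. map v (b \<sigma>) = map u (y \<sigma>)"
        unfolding rel[rule_format] by blast
      then have "a = (\<lambda>\<sigma>. map u (x \<sigma>))" by auto
      with * ** u show "Conj (rename v A) (inst c a \<phi>) \<turnstile>[\<Lambda>] rename v B" by blast
    next
      fix \<Lambda> u v
      assume *: "?tuples"
        and **: "set \<Lambda> \<subseteq> sorts T \<and> renaming \<Theta> \<Lambda> u \<and> renaming \<Delta> \<Lambda> v \<and> (\<forall>\<sigma>. map v (b \<sigma>) = map u (y \<sigma>))"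
      then have "related \<omega> \<Lambda> (\<lambda>\<sigma>. map u (x \<sigma>)) (\<lambda>\<sigma>. map v (b \<sigma>))" unfolding rel[rule_format] by blast
      with * ** show "Conj (rename v A) (inst c (\<lambda>\<sigma>. map u (x \<sigma>)) \<phi>) \<turnstile>[\<Lambda>] rename v B" by blast
    qed
    finally show "Conj A (inst d b ?\<chi>) \<turnstile>[\<Delta>] B \<longleftrightarrow> ?tuples" .
  qed
qed

abbreviation (input) CT where "CT \<equiv> coprod_WW (sorts T)"

lemma conj_commute_iff: "Conj \<phi> \<psi> \<turnstile>[\<Gamma>] \<chi> \<longleftrightarrow> Conj \<psi> \<phi> \<turnstile>[\<Gamma>] \<chi>"
proof -
  have "Conj \<psi> \<phi> \<turnstile>[\<Gamma>] \<chi>" if "Conj \<phi> \<psi> \<turnstile>[\<Gamma>] \<chi>" for \<phi> \<psi>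
    using entails_wff[OF that] by (intro Cut[OF Conj_intro[OF Conj_right Conj_left] that]) simp_all
  then show ?thesis by blast
qed

lemma conj_mono: "\<phi> \<turnstile>[\<Gamma>] \<phi>' \<Longrightarrow> \<psi> \<turnstile>[\<Gamma>] \<psi>' \<Longrightarrow> Conj \<phi> \<psi> \<turnstile>[\<Gamma>] Conj \<phi>' \<psi>'"
  by (rule Conj_intro[OF conj_entails1 conj_entails2]) (simp_all add: entails_wff)

lemma Top_conj_iff:
  assumes "wff \<Gamma> \<chi>" shows "Conj Top \<chi> \<turnstile>[\<Gamma>] \<psi> \<longleftrightarrow> \<chi> \<turnstile>[\<Gamma>] \<psi>"
proof
  assume "Conj Top \<chi> \<turnstile>[\<Gamma>] \<psi>"
  then show "\<chi> \<turnstile>[\<Gamma>] \<psi>" by (rule Cut[OF Conj_intro[OF Top_intro Identity], OF assms assms])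
next
  assume "\<chi> \<turnstile>[\<Gamma>] \<psi>"
  then show "Conj Top \<chi> \<turnstile>[\<Gamma>] \<psi>" using formula_in_sorts[OF assms] by (intro conj_entails2) simp_all
qed

text \<open>Any formula with the universal property will do, so the apex used to construct one is
  forgotten.\<close>

definition push where "push \<omega> c d \<phi> = (SOME \<chi>. is_push \<omega> c d \<phi> \<chi>)"

context
  fixes \<omega> c d
  assumes \<omega>: "\<omega> \<in> Homs CT c d"
begin

lemma is_push:
  assumes "wff (context_of c) \<phi>" shows "is_push \<omega> c d \<phi> (push \<omega> c d \<phi>)"
  unfolding push_def using push_exists[OF \<omega> assms] by (rule someI_ex)

lemma wff_push: "wff (context_of c) \<phi> \<Longrightarrow> wff (context_of d) (push \<omega> c d \<phi>)"
  by (rule is_push[unfolded is_push_def, THEN conjunct1])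

lemma conj_inst_push_iff:
  assumes "wff (context_of c) \<phi>" "valuation d \<Delta> b" "wff \<Delta> A" "wff \<Delta> B"
  shows "Conj A (inst d b (push \<omega> c d \<phi>)) \<turnstile>[\<Delta>] B \<longleftrightarrow> (\<forall>\<Lambda> v a. set \<Lambda> \<subseteq> sorts T \<longrightarrow> renaming \<Delta> \<Lambda> v \<longrightarrow>
    related \<omega> \<Lambda> a (\<lambda>\<sigma>. map v (b \<sigma>)) \<longrightarrow> Conj (rename v A) (inst c a \<phi>) \<turnstile>[\<Lambda>] rename v B)"
  using is_push[OF assms(1), unfolded is_push_def, THEN conjunct2] assms(2-) by simp

lemma inst_push_iff:
  assumes \<phi>: "wff (context_of c) \<phi>" and b: "valuation d \<Delta> b" and B: "wff \<Delta> B"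
  shows "inst d b (push \<omega> c d \<phi>) \<turnstile>[\<Delta>] B \<longleftrightarrow> (\<forall>\<Lambda> v a. set \<Lambda> \<subseteq> sorts T \<longrightarrow> renaming \<Delta> \<Lambda> v \<longrightarrow>
    related \<omega> \<Lambda> a (\<lambda>\<sigma>. map v (b \<sigma>)) \<longrightarrow> inst c a \<phi> \<turnstile>[\<Lambda>] rename v B)"
proof -
  have sorts: "set \<Delta> \<subseteq> sorts T" using B by (rule formula_in_sorts)
  have "wff \<Delta> (inst d b (push \<omega> c d \<phi>))"
    using \<phi> b sorts by (intro formula_in_inst[OF Homs_C_D(3)[OF \<omega>]] wff_push)
  then have "inst d b (push \<omega> c d \<phi>) \<turnstile>[\<Delta>] B \<longleftrightarrow> Conj Top (inst d b (push \<omega> c d \<phi>)) \<turnstile>[\<Delta>] B"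
    by (simp add: Top_conj_iff)
  moreover have "Conj Top (inst c a \<phi>) \<turnstile>[\<Lambda>] rename v B \<longleftrightarrow> inst c a \<phi> \<turnstile>[\<Lambda>] rename v B"
    if "set \<Lambda> \<subseteq> sorts T" "related \<omega> \<Lambda> a (\<lambda>\<sigma>. map v (b \<sigma>))" for \<Lambda> v a
    using that \<phi> related_valuation(1)[OF \<omega>] by (intro Top_conj_iff formula_in_inst[OF Homs_C_D(2)[OF \<omega>]])
  ultimately show ?thesis using conj_inst_push_iff[OF \<phi> b _ B, of Top] sorts by simp
qed

text \<open>Every tuple \<open>b\<close> is the image of the generic one under
  \<open>ren_of d b\<close>. Testing the generic tuple along all renamings is thus the same as
  testing all pairs related by \<open>\<omega>\<close>.\<close>

lemma push_entails_iff:
  assumes \<phi>: "wff (context_of c) \<phi>" and B: "wff (context_of d) B"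
  shows "push \<omega> c d \<phi> \<turnstile>[context_of d] B \<longleftrightarrow>
    (\<forall>\<Lambda> a b. set \<Lambda> \<subseteq> sorts T \<longrightarrow> related \<omega> \<Lambda> a b \<longrightarrow> inst c a \<phi> \<turnstile>[\<Lambda>] inst d b B)"
proof -
  let ?all = "\<forall>\<Lambda> a b. set \<Lambda> \<subseteq> sorts T \<longrightarrow> related \<omega> \<Lambda> a b \<longrightarrow> inst c a \<phi> \<turnstile>[\<Lambda>] inst d b B"
  let ?generic = "\<forall>\<Lambda> v a. set \<Lambda> \<subseteq> sorts T \<longrightarrow> renaming (context_of d) \<Lambda> v \<longrightarrow> related \<omega> \<Lambda> a (\<lambda>\<sigma>. map v (generic d \<sigma>)) \<longrightarrow> inst c a \<phi> \<turnstile>[\<Lambda>] rename v B"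
  note d = Homs_C_D(3)[OF \<omega>]
  have "push \<omega> c d \<phi> \<turnstile>[context_of d] B \<longleftrightarrow> ?generic"
    using inst_push_iff[OF \<phi> valuation_generic[OF d] B] by (simp add: inst_generic[OF d wff_push[OF \<phi>]])
  also have "\<dots> \<longleftrightarrow> ?all"
  proof (intro iffI allI impI)
    fix \<Lambda> a b
    assume *: "?generic"
      and **: "set \<Lambda> \<subseteq> sorts T" "related \<omega> \<Lambda> a b"
    have b: "valuation d \<Lambda> b" using \<omega> **(2) by (rule related_valuation)
    then have "(\<lambda>\<sigma>. map (ren_of d b) (generic d \<sigma>)) = b"
      by (intro ext map_ren_of_generic[OF d]) (simp add: valuation_def)
    with * ** renaming_ren_of[OF d b] show "inst c a \<phi> \<turnstile>[\<Lambda>] inst d b B" by (simp add: inst_def[of d])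
  next
    fix \<Lambda> v a
    assume *: "?all"
      and **: "set \<Lambda> \<subseteq> sorts T" "related \<omega> \<Lambda> a (\<lambda>\<sigma>. map v (generic d \<sigma>))"
    then have "inst c a \<phi> \<turnstile>[\<Lambda>] inst d (\<lambda>\<sigma>. map v (generic d \<sigma>)) B" by blast
    then show "inst c a \<phi> \<turnstile>[\<Lambda>] rename v B" by (simp add: inst_map_generic[OF d B])
  qed
  finally show ?thesis .
qed

lemma entails_push:
  assumes \<phi>: "wff (context_of c) \<phi>" and "set \<Lambda> \<subseteq> sorts T" "related \<omega> \<Lambda> a b"
  shows "inst c a \<phi> \<turnstile>[\<Lambda>] inst d b (push \<omega> c d \<phi>)"
  using push_entails_iff[OF \<phi> wff_push[OF \<phi>]] Identity[OF wff_push[OF \<phi>]] assms(2,3) by blast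

lemma push_mono:
  assumes "\<phi> \<turnstile>[context_of c] \<psi>"
  shows "push \<omega> c d \<phi> \<turnstile>[context_of d] push \<omega> c d \<psi>"
proof -
  have wff: "wff (context_of c) \<phi>" "wff (context_of c) \<psi>" using entails_wff[OF assms] by auto
  show ?thesis unfolding push_entails_iff[OF wff(1) wff_push[OF wff(2)]]
  proof (intro allI impI)
    fix \<Lambda> a b assume \<Lambda>: "set \<Lambda> \<subseteq> sorts T" and r: "related \<omega> \<Lambda> a b"
    have "inst c a \<phi> \<turnstile>[\<Lambda>] inst c a \<psi>" unfolding inst_def
      using assms renaming_ren_of[OF Homs_C_D(2)[OF \<omega>] related_valuation(1)[OF \<omega> r]] \<Lambda> by (rule entails_rename)
    then show "inst c a \<phi> \<turnstile>[\<Lambda>] inst d b (push \<omega> c d \<psi>)"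
      using entails_push[OF wff(2) \<Lambda> r] by (rule Cut)
  qed
qed

end

lemma push_Ident_entails_iff:
  assumes c: "c \<in> Objs CT" and \<phi>: "wff (context_of c) \<phi>" and B: "wff (context_of c) B"
  shows "push (Ident CT c) c c \<phi> \<turnstile>[context_of c] B \<longleftrightarrow> \<phi> \<turnstile>[context_of c] B"
proof -
  have rel: "related (Ident CT c) \<Lambda> a b \<longleftrightarrow> a = b \<and> valuation c \<Lambda> a" for \<Lambda> a b
    by (auto simp: related_def coprod_fields wrel_Ident valuation_def)
  show ?thesis
    unfolding push_entails_iff[OF Ident_C_in[OF c] \<phi> B] rel
  proof (intro iffI allI impI; (elim conjE)?)
    assume "\<forall>\<Lambda> a b. set \<Lambda> \<subseteq> sorts T \<longrightarrow> a = b \<and> valuation c \<Lambda> a \<longrightarrow> inst c a \<phi> \<turnstile>[\<Lambda>] inst c b B"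
    then have "inst c (generic c) \<phi> \<turnstile>[context_of c] inst c (generic c) B"
      using valuation_generic[OF c] set_context_of[OF c] by blast
    then show "\<phi> \<turnstile>[context_of c] B" by (simp only: inst_generic[OF c \<phi>] inst_generic[OF c B])
  next
    fix \<Lambda> a b assume "\<phi> \<turnstile>[context_of c] B" "set \<Lambda> \<subseteq> sorts T" "a = b" "valuation c \<Lambda> a"
    then show "inst c a \<phi> \<turnstile>[\<Lambda>] inst c b B"
      unfolding inst_def using renaming_ren_of[OF c] by (blast intro: entails_rename)
  qed
qed

text \<open>A pair is related by the composite exactly when some \<open>m\<close> lies between.
  Given the iterated push, such a pair passes through the inner formula at \<open>m\<close>.
  Conversely the inner formula is unfolded at \<open>m\<close>, and \<open>related_map\<close>
  carries the pair \<open>(m, b)\<close> into the new context.\<close>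

lemma push_comp_entails_iff:
  assumes f: "f \<in> Homs CT c d" and g: "g \<in> Homs CT d e"
    and \<phi>: "wff (context_of c) \<phi>" and B: "wff (context_of e) B"
  shows "push (comp CT g f) c e \<phi> \<turnstile>[context_of e] B \<longleftrightarrow> push g d e (push f c d \<phi>) \<turnstile>[context_of e] B"
proof -
  let ?gf = "\<forall>\<Lambda> a b. set \<Lambda> \<subseteq> sorts T \<longrightarrow> related (comp CT g f) \<Lambda> a b \<longrightarrow> inst c a \<phi> \<turnstile>[\<Lambda>] inst e b B"
  let ?g = "\<forall>\<Lambda> m b. set \<Lambda> \<subseteq> sorts T \<longrightarrow> related g \<Lambda> m b \<longrightarrow> inst d m (push f c d \<phi>) \<turnstile>[\<Lambda>] inst e b B"
  note e = Homs_C_D(3)[OF g]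
  have rel: "related (comp CT g f) \<Lambda> a b \<longleftrightarrow> (\<exists>m. related f \<Lambda> a m \<and> related g \<Lambda> m b)" for \<Lambda> a b
  proof -
    have "related (comp CT g f) \<Lambda> a b \<longleftrightarrow>
      (\<forall>\<sigma>. \<exists>m. (a \<sigma>, m) \<in> wrel (f \<sigma>) (Pos \<Lambda> \<sigma>) \<and> (m, b \<sigma>) \<in> wrel (g \<sigma>) (Pos \<Lambda> \<sigma>))"
      unfolding related_def coprod_fields
      by (simp add: wrel_comp[OF Homs_C_D(1)[OF f] Homs_C_D(1)[OF g]] relcomp_unfold)
    \<comment> \<open>The intermediate lists exist separately at each sort; choice collects them
      into one tuple.\<close>
    also have "\<dots> \<longleftrightarrow> (\<exists>m. related f \<Lambda> a m \<and> related g \<Lambda> m b)"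
      unfolding related_def choice_iff by auto
    finally show ?thesis .
  qed
  have "push g d e (push f c d \<phi>) \<turnstile>[context_of e] B \<longleftrightarrow>
    ?g"
    by (rule push_entails_iff[OF g wff_push[OF f \<phi>] B])
  also have "\<dots> \<longleftrightarrow> ?gf"
  proof (intro iffI allI impI)
    fix \<Lambda> a b
    assume *: "?g"
      and \<Lambda>: "set \<Lambda> \<subseteq> sorts T" and "related (comp CT g f) \<Lambda> a b"
    then obtain m where m: "related f \<Lambda> a m" "related g \<Lambda> m b" by (auto simp: rel)
    have "inst c a \<phi> \<turnstile>[\<Lambda>] inst d m (push f c d \<phi>)" by (rule entails_push[OF f \<phi> \<Lambda> m(1)])
    then show "inst c a \<phi> \<turnstile>[\<Lambda>] inst e b B" using * \<Lambda> m(2) by (blast intro: Cut)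
  next
    fix \<Lambda> m b
    assume *: "?gf"
      and \<Lambda>: "set \<Lambda> \<subseteq> sorts T" and m: "related g \<Lambda> m b"
    note vm = related_valuation[OF g m]
    have lenb: "length (b \<sigma>) = e \<sigma>" for \<sigma> using vm(2) by (simp add: valuation_def)
    show "inst d m (push f c d \<phi>) \<turnstile>[\<Lambda>] inst e b B"
      unfolding inst_push_iff[OF f \<phi> vm(1) formula_in_inst[OF e B vm(2) \<Lambda>]]
    proof (intro allI impI)
      fix \<Lambda>' v a assume \<Lambda>': "set \<Lambda>' \<subseteq> sorts T" and v: "renaming \<Lambda> \<Lambda>' v"
        and "related f \<Lambda>' a (\<lambda>\<sigma>. map v (m \<sigma>))"
      then have "related (comp CT g f) \<Lambda>' a (\<lambda>\<sigma>. map v (b \<sigma>))"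
        unfolding rel using related_map[OF g m v] by blast
      then show "inst c a \<phi> \<turnstile>[\<Lambda>'] rename v (inst e b B)"
        unfolding rename_inst[OF e B lenb] using * \<Lambda>' by blast
    qed
  qed
  also have "\<dots> \<longleftrightarrow> push (comp CT g f) c e \<phi> \<turnstile>[context_of e] B"
    by (rule push_entails_iff[OF comp_C_in[OF f g] \<phi> B, symmetric])
  finally show ?thesis by simp
qed

text \<open>A larger morphism relates more tuples, so every witness for \<open>f\<close> is one for
  \<open>g\<close>.\<close>

lemma push_leq:
  assumes f: "f \<in> Homs CT c d" and g: "g \<in> Homs CT c d" and le: "leq CT f g"
    and \<phi>: "wff (context_of c) \<phi>"
  shows "push f c d \<phi> \<turnstile>[context_of d] push g c d \<phi>"
proof -
  have "related g \<Lambda> a b" if "related f \<Lambda> a b" for \<Lambda> a b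
    using that leq_WW_wrel_mono[OF Homs_C_D(1)[OF f] Homs_C_D(1)[OF g]] le
    unfolding related_def coprod_fields by blast
  then show ?thesis
    unfolding push_entails_iff[OF f \<phi> wff_push[OF g \<phi>]] using entails_push[OF g \<phi>] by blast
qed

text \<open>At every sort the first \<open>c \<sigma>\<close> variables of the generic tuple serve
  \<open>\<phi>\<close> and the others serve \<open>\<psi>\<close>. The split is made per sort
  because the listed context of the tensor need not be a concatenation of the two listed
  contexts.\<close>

definition lax :: "('s \<Rightarrow> nat) \<Rightarrow> ('s \<Rightarrow> nat) \<Rightarrow> ('s, 'r) formula \<Rightarrow> ('s, 'r) formula \<Rightarrow> ('s, 'r) formula" where
  "lax c d \<phi> \<psi> = Conj (inst c (\<lambda>\<sigma>. take (c \<sigma>) (generic (tensO CT c d) \<sigma>)) \<phi>)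
     (inst d (\<lambda>\<sigma>. drop (c \<sigma>) (generic (tensO CT c d) \<sigma>)) \<psi>)"

lemma tensO_apply: "tensO CT c d \<sigma> = c \<sigma> + d \<sigma>"
  by (simp add: coprod_fields)

lemma valuation_split:
  assumes "valuation (tensO CT c d) \<Lambda> w"
  shows "valuation c \<Lambda> (\<lambda>\<sigma>. take (c \<sigma>) (w \<sigma>))" "valuation d \<Lambda> (\<lambda>\<sigma>. drop (c \<sigma>) (w \<sigma>))"
proof -
  have "length (w \<sigma>) = c \<sigma> + d \<sigma>" "set (w \<sigma>) \<subseteq> Pos \<Lambda> \<sigma>" for \<sigma>
    using assms by (simp_all add: valuation_def tensO_apply)
  then show "valuation c \<Lambda> (\<lambda>\<sigma>. take (c \<sigma>) (w \<sigma>))" "valuation d \<Lambda> (\<lambda>\<sigma>. drop (c \<sigma>) (w \<sigma>))"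
    by (simp_all add: valuation_def order_trans[OF set_take_subset] order_trans[OF set_drop_subset])
qed

context
  fixes c d
  assumes c: "c \<in> Objs CT" and d: "d \<in> Objs CT"
begin

lemma inst_lax:
  assumes \<phi>: "wff (context_of c) \<phi>" and \<psi>: "wff (context_of d) \<psi>"
    and w: "\<And>\<sigma>. length (w \<sigma>) = c \<sigma> + d \<sigma>"
  shows "inst (tensO CT c d) w (lax c d \<phi> \<psi>) =
    Conj (inst c (\<lambda>\<sigma>. take (c \<sigma>) (w \<sigma>)) \<phi>) (inst d (\<lambda>\<sigma>. drop (c \<sigma>) (w \<sigma>)) \<psi>)"
proof -
  note cd = tensO_C_in[OF c d]
  have len: "length (generic (tensO CT c d) \<sigma>) = c \<sigma> + d \<sigma>" for \<sigma>
    by (simp add: length_pos count_context_of[OF cd] tensO_apply)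
  have m: "map (ren_of (tensO CT c d) w) (generic (tensO CT c d) \<sigma>) = w \<sigma>" for \<sigma>
    by (rule map_ren_of_generic[OF cd]) (simp add: w tensO_apply)
  have "rename (ren_of (tensO CT c d) w) (inst c (\<lambda>\<sigma>. take (c \<sigma>) (generic (tensO CT c d) \<sigma>)) \<phi>) =
      inst c (\<lambda>\<sigma>. take (c \<sigma>) (w \<sigma>)) \<phi>"
    by (subst rename_inst[OF c \<phi>]) (simp_all add: len m flip: take_map)
  moreover have "rename (ren_of (tensO CT c d) w) (inst d (\<lambda>\<sigma>. drop (c \<sigma>) (generic (tensO CT c d) \<sigma>)) \<psi>) =
      inst d (\<lambda>\<sigma>. drop (c \<sigma>) (w \<sigma>)) \<psi>"
    by (subst rename_inst[OF d \<psi>]) (simp_all add: len m flip: drop_map)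
  ultimately show ?thesis unfolding inst_def[of "tensO CT c d"] lax_def by simp
qed

lemma wff_lax:
  assumes "wff (context_of c) \<phi>" "wff (context_of d) \<psi>"
  shows "wff (context_of (tensO CT c d)) (lax c d \<phi> \<psi>)"
  using valuation_split[OF valuation_generic[OF tensO_C_in[OF c d]]] assms set_context_of[OF tensO_C_in[OF c d]]
  by (simp add: lax_def formula_in_inst[OF c] formula_in_inst[OF d])

lemma lax_mono:
  assumes "\<phi> \<turnstile>[context_of c] \<phi>'" "\<psi> \<turnstile>[context_of d] \<psi>'"
  shows "lax c d \<phi> \<psi> \<turnstile>[context_of (tensO CT c d)] lax c d \<phi>' \<psi>'"
  unfolding lax_def inst_def
  using valuation_split[OF valuation_generic[OF tensO_C_in[OF c d]]] set_context_of[OF tensO_C_in[OF c d]] assms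
  by (intro conj_mono) (auto intro!: entails_rename renaming_ren_of[OF c] renaming_ren_of[OF d])

end

lemma rtens_iff:
  assumes "X \<in> Homs WW m n"
  shows "(u, v) \<in> rtens (wrel X V) Q \<longleftrightarrow> (take m u, take n v) \<in> wrel X V \<and> (drop m u, drop n v) \<in> Q"
proof
  assume "(u, v) \<in> rtens (wrel X V) Q"
  then show "(take m u, take n v) \<in> wrel X V \<and> (drop m u, drop n v) \<in> Q"
    by (elim rtensE) (simp add: wrel_length[OF assms])
next
  assume "(take m u, take n v) \<in> wrel X V \<and> (drop m u, drop n v) \<in> Q"
  then have "(take m u @ drop m u, take n v @ drop n v) \<in> rtens (wrel X V) Q" by (blast intro: rtensI)
  then show "(u, v) \<in> rtens (wrel X V) Q" by simp
qed

lemma related_tensA_iff: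
  assumes f: "f \<in> Homs CT c c'" and g: "g \<in> Homs CT d d'"
  shows "related (tensA CT f g) \<Lambda> a b \<longleftrightarrow>
    related f \<Lambda> (\<lambda>\<sigma>. take (c \<sigma>) (a \<sigma>)) (\<lambda>\<sigma>. take (c' \<sigma>) (b \<sigma>)) \<and>
    related g \<Lambda> (\<lambda>\<sigma>. drop (c \<sigma>) (a \<sigma>)) (\<lambda>\<sigma>. drop (c' \<sigma>) (b \<sigma>))"
  unfolding related_def coprod_fields wrel_tensA[OF Homs_C_D(1)[OF f] Homs_C_D(1)[OF g]]
    rtens_iff[OF Homs_C_D(1)[OF f]] by blast

lemma inst_mono:
  assumes "n \<in> Objs CT" "valuation n \<Lambda> a" "set \<Lambda> \<subseteq> sorts T" "\<phi> \<turnstile>[context_of n] \<psi>"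
  shows "inst n a \<phi> \<turnstile>[\<Lambda>] inst n a \<psi>"
  unfolding inst_def using assms(4) renaming_ren_of[OF assms(1,2)] assms(3) by (rule entails_rename)

text \<open>If the conjunction of the pushed formulae entails \<open>B\<close>, a pair related by
  the tensor splits and \<open>entails_push\<close> applies to each half. In the other direction the
  two pushes are unfolded one after the other, each with the remaining conjunct as its side formula;
  hence the \<open>A\<close> in \<open>is_push\<close>.\<close>

lemma lax_natural_entails_iff:
  assumes f: "f \<in> Homs CT c c'" and g: "g \<in> Homs CT d d'"
    and \<phi>: "wff (context_of c) \<phi>" and \<psi>: "wff (context_of d) \<psi>" and B: "wff (context_of (tensO CT c' d')) B"
  shows "lax c' d' (push f c c' \<phi>) (push g d d' \<psi>) \<turnstile>[context_of (tensO CT c' d')] B \<longleftrightarrow>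
    push (tensA CT f g) (tensO CT c d) (tensO CT c' d') (lax c d \<phi> \<psi>) \<turnstile>[context_of (tensO CT c' d')] B"
    (is "?l \<longleftrightarrow> ?r")
proof -
  note objs = Homs_C_D(2,3)[OF f] Homs_C_D(2,3)[OF g]
  let ?n = "tensO CT c' d'"
  let ?p = "generic ?n"
  note n = tensO_C_in[OF objs(2,4)]
  note X = wff_push[OF f \<phi>] and Y = wff_push[OF g \<psi>]
  note fg = tensA_C_in[OF f g]
  have r: "?r \<longleftrightarrow> (\<forall>\<Lambda> a b. set \<Lambda> \<subseteq> sorts T \<longrightarrow> related (tensA CT f g) \<Lambda> a b \<longrightarrow>
    inst (tensO CT c d) a (lax c d \<phi> \<psi>) \<turnstile>[\<Lambda>] inst ?n b B)"
    by (rule push_entails_iff[OF fg wff_lax[OF objs(1,3) \<phi> \<psi>] B])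
  show ?thesis
  proof
    assume l: ?l
    show ?r unfolding r
    proof (intro allI impI)
      fix \<Lambda> a b assume \<Lambda>: "set \<Lambda> \<subseteq> sorts T" and rel: "related (tensA CT f g) \<Lambda> a b"
      note val = related_valuation[OF fg rel]
      have len: "length (a \<sigma>) = c \<sigma> + d \<sigma>" "length (b \<sigma>) = c' \<sigma> + d' \<sigma>" for \<sigma>
        using val by (simp_all add: valuation_def tensO_apply)
      note rels = rel[unfolded related_tensA_iff[OF f g], THEN conjunct1] rel[unfolded related_tensA_iff[OF f g], THEN conjunct2]
      have "inst (tensO CT c d) a (lax c d \<phi> \<psi>) \<turnstile>[\<Lambda>] inst ?n b (lax c' d' (push f c c' \<phi>) (push g d d' \<psi>))"
        unfolding inst_lax[OF objs(1,3) \<phi> \<psi> len(1)] inst_lax[OF objs(2,4) X Y len(2)]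
        by (intro conj_mono entails_push[OF f \<phi> \<Lambda>] entails_push[OF g \<psi> \<Lambda>] rels)
      then show "inst (tensO CT c d) a (lax c d \<phi> \<psi>) \<turnstile>[\<Lambda>] inst ?n b B"
        using inst_mono[OF n val(2) \<Lambda> l] by (rule Cut)
    qed
  next
    assume r': ?r
    note vp = valuation_split[OF valuation_generic[OF n]]
    have vlen: "length (take (c' \<sigma>) (?p \<sigma>)) = c' \<sigma>" for \<sigma> using vp(1) by (simp add: valuation_def)
    have plen: "length (?p \<sigma>) = ?n \<sigma>" for \<sigma> using valuation_generic[OF n] by (simp add: valuation_def)
    let ?A = "inst c' (\<lambda>\<sigma>. take (c' \<sigma>) (?p \<sigma>)) (push f c c' \<phi>)"
    have A: "wff (context_of ?n) ?A" by (rule formula_in_inst[OF objs(2) X vp(1) set_context_of[OF n]])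
    show ?l
      unfolding lax_def conj_inst_push_iff[OF g \<psi> vp(2) A B]
    proof (intro allI impI)
      fix \<Lambda> v e
      assume \<Lambda>: "set \<Lambda> \<subseteq> sorts T" and v: "renaming (context_of ?n) \<Lambda> v"
        and e: "related g \<Lambda> e (\<lambda>\<sigma>. map v (drop (c' \<sigma>) (?p \<sigma>)))"
      note ve = related_valuation(1)[OF g e]
      have elen: "length (e \<sigma>) = d \<sigma>" for \<sigma> using ve by (simp add: valuation_def)
      have A': "rename v ?A = inst c' (\<lambda>\<sigma>. map v (take (c' \<sigma>) (?p \<sigma>))) (push f c c' \<phi>)"
        by (rule rename_inst[OF objs(2) X vlen])
      have D: "wff \<Lambda> (inst d e \<psi>)" by (rule formula_in_inst[OF objs(3) \<psi> ve \<Lambda>])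
      have B': "wff \<Lambda> (rename v B)" by (rule formula_in_rename[OF B v \<Lambda>])
      \<comment> \<open>Roles exchanged: the instance of \<open>\<psi>\<close> just obtained is now
        the side formula, and the push along \<open>f\<close> is unfolded.\<close>
      have "Conj (inst d e \<psi>) (inst c' (\<lambda>\<sigma>. map v (take (c' \<sigma>) (?p \<sigma>))) (push f c c' \<phi>)) \<turnstile>[\<Lambda>] rename v B"
        unfolding conj_inst_push_iff[OF f \<phi> valuation_map[OF objs(2) vp(1) v] D B']
      proof (intro allI impI)
        fix \<Lambda>' v' a
        assume \<Lambda>': "set \<Lambda>' \<subseteq> sorts T" and v': "renaming \<Lambda> \<Lambda>' v'"
          and a: "related f \<Lambda>' a (\<lambda>\<sigma>. map v' (map v (take (c' \<sigma>) (?p \<sigma>))))"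
        \<comment> \<open>The witness \<open>e\<close> for \<open>g\<close> is moved into the newest
          context and appended to the witness for \<open>f\<close>; the result is related by the
          tensor to the image of the generic tuple.\<close>
        let ?b = "\<lambda>\<sigma>. map v' (map v (?p \<sigma>))" and ?a = "\<lambda>\<sigma>. a \<sigma> @ map v' (e \<sigma>)"
        have alen: "length (a \<sigma>) = c \<sigma>" for \<sigma> using related_valuation(1)[OF f a] by (simp add: valuation_def)
        have "related (tensA CT f g) \<Lambda>' ?a ?b"
          unfolding related_tensA_iff[OF f g] using a related_map[OF g e v'] alen
          by (simp add: take_map drop_map)
        then have "inst (tensO CT c d) ?a (lax c d \<phi> \<psi>) \<turnstile>[\<Lambda>'] inst ?n ?b B"
          using r' \<Lambda>' unfolding r by blast
        moreover have "inst ?n ?b B = rename v' (rename v B)"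
          using rename_inst[OF n B, of "\<lambda>\<sigma>. map v (?p \<sigma>)" v'] inst_map_generic[OF n B, of v] plen by simp
        moreover have "inst (tensO CT c d) ?a (lax c d \<phi> \<psi>) = Conj (inst c a \<phi>) (rename v' (inst d e \<psi>))"
          by (subst inst_lax[OF objs(1,3) \<phi> \<psi>]) (simp_all add: alen elen rename_inst[OF objs(3) \<psi> elen])
        ultimately show "Conj (rename v' (inst d e \<psi>)) (inst c a \<phi>) \<turnstile>[\<Lambda>'] rename v' (rename v B)"
          by (simp add: conj_commute_iff)
      qed
      then show "Conj (rename v ?A) (inst d e \<psi>) \<turnstile>[\<Lambda>] rename v B"
        unfolding A' by (simp add: conj_commute_iff)
    qed
  qed
qed

lemma lax_symm_entails_iff:
  assumes c: "c \<in> Objs CT" and d: "d \<in> Objs CT"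
    and \<phi>: "wff (context_of c) \<phi>" and \<psi>: "wff (context_of d) \<psi>" and B: "wff (context_of (tensO CT d c)) B"
  shows "push (symm CT c d) (tensO CT c d) (tensO CT d c) (lax c d \<phi> \<psi>) \<turnstile>[context_of (tensO CT d c)] B \<longleftrightarrow>
    lax d c \<psi> \<phi> \<turnstile>[context_of (tensO CT d c)] B" (is "?l \<longleftrightarrow> ?r")
proof -
  note s = symm_C_in[OF c d] and n = tensO_C_in[OF d c]
  let ?n = "tensO CT d c"
  have l: "?l \<longleftrightarrow> (\<forall>\<Lambda> a b. set \<Lambda> \<subseteq> sorts T \<longrightarrow> related (symm CT c d) \<Lambda> a b \<longrightarrow>
    inst (tensO CT c d) a (lax c d \<phi> \<psi>) \<turnstile>[\<Lambda>] inst ?n b B)"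
    by (rule push_entails_iff[OF s wff_lax[OF c d \<phi> \<psi>] B])
  show ?thesis
  proof
    assume l': ?l
    let ?p = "generic ?n"
    \<comment> \<open>The generic tuple with its halves exchanged, which the symmetry sends back to
      the generic tuple.\<close>
    let ?a = "\<lambda>\<sigma>. drop (d \<sigma>) (?p \<sigma>) @ take (d \<sigma>) (?p \<sigma>)"
    have plen: "length (?p \<sigma>) = d \<sigma> + c \<sigma>" for \<sigma> using valuation_generic[OF n] by (simp add: valuation_def tensO_apply)
    note vp = valuation_split[OF valuation_generic[OF n]]
    have "related (symm CT c d) (context_of ?n) ?a ?p"
      unfolding related_def coprod_fields(10) wrel_symm
    proof
      fix \<sigma>
      show "(?a \<sigma>, ?p \<sigma>) \<in> {(a @ b, b @ a) | a b. length a = c \<sigma> \<and> length b = d \<sigma> \<and>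
        set a \<subseteq> Pos (context_of ?n) \<sigma> \<and> set b \<subseteq> Pos (context_of ?n) \<sigma>}"
        using vp unfolding valuation_def
        by (intro CollectI exI[of _ "drop (d \<sigma>) (?p \<sigma>)"] exI[of _ "take (d \<sigma>) (?p \<sigma>)"] conjI) simp_all
    qed
    then have "inst (tensO CT c d) ?a (lax c d \<phi> \<psi>) \<turnstile>[context_of ?n] inst ?n ?p B"
      using l' set_context_of[OF n] unfolding l by blast
    moreover have "inst (tensO CT c d) ?a (lax c d \<phi> \<psi>) =
      Conj (inst c (\<lambda>\<sigma>. drop (d \<sigma>) (?p \<sigma>)) \<phi>) (inst d (\<lambda>\<sigma>. take (d \<sigma>) (?p \<sigma>)) \<psi>)"
      by (subst inst_lax[OF c d \<phi> \<psi>]) (simp_all add: plen)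
    ultimately show ?r unfolding lax_def inst_generic[OF n B] by (simp add: conj_commute_iff)
  next
    assume r: ?r
    show ?l unfolding l
    proof (intro allI impI)
      fix \<Lambda> a b assume \<Lambda>: "set \<Lambda> \<subseteq> sorts T" and rel: "related (symm CT c d) \<Lambda> a b"
      note val = related_valuation[OF s rel]
      have len: "length (a \<sigma>) = c \<sigma> + d \<sigma>" "length (b \<sigma>) = d \<sigma> + c \<sigma>" for \<sigma>
        using val by (simp_all add: valuation_def tensO_apply)
      have "take (d \<sigma>) (b \<sigma>) = drop (c \<sigma>) (a \<sigma>) \<and> drop (d \<sigma>) (b \<sigma>) = take (c \<sigma>) (a \<sigma>)" for \<sigma>
        using rel unfolding related_def coprod_fields(10) by (auto dest!: spec[of _ \<sigma>] elim!: wrel_symmE)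
      then have "inst ?n b (lax d c \<psi> \<phi>) =
        Conj (inst d (\<lambda>\<sigma>. drop (c \<sigma>) (a \<sigma>)) \<psi>) (inst c (\<lambda>\<sigma>. take (c \<sigma>) (a \<sigma>)) \<phi>)"
        by (simp add: inst_lax[OF d c \<psi> \<phi> len(2)])
      then have "Conj (inst d (\<lambda>\<sigma>. drop (c \<sigma>) (a \<sigma>)) \<psi>) (inst c (\<lambda>\<sigma>. take (c \<sigma>) (a \<sigma>)) \<phi>) \<turnstile>[\<Lambda>] inst ?n b B"
        using inst_mono[OF n val(2) \<Lambda> r] by simp
      then show "inst (tensO CT c d) a (lax c d \<phi> \<psi>) \<turnstile>[\<Lambda>] inst ?n b B"
        unfolding inst_lax[OF c d \<phi> \<psi> len(1)] by (simp add: conj_commute_iff)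
    qed
  qed
qed

text \<open>The case of \<open>Top\<close> and the identity renaming. The cocone with vertex
  \<open>\<Theta>\<close> and legs \<open>id\<close> and \<open>f\<close> is universal, so it alone
  gives the condition. The resulting adjunction supplies the left adjoint of the laxator.\<close>

lemma image_formula_entails_iff:
  assumes f: "renaming \<Gamma> \<Theta> f" and \<chi>: "wff \<Theta> \<chi>" and B: "wff \<Gamma> B"
  shows "image_formula \<Gamma> \<Theta> f \<chi> \<turnstile>[\<Gamma>] B \<longleftrightarrow> \<chi> \<turnstile>[\<Theta>] rename f B"
proof -
  let ?cocones = "\<forall>\<Lambda> u v. set \<Lambda> \<subseteq> sorts T \<and> renaming \<Theta> \<Lambda> u \<and> renaming \<Gamma> \<Lambda> v \<and> (\<forall>i<length \<Gamma>. u (f i) = v (id i)) \<longrightarrow> Conj (rename v Top) (rename u \<chi>) \<turnstile>[\<Lambda>] rename v B"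
  have sorts: "set \<Gamma> \<subseteq> sorts T" "set \<Theta> \<subseteq> sorts T" using \<chi> B by (auto dest: formula_in_sorts)
  have img: "wff \<Gamma> (image_formula \<Gamma> \<Theta> f \<chi>)" using f \<chi> sorts(1) by (rule wff_image_formula)
  have "image_formula \<Gamma> \<Theta> f \<chi> \<turnstile>[\<Gamma>] B \<longleftrightarrow> Conj Top (rename id (image_formula \<Gamma> \<Theta> f \<chi>)) \<turnstile>[\<Gamma>] B"
    by (simp add: Top_conj_iff[OF img])
  also have "\<dots> \<longleftrightarrow> ?cocones"
    by (rule conj_image_formula_entails_iff[OF f \<chi> renaming_id _ B]) (simp add: sorts)
  also have "\<dots> \<longleftrightarrow> \<chi> \<turnstile>[\<Theta>] rename f B"
  proof
    assume *: "?cocones"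
    have "Conj Top \<chi> \<turnstile>[\<Theta>] rename f B"
      using *[rule_format, of \<Theta> id f] sorts(2) f by (simp add: renaming_id)
    then show "\<chi> \<turnstile>[\<Theta>] rename f B" by (simp add: Top_conj_iff[OF \<chi>])
  next
    assume *: "\<chi> \<turnstile>[\<Theta>] rename f B"
    show "?cocones"
    proof (intro allI impI, elim conjE)
      fix \<Lambda> u v assume \<Lambda>: "set \<Lambda> \<subseteq> sorts T" and u: "renaming \<Theta> \<Lambda> u"
        and eq: "\<forall>i<length \<Gamma>. u (f i) = v (id i)"
      have "rename u (rename f B) = rename v B"
        unfolding rename_rename using eq by (intro rename_cong[OF B]) simp
      then have "rename u \<chi> \<turnstile>[\<Lambda>] rename v B" using entails_rename[OF * u \<Lambda>] by simp
      then show "Conj (rename v Top) (rename u \<chi>) \<turnstile>[\<Lambda>] rename v B"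
        by (simp add: Top_conj_iff[OF formula_in_rename[OF \<chi> u \<Lambda>]])
    qed
  qed
  finally show ?thesis .
qed

section \<open>The posets of formulae and the functor\<close>

definition cls :: "'s list \<Rightarrow> ('s, 'r) formula \<Rightarrow> ('s, 'r) formula set" where
  "cls \<Gamma> = refl_class {\<phi>. wff \<Gamma> \<phi>} (provable T \<Gamma>)"

text \<open>The functor acts on classes through a chosen member; monotonicity of \<open>push\<close>
  and \<open>lax\<close> under entailment makes the choice immaterial (\<open>PArr_cls\<close>,
  \<open>laxator_cls\<close>).\<close>

definition rep :: "('s, 'r) formula set \<Rightarrow> ('s, 'r) formula" where
  "rep X = (SOME \<phi>. \<phi> \<in> X)"

lemma mem_cls: "\<psi> \<in> cls \<Gamma> \<phi> \<longleftrightarrow> \<phi> \<turnstile>[\<Gamma>] \<psi> \<and> \<psi> \<turnstile>[\<Gamma>] \<phi>"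
  using entails_wff by (auto simp: cls_def refl_class_def)

lemma carrier_formula_poset: "carrier (formula_poset T \<Gamma>) = cls \<Gamma> ` {\<phi>. wff \<Gamma> \<phi>}"
  by (simp add: formula_poset_def poset_reflection_def cls_def)

lemma cls_in: "wff \<Gamma> \<phi> \<Longrightarrow> cls \<Gamma> \<phi> \<in> carrier (formula_poset T \<Gamma>)"
  by (simp add: carrier_formula_poset)

lemma carrierE:
  assumes "X \<in> carrier (formula_poset T \<Gamma>)" obtains \<phi> where "wff \<Gamma> \<phi>" "X = cls \<Gamma> \<phi>"
  using assms by (auto simp: carrier_formula_poset)

lemma cls_eq: "\<phi> \<turnstile>[\<Gamma>] \<psi> \<Longrightarrow> \<psi> \<turnstile>[\<Gamma>] \<phi> \<Longrightarrow> cls \<Gamma> \<phi> = cls \<Gamma> \<psi>"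
  by (rule Set.set_eqI) (auto simp: mem_cls intro: Cut)

lemma cls_eqI:
  assumes "wff \<Gamma> \<phi>" "wff \<Gamma> \<psi>" "\<And>B. wff \<Gamma> B \<Longrightarrow> \<phi> \<turnstile>[\<Gamma>] B \<longleftrightarrow> \<psi> \<turnstile>[\<Gamma>] B"
  shows "cls \<Gamma> \<phi> = cls \<Gamma> \<psi>"
  using assms Identity by (intro cls_eq) blast+

lemma le_cls:
  assumes "wff \<Gamma> \<phi>" "wff \<Gamma> \<psi>"
  shows "le (formula_poset T \<Gamma>) (cls \<Gamma> \<phi>) (cls \<Gamma> \<psi>) \<longleftrightarrow> \<phi> \<turnstile>[\<Gamma>] \<psi>"
proof -
  have "le (formula_poset T \<Gamma>) (cls \<Gamma> \<phi>) (cls \<Gamma> \<psi>) \<longleftrightarrow> (\<exists>x\<in>cls \<Gamma> \<phi>. \<exists>y\<in>cls \<Gamma> \<psi>. x \<turnstile>[\<Gamma>] y)"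
    by (simp add: formula_poset_def poset_reflection_def)
  also have "\<dots> \<longleftrightarrow> \<phi> \<turnstile>[\<Gamma>] \<psi>"
    unfolding mem_cls Bex_def using assms Identity Cut by blast
  finally show ?thesis .
qed

lemma rep_cls:
  assumes "wff \<Gamma> \<phi>" shows "rep (cls \<Gamma> \<phi>) \<turnstile>[\<Gamma>] \<phi>" "\<phi> \<turnstile>[\<Gamma>] rep (cls \<Gamma> \<phi>)"
proof -
  have "\<phi> \<in> cls \<Gamma> \<phi>" using assms by (simp add: mem_cls Identity)
  then have "rep (cls \<Gamma> \<phi>) \<in> cls \<Gamma> \<phi>" unfolding rep_def by (rule someI)
  then show "rep (cls \<Gamma> \<phi>) \<turnstile>[\<Gamma>] \<phi>" "\<phi> \<turnstile>[\<Gamma>] rep (cls \<Gamma> \<phi>)" by (simp_all add: mem_cls)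
qed

lemma partial_order_formula_poset: "partial_order (formula_poset T \<Gamma>)"
proof -
  have eq: "eq (formula_poset T \<Gamma>) = (=)" by (simp add: formula_poset_def poset_reflection_def)
  show ?thesis
    by unfold_locales (auto simp: eq le_cls mem_cls elim!: carrierE intro: Identity Cut)
qed

lemmas weak_po = partial_order.axioms(1)[OF partial_order_formula_poset]

lemma partial_order_prod:
  assumes A: "partial_order A" and B: "partial_order B" shows "partial_order (prod_poset A B)"
proof -
  interpret A: partial_order A by (rule A)
  interpret B: partial_order B by (rule B)
  show ?thesis
    by unfold_locales
      (auto simp: prod_poset_def intro: A.le_trans B.le_trans)
qed

lemma partial_order_unit: "partial_order unit_poset"
  by unfold_locales (auto simp: unit_poset_def)

text \<open>\<open>PArr\<close> receives a bare family of classes, while \<open>push\<close> needs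
  both ends. Distinct hom-sets are disjoint, so the ends can be recovered from the family.\<close>

definition arr_dom :: "('s \<Rightarrow> cospan set) \<Rightarrow> 's \<Rightarrow> nat" where
  "arr_dom \<omega> = (SOME c. \<exists>d. \<omega> \<in> Homs CT c d)"

definition arr_cod :: "('s \<Rightarrow> cospan set) \<Rightarrow> 's \<Rightarrow> nat" where
  "arr_cod \<omega> = (SOME d. \<exists>c. \<omega> \<in> Homs CT c d)"

lemma arr_dom_cod:
  assumes "\<omega> \<in> Homs CT c d" shows "arr_dom \<omega> = c" "arr_cod \<omega> = d"
  unfolding arr_dom_def arr_cod_def
  using assms po_category.Homs_disjoint[OF po_category_C assms] by (blast intro!: some_equality)+

abbreviation (input) FP where "FP n \<equiv> formula_poset T (context_of n)"

definition formula_functor :: "('s \<Rightarrow> nat, 's \<Rightarrow> cospan set, ('s, 'r) formula set) lax_poset_functor" where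
  "formula_functor = \<lparr>
     PObj = (\<lambda>n. FP n),
     PArr = (\<lambda>\<omega> X. cls (context_of (arr_cod \<omega>)) (push \<omega> (arr_dom \<omega>) (arr_cod \<omega>) (rep X))),
     laxator = (\<lambda>c d (X, Y). cls (context_of (tensO CT c d)) (lax c d (rep X) (rep Y))),
     unit_laxator = (\<lambda>_. cls (context_of (unitO CT)) Top)\<rparr>"

lemma PObj_formula_functor: "PObj formula_functor n = FP n"
  by (simp add: formula_functor_def)

lemma PArr_cls:
  assumes \<omega>: "\<omega> \<in> Homs CT c d" and \<phi>: "wff (context_of c) \<phi>"
  shows "PArr formula_functor \<omega> (cls (context_of c) \<phi>) = cls (context_of d) (push \<omega> c d \<phi>)"
proof -
  have "PArr formula_functor \<omega> X = cls (context_of d) (push \<omega> c d (rep X))" for X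
    by (simp add: formula_functor_def arr_dom_cod[OF \<omega>])
  then show ?thesis by (simp only:) (intro cls_eq push_mono[OF \<omega>] rep_cls[OF \<phi>])
qed

lemma laxator_cls:
  assumes "c \<in> Objs CT" "d \<in> Objs CT" "wff (context_of c) \<phi>" "wff (context_of d) \<psi>"
  shows "laxator formula_functor c d (cls (context_of c) \<phi>, cls (context_of d) \<psi>) =
    cls (context_of (tensO CT c d)) (lax c d \<phi> \<psi>)"
proof -
  have "laxator formula_functor c d (X, Y) = cls (context_of (tensO CT c d)) (lax c d (rep X) (rep Y))" for X Y
    by (simp add: formula_functor_def)
  then show ?thesis
    by (simp only:) (intro cls_eq lax_mono[OF assms(1,2)] rep_cls[OF assms(3)] rep_cls[OF assms(4)])
qed

lemma unit_laxator_eq: "unit_laxator formula_functor x = cls (context_of (unitO CT)) Top"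
  by (simp add: formula_functor_def)

lemma PArr_Ident_eq:
  assumes "c \<in> Objs CT" "X \<in> carrier (FP c)"
  shows "PArr formula_functor (Ident CT c) X = X"
proof -
  obtain \<phi> where \<phi>: "wff (context_of c) \<phi>" "X = cls (context_of c) \<phi>" using assms(2) by (rule carrierE)
  show ?thesis unfolding \<phi>(2) PArr_cls[OF Ident_C_in[OF assms(1)] \<phi>(1)]
    using \<phi>(1) by (intro cls_eqI wff_push[OF Ident_C_in[OF assms(1)]] push_Ident_entails_iff assms(1))
qed

lemma wff_Top: "n \<in> Objs CT \<Longrightarrow> wff (context_of n) Top"
  using set_context_of by simp

lemma cls_conj_assoc:
  assumes "wff \<Gamma> \<phi>" "wff \<Gamma> \<psi>" "wff \<Gamma> \<chi>"
  shows "cls \<Gamma> (Conj (Conj \<phi> \<psi>) \<chi>) = cls \<Gamma> (Conj \<phi> (Conj \<psi> \<chi>))"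
proof (rule cls_eq)
  show "Conj (Conj \<phi> \<psi>) \<chi> \<turnstile>[\<Gamma>] Conj \<phi> (Conj \<psi> \<chi>)"
    using assms by (intro Conj_intro Conj_right conj_entails1 Conj_left) simp_all
  show "Conj \<phi> (Conj \<psi> \<chi>) \<turnstile>[\<Gamma>] Conj (Conj \<phi> \<psi>) \<chi>"
    using assms by (intro Conj_intro Conj_left conj_entails2[OF Conj_left] conj_entails2[OF Conj_right]) simp_all
qed

text \<open>The two bracketings of the objects are equal, and both sides instantiate the three
  formulae at the same consecutive segments of the generic tuple. Only the conjunction is bracketed
  differently.\<close>

lemma lax_assoc:
  assumes c: "c \<in> Objs CT" and d: "d \<in> Objs CT" and e: "e \<in> Objs CT"
    and \<phi>: "wff (context_of c) \<phi>" and \<psi>: "wff (context_of d) \<psi>" and \<chi>: "wff (context_of e) \<chi>"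
  shows "cls (context_of (tensO CT c (tensO CT d e))) (lax (tensO CT c d) e (lax c d \<phi> \<psi>) \<chi>) =
    cls (context_of (tensO CT c (tensO CT d e))) (lax c (tensO CT d e) \<phi> (lax d e \<psi> \<chi>))"
proof -
  have obj: "tensO CT (tensO CT c d) e = tensO CT c (tensO CT d e)" by (simp add: tensO_C_assoc)
  let ?n = "tensO CT c (tensO CT d e)"
  let ?p = "generic ?n"
  note n = tensO_C_in[OF c tensO_C_in[OF d e]]
  have plen: "length (?p \<sigma>) = c \<sigma> + (d \<sigma> + e \<sigma>)" for \<sigma>
    using valuation_generic[OF n] by (simp add: valuation_def tensO_apply)
  let ?A = "inst c (\<lambda>\<sigma>. take (c \<sigma>) (?p \<sigma>)) \<phi>"
    and ?B = "inst d (\<lambda>\<sigma>. take (d \<sigma>) (drop (c \<sigma>) (?p \<sigma>))) \<psi>"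
    and ?D = "inst e (\<lambda>\<sigma>. drop (d \<sigma>) (drop (c \<sigma>) (?p \<sigma>))) \<chi>"
  have l: "lax (tensO CT c d) e (lax c d \<phi> \<psi>) \<chi> = Conj (Conj ?A ?B) ?D"
    unfolding lax_def[of "tensO CT c d"] obj
    by (subst inst_lax[OF c d \<phi> \<psi>]) (simp_all add: plen tensO_apply drop_take add.commute)
  have r: "lax c (tensO CT d e) \<phi> (lax d e \<psi> \<chi>) = Conj ?A (Conj ?B ?D)"
    unfolding lax_def[of c "tensO CT d e"]
    by (subst inst_lax[OF d e \<psi> \<chi>]) (simp_all add: plen)
  have "wff (context_of ?n) (Conj ?A (Conj ?B ?D))"
    unfolding r[symmetric] by (intro wff_lax c d e tensO_C_in \<phi> \<psi> \<chi>)
  then have w: "wff (context_of ?n) ?A" "wff (context_of ?n) ?B" "wff (context_of ?n) ?D" by simp_all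
  show ?thesis unfolding l r
    using w by (rule cls_conj_assoc)
qed

lemma lax_Top_left:
  assumes c: "c \<in> Objs CT" and \<phi>: "wff (context_of c) \<phi>"
  shows "cls (context_of c) (lax (unitO CT) c Top \<phi>) = cls (context_of c) \<phi>"
proof -
  have "lax (unitO CT) c Top \<phi> = Conj Top \<phi>"
    unfolding lax_def tensO_C_unit by (simp add: coprod_fields inst_generic[OF c \<phi>])
  then show ?thesis using \<phi> wff_Top[OF c] by (intro cls_eqI) (simp_all add: Top_conj_iff)
qed

lemma lax_Top_right:
  assumes c: "c \<in> Objs CT" and \<phi>: "wff (context_of c) \<phi>"
  shows "cls (context_of c) (lax c (unitO CT) \<phi> Top) = cls (context_of c) \<phi>"
proof -
  have "length (generic c \<sigma>) = c \<sigma>" for \<sigma>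
    using valuation_generic[OF c] by (simp add: valuation_def)
  then have "lax c (unitO CT) \<phi> Top = Conj \<phi> Top"
    unfolding lax_def tensO_C_unit by (simp add: inst_generic[OF c \<phi>])
  then show ?thesis using \<phi> wff_Top[OF c] by (intro cls_eqI) (simp_all add: Top_conj_iff conj_commute_iff[where \<psi> = Top])
qed

text \<open>The laxator is the conjunction of the two substitutions along \<open>f\<close> and
  \<open>g\<close>, the inclusions of the variables of \<open>c\<close> and \<open>d\<close>. Each
  substitution has existential quantification as left adjoint, so the pair of quantifications is
  left adjoint to the laxator.\<close>

lemma laxator_right_adjoint:
  assumes c: "c \<in> Objs CT" and d: "d \<in> Objs CT"
  shows "right_adjoint (prod_poset (FP c) (FP d))
    (FP (tensO CT c d)) (laxator formula_functor c d)"
proof -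
  let ?n = "tensO CT c d"
  let ?\<Gamma> = "context_of c" and ?\<Delta> = "context_of d" and ?\<Theta> = "context_of ?n"
  note n = tensO_C_in[OF c d]
  note val = valuation_split[OF valuation_generic[OF n]]
  define f g where "f = ren_of c (\<lambda>\<sigma>. take (c \<sigma>) (generic ?n \<sigma>))"
    and "g = ren_of d (\<lambda>\<sigma>. drop (c \<sigma>) (generic ?n \<sigma>))"
  have f: "renaming ?\<Gamma> ?\<Theta> f" and g: "renaming ?\<Delta> ?\<Theta> g"
    unfolding f_def g_def using val by (intro renaming_ren_of[OF c] renaming_ren_of[OF d]; simp)+
  have lax: "lax c d \<phi> \<psi> = Conj (rename f \<phi>) (rename g \<psi>)" for \<phi> \<psi>
    by (simp add: lax_def inst_def f_def g_def)
  let ?l = "\<lambda>X. (cls ?\<Gamma> (image_formula ?\<Gamma> ?\<Theta> f (rep X)), cls ?\<Delta> (image_formula ?\<Delta> ?\<Theta> g (rep X)))"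
  have img: "wff ?\<Gamma> (image_formula ?\<Gamma> ?\<Theta> f \<chi>)" "wff ?\<Delta> (image_formula ?\<Delta> ?\<Theta> g \<chi>)" if "wff ?\<Theta> \<chi>" for \<chi>
    by (rule wff_image_formula[OF f that set_context_of[OF c]], rule wff_image_formula[OF g that set_context_of[OF d]])
  have wff_rep: "wff ?\<Theta> (rep (cls ?\<Theta> \<chi>))" if "wff ?\<Theta> \<chi>" for \<chi> using entails_wff[OF rep_cls(1)[OF that]] by simp
  have adj: "(image_formula ?\<Gamma> ?\<Theta> f (rep (cls ?\<Theta> \<chi>)) \<turnstile>[?\<Gamma>] \<phi> \<and> image_formula ?\<Delta> ?\<Theta> g (rep (cls ?\<Theta> \<chi>)) \<turnstile>[?\<Delta>] \<psi>)
    \<longleftrightarrow> \<chi> \<turnstile>[?\<Theta>] lax c d \<phi> \<psi>" if "wff ?\<Theta> \<chi>" "wff ?\<Gamma> \<phi>" "wff ?\<Delta> \<psi>" for \<chi> \<phi> \<psi>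
    unfolding image_formula_entails_iff[OF f wff_rep[OF that(1)] that(2)]
      image_formula_entails_iff[OF g wff_rep[OF that(1)] that(3)] lax entails_conj_iff
    using rep_cls[OF that(1)] Cut by blast
  have "galois_connection \<lparr>orderA = formula_poset T ?\<Theta>,
    orderB = prod_poset (formula_poset T ?\<Gamma>) (formula_poset T ?\<Delta>), lower = ?l, upper = laxator formula_functor c d\<rparr>"
  proof (intro galois_connection.intro connection.intro galois_connection_axioms.intro; simp)
    show "partial_order (formula_poset T ?\<Theta>)" by (rule partial_order_formula_poset)
    show "partial_order (prod_poset (formula_poset T ?\<Gamma>) (formula_poset T ?\<Delta>))"
      by (intro partial_order_prod partial_order_formula_poset)
    show "?l \<in> carrier (formula_poset T ?\<Theta>) \<rightarrow> carrier (prod_poset (formula_poset T ?\<Gamma>) (formula_poset T ?\<Delta>))"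
      by (auto simp: prod_poset_def elim!: carrierE intro!: cls_in img wff_rep)
    show "laxator formula_functor c d \<in> carrier (prod_poset (formula_poset T ?\<Gamma>) (formula_poset T ?\<Delta>)) \<rightarrow> carrier (formula_poset T ?\<Theta>)"
      by (auto simp: prod_poset_def laxator_cls[OF c d] elim!: carrierE intro!: cls_in wff_lax c d)
    fix X Y
    assume "X \<in> carrier (formula_poset T ?\<Theta>)" "Y \<in> carrier (prod_poset (formula_poset T ?\<Gamma>) (formula_poset T ?\<Delta>))"
    then obtain \<chi> \<phi> \<psi> where *: "wff ?\<Theta> \<chi>" "X = cls ?\<Theta> \<chi>" "wff ?\<Gamma> \<phi>" "wff ?\<Delta> \<psi>" "Y = (cls ?\<Gamma> \<phi>, cls ?\<Delta> \<psi>)"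
      by (auto simp: prod_poset_def elim!: carrierE)
    then show "le (prod_poset (formula_poset T ?\<Gamma>) (formula_poset T ?\<Delta>)) (?l X) Y \<longleftrightarrow>
      le (formula_poset T ?\<Theta>) X (laxator formula_functor c d Y)"
      by (simp add: prod_poset_def laxator_cls[OF c d] le_cls wff_lax[OF c d] img wff_rep adj)
  qed
  then show ?thesis unfolding right_adjoint_def by blast
qed

text \<open>The unit laxator picks the greatest element, which is the right adjoint of the map to a
  point.\<close>

lemma unit_laxator_right_adjoint:
  "right_adjoint unit_poset (FP (unitO CT)) (unit_laxator formula_functor)"
proof -
  let ?\<Gamma> = "context_of (unitO CT)"
  have Top: "wff ?\<Gamma> Top" by (rule wff_Top[OF unitO_C_in])
  have "galois_connection \<lparr>orderA = formula_poset T ?\<Gamma>, orderB = unit_poset, lower = \<lambda>_. (),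
    upper = unit_laxator formula_functor\<rparr>"
  proof (intro galois_connection.intro connection.intro galois_connection_axioms.intro; simp)
    show "partial_order (formula_poset T ?\<Gamma>)" by (rule partial_order_formula_poset)
    show "partial_order unit_poset" by (rule partial_order_unit)
    show "(\<lambda>_. ()) \<in> carrier (formula_poset T ?\<Gamma>) \<rightarrow> carrier unit_poset" by (simp add: unit_poset_def)
    show "unit_laxator formula_functor \<in> carrier unit_poset \<rightarrow> carrier (formula_poset T ?\<Gamma>)"
      by (simp add: unit_laxator_eq cls_in[OF Top])
    fix X assume "X \<in> carrier (formula_poset T ?\<Gamma>)"
    then show "le unit_poset () () \<longleftrightarrow> le (formula_poset T ?\<Gamma>) X (unit_laxator formula_functor ())"
      by (auto simp: unit_poset_def unit_laxator_eq le_cls[OF _ Top] intro: Top_intro elim!: carrierE)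
  qed
  then show ?thesis unfolding right_adjoint_def by blast
qed

lemma right_ajax_formula_functor: "right_ajax CT formula_functor"
proof (intro right_ajax.intro sm_po_category_C right_ajax_axioms.intro; unfold PObj_formula_functor)
  fix c show "partial_order (FP c)" by (rule partial_order_formula_poset)
next
  fix f c d assume f: "f \<in> Homs CT c d"
  show "monotone_map (FP c) (FP d) (PArr formula_functor f)"
    unfolding monotone_map_def isotone_def
    by (auto simp: weak_po PArr_cls[OF f] le_cls wff_push[OF f] elim!: carrierE intro!: cls_in wff_push[OF f] push_mono[OF f])
next
  fix c X assume "c \<in> Objs CT" "X \<in> carrier (FP c)"
  then show "PArr formula_functor (Ident CT c) X = X" by (rule PArr_Ident_eq)
next
  fix f c d g e X
  assume f: "f \<in> Homs CT c d" and g: "g \<in> Homs CT d e" and "X \<in> carrier (FP c)"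
  then obtain \<phi> where \<phi>: "wff (context_of c) \<phi>" "X = cls (context_of c) \<phi>" by (elim carrierE)
  show "PArr formula_functor (comp CT g f) X = PArr formula_functor g (PArr formula_functor f X)"
    unfolding \<phi>(2) PArr_cls[OF f \<phi>(1)] PArr_cls[OF g wff_push[OF f \<phi>(1)]] PArr_cls[OF comp_C_in[OF f g] \<phi>(1)]
    using \<phi>(1) by (intro cls_eqI wff_push[OF g] wff_push[OF f] wff_push[OF comp_C_in[OF f g]] push_comp_entails_iff f g)
next
  fix f g c d X
  assume f: "f \<in> Homs CT c d" and g: "g \<in> Homs CT c d" and le: "leq CT f g"
    and "X \<in> carrier (FP c)"
  then obtain \<phi> where \<phi>: "wff (context_of c) \<phi>" "X = cls (context_of c) \<phi>" by (elim carrierE)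
  show "le (FP d) (PArr formula_functor f X) (PArr formula_functor g X)"
    unfolding \<phi>(2) PArr_cls[OF f \<phi>(1)] PArr_cls[OF g \<phi>(1)] le_cls[OF wff_push[OF f \<phi>(1)] wff_push[OF g \<phi>(1)]]
    by (rule push_leq[OF f g le \<phi>(1)])
next
  fix c d assume c: "c \<in> Objs CT" and d: "d \<in> Objs CT"
  show "monotone_map (prod_poset (FP c) (FP d))
    (FP (tensO CT c d)) (laxator formula_functor c d)"
    unfolding monotone_map_def isotone_def
    using partial_order.axioms(1)[OF partial_order_prod[OF partial_order_formula_poset partial_order_formula_poset]]
    by (auto simp: weak_po prod_poset_def laxator_cls[OF c d] le_cls wff_lax[OF c d]
        elim!: carrierE intro!: cls_in wff_lax[OF c d] lax_mono[OF c d])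
  show "right_adjoint (prod_poset (FP c) (FP d))
    (FP (tensO CT c d)) (laxator formula_functor c d)"
    by (rule laxator_right_adjoint[OF c d])
next
  show "monotone_map unit_poset (FP (unitO CT)) (unit_laxator formula_functor)"
    unfolding monotone_map_def isotone_def using wff_Top[OF unitO_C_in]
    by (auto simp: weak_po partial_order.axioms(1)[OF partial_order_unit] unit_laxator_eq le_cls intro: cls_in[OF wff_Top[OF unitO_C_in]] Identity)
  show "right_adjoint unit_poset (FP (unitO CT)) (unit_laxator formula_functor)"
    by (rule unit_laxator_right_adjoint)
next
  fix f c c' g d d' X Y
  assume f: "f \<in> Homs CT c c'" and g: "g \<in> Homs CT d d'"
    and "X \<in> carrier (FP c)" "Y \<in> carrier (FP d)"
  then obtain \<phi> \<psi> where \<phi>: "wff (context_of c) \<phi>" "X = cls (context_of c) \<phi>"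
    and \<psi>: "wff (context_of d) \<psi>" "Y = cls (context_of d) \<psi>" by (elim carrierE)
  note objs = Homs_C_D(2,3)[OF f] Homs_C_D(2,3)[OF g]
  show "laxator formula_functor c' d' (PArr formula_functor f X, PArr formula_functor g Y) =
    PArr formula_functor (tensA CT f g) (laxator formula_functor c d (X, Y))"
    unfolding \<phi>(2) \<psi>(2) PArr_cls[OF f \<phi>(1)] PArr_cls[OF g \<psi>(1)] laxator_cls[OF objs(1,3) \<phi>(1) \<psi>(1)]
      laxator_cls[OF objs(2,4) wff_push[OF f \<phi>(1)] wff_push[OF g \<psi>(1)]]
      PArr_cls[OF tensA_C_in[OF f g] wff_lax[OF objs(1,3) \<phi>(1) \<psi>(1)]]
    using \<phi>(1) \<psi>(1)
    by (intro cls_eqI wff_push[OF tensA_C_in[OF f g]] wff_lax objs wff_push[OF f] wff_push[OF g]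
        lax_natural_entails_iff f g)
next
  fix c d e X Y Z
  assume c: "c \<in> Objs CT" and d: "d \<in> Objs CT" and e: "e \<in> Objs CT"
    and "X \<in> carrier (FP c)" "Y \<in> carrier (FP d)"
      "Z \<in> carrier (FP e)"
  then obtain \<phi> \<psi> \<chi> where \<phi>: "wff (context_of c) \<phi>" "X = cls (context_of c) \<phi>"
    and \<psi>: "wff (context_of d) \<psi>" "Y = cls (context_of d) \<psi>"
    and \<chi>: "wff (context_of e) \<chi>" "Z = cls (context_of e) \<chi>" by (elim carrierE)
  note cd = tensO_C_in[OF c d] and de = tensO_C_in[OF d e]
  \<comment> \<open>Objects are bracketed strictly, so the associator acts as an identity and
    \<open>lax_assoc\<close> gives the rest.\<close>
  have assoc: "assoc CT c d e = Ident CT (tensO CT c (tensO CT d e))"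
    and obj: "tensO CT (tensO CT c d) e = tensO CT c (tensO CT d e)"
    by (simp_all add: coprod_fields add.assoc)
  show "PArr formula_functor (assoc CT c d e) (laxator formula_functor (tensO CT c d) e (laxator formula_functor c d (X, Y), Z)) =
    laxator formula_functor c (tensO CT d e) (X, laxator formula_functor d e (Y, Z))"
    unfolding \<phi>(2) \<psi>(2) \<chi>(2) laxator_cls[OF c d \<phi>(1) \<psi>(1)] laxator_cls[OF d e \<psi>(1) \<chi>(1)]
      laxator_cls[OF cd e wff_lax[OF c d \<phi>(1) \<psi>(1)] \<chi>(1)] laxator_cls[OF c de \<phi>(1) wff_lax[OF d e \<psi>(1) \<chi>(1)]]
      assoc obj lax_assoc[OF c d e \<phi>(1) \<psi>(1) \<chi>(1)]
    by (intro PArr_Ident_eq cls_in wff_lax tensO_C_in c d e \<phi>(1) \<psi>(1) \<chi>(1))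
next
  fix c X assume c: "c \<in> Objs CT" and X: "X \<in> carrier (FP c)"
  then obtain \<phi> where \<phi>: "wff (context_of c) \<phi>" "X = cls (context_of c) \<phi>" by (elim carrierE)
  note Top = wff_Top[OF unitO_C_in]
  show "PArr formula_functor (lunit CT c) (laxator formula_functor (unitO CT) c (unit_laxator formula_functor (), X)) = X"
    unfolding unit_laxator_eq \<phi>(2) laxator_cls[OF unitO_C_in c Top \<phi>(1)] tensO_C_unit lax_Top_left[OF c \<phi>(1)] coprod_fields(8)
    by (intro PArr_Ident_eq cls_in c \<phi>(1))
  show "PArr formula_functor (runit CT c) (laxator formula_functor c (unitO CT) (X, unit_laxator formula_functor ())) = X"
    unfolding unit_laxator_eq \<phi>(2) laxator_cls[OF c unitO_C_in \<phi>(1) Top] tensO_C_unit lax_Top_right[OF c \<phi>(1)] coprod_fields(9)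
    by (intro PArr_Ident_eq cls_in c \<phi>(1))
next
  fix c d X Y
  assume c: "c \<in> Objs CT" and d: "d \<in> Objs CT"
    and "X \<in> carrier (FP c)" "Y \<in> carrier (FP d)"
  then obtain \<phi> \<psi> where \<phi>: "wff (context_of c) \<phi>" "X = cls (context_of c) \<phi>"
    and \<psi>: "wff (context_of d) \<psi>" "Y = cls (context_of d) \<psi>" by (elim carrierE)
  show "PArr formula_functor (symm CT c d) (laxator formula_functor c d (X, Y)) = laxator formula_functor d c (Y, X)"
    unfolding \<phi>(2) \<psi>(2) laxator_cls[OF c d \<phi>(1) \<psi>(1)] laxator_cls[OF d c \<psi>(1) \<phi>(1)]
      PArr_cls[OF symm_C_in[OF c d] wff_lax[OF c d \<phi>(1) \<psi>(1)]]
    using \<phi>(1) \<psi>(1)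
    by (intro cls_eqI wff_push[OF symm_C_in[OF c d]] wff_lax c d lax_symm_entails_iff)
qed

end

theorem theorem4p22:
  fixes T :: "('s, 'r) reg_theory"
  assumes "regular_theory T"
  shows "\<exists>F. regular_calculus (coprod_WW (sorts T)) coprod_supply F \<and>
           (\<forall>n \<in> Objs (coprod_WW (sorts T)). PObj F n = formula_poset T (context_of n))"
proof (intro exI conjI ballI)
  interpret regular_theory T by (rule assms)
  show "regular_calculus (coprod_WW (sorts T)) coprod_supply formula_functor"
    by (intro regular_calculus.intro supplies_WW_C right_ajax_formula_functor)
  show "PObj formula_functor n = formula_poset T (context_of n)" for n
    by (rule PObj_formula_functor)
qed

end
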